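(* Consider the closed-loop Markov-jumping system $$\partial_t u+\lambda(t)\partial_x u=\sigma^+(t)v,\quad \partial_t v-\mu(t)\partial_x v=\sigma^-(t)u,\quad D\,\partial_t\eta=\partial_x\eta\qquad (x\in[0,1],\ t\ge 0),$$ $$u(0,t)=\phi(t)v(0,t),\quad v(1,t)=\eta(0,t),\quad \eta(1,t)=U(t),$$ $$U(t)=\int_0^1 p(1-\xi)\eta(\xi,t)\,d\xi+\int_0^1 q_1(1,\xi)u(\xi,t)\,d\xi+\int_0^1 q_2(1,\xi)v(\xi,t)\,d\xi ,$$ with data as in the context. For any initial conditions $(u^0,v^0,\eta^0)\in L^2([0,1])^3$ the closed-loop system is well-posed in the sense that there exists a unique solution $(u,v,\eta)$ such that, for any initial mode $\delta(0)$ and any $t\ge0$, $$\mathbb E_{[0,(u^0,v^0,\eta^0,\delta(0))]}\left[\|(u(\cdot,t),v(\cdot,t),\eta(\cdot,t))\|_{L^2}^2\right]<\infty .$$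
   Context: **Markov-jumping parameters.** $D>0$ is a known constant delay. $\theta(t)$ is a right-continuous Markov process with finite state space $\mathcal R=\{1,\dots,r\}$ and transition probabilities $P_{ij}(s,t)=\mathbb P\{\theta(t)=j\mid\theta(s)=i\}$ satisfying $\partial_tP_{ij}(s,t)=\sum_{k\ne j}P_{ik}(s,t)\tau_{kj}(t)-P_{ij}(s,t)\sum_{\ell\ne j}\tau_{j\ell}(t)$, $P_{ii}(s,s)=1$, $P_{ij}(s,s)=0$ ($i\neq j$), with rates $\tau_{ij}(t)\ge0$ ($i\ne j$), $\tau_{ii}=0$, and $\sum_{\ell\ne i}\tau_{i\ell}(t)\le\tau^\star<\infty$ for all $i\in\mathcal R$, $t\ge0$ (so the process is non-explosive). When $\theta(t)=j$ the active coefficients are $\delta(t)=\delta_j=(\lambda_j,\mu_j,\sigma_j^+,\sigma_j^-,\phi_j)$, i.e. $\lambda(t)=\lambda_j$, $\mu(t)=\mu_j$, $\sigma^\pm(t)=\sigma^\pm_j$, $\phi(t)=\phi_j$. For all $j\in\mathcal R$: $0<\underline\lambda\le\lambda_j\le\bar\lambda$, $0<\underline\mu\le\mu_j\le\bar\mu$, $\underline\sigma^\pm\le\sigma_j^\pm\le\bar\sigma^\pm$, $\underline\phi\le\phi_j\le\bar\phi$. The nominal vector $\delta_0=(\lambda_0,\mu_0,\sigma_0^+,\sigma_0^-,\phi_0)$ is fixed, with $\lambda_0>0$, $\mu_0>0$, $\phi_0\neq0$. **Delay state and solutions.** $\eta(x,t)$ is the transport representation of the input delay, so that $v(1,t)=U(t-D)$.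 The PDE state is not reset at jump times: a solution is understood pathwise (for almost every sample path of $\theta$), as a function of time with values in $L^2([0,1])^3$, continuous at the jump times, which on each interval between consecutive jump times is the (semigroup) solution of the closed-loop system with coefficients frozen at the active mode. $\mathbb E_{[0,(u^0,v^0,\eta^0,\delta(0))]}$ is the expectation conditional on the data $(u^0,v^0,\eta^0,\delta(0))$ at time $0$. **Nominal controller kernels.** On $\mathcal T_1=\{0\le\xi\le x\le1\}$ the kernels $K^{vu},K^{vv}$ solve $\mu_0\partial_xK^{vu}-\lambda_0\partial_\xi K^{vu}=\sigma_0^-K^{vv}$, $\mu_0(\partial_x+\partial_\xi)K^{vv}=\sigma_0^+K^{vu}$, $K^{vu}(x,x)=-\frac{\sigma_0^-}{\lambda_0+\mu_0}$, $K^{vv}(x,0)=\frac{\lambda_0\phi_0}{\mu_0}K^{vu}(x,0)$. On $\mathcal T_2=[0,1]^2$, $q_1,q_2$ solve $\frac1D\partial_xq_1-\lambda_0\partial_\xi q_1=\sigma_0^-q_2$, $\frac1D\partial_xq_2+\mu_0\partial_\xi q_2=\sigma_0^+q_1$, with $q_1(x,1)=0$, $q_1(x,0)=\frac{\mu_0}{\phi_0\lambda_0}q_2(x,0)$, $q_1(0,\xi)=K^{vu}(1,\xi)$, $q_2(0,\xi)=K^{vv}(1,\xi)$; and $p(x)=D\mu_0q_2(x,1)$. The kernels $K^{vu},K^{vv},q_1,q_2,p$ are well defined and bounded. *)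

theory Defs
  imports "HOL-Probability.Probability"
begin

definition sq_integrable :: "(real \<Rightarrow> real) \<Rightarrow> bool" where
  "sq_integrable f \<longleftrightarrow>
     f \<in> borel_measurable (lebesgue_on {0..1}) \<and> integrable (lebesgue_on {0..1}) (\<lambda>x. (f x)\<^sup>2)"

lemma sq_integrable_zero: "sq_integrable (\<lambda>x. 0)"
  by (simp add: sq_integrable_def)

lemma sq_integrable_scale:
  assumes "sq_integrable f"
  shows "sq_integrable (\<lambda>x. c * f x)"
  using assms by (auto simp: sq_integrable_def power_mult_distrib)

lemma sq_integrable_mult:
  assumes "sq_integrable f" "sq_integrable g"
  shows "integrable (lebesgue_on {0..1}) (\<lambda>x. f x * g x)"
proof (rule Bochner_Integration.integrable_bound)
  show "integrable (lebesgue_on {0..1}) (\<lambda>x. (f x)\<^sup>2 + (g x)\<^sup>2)"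
    using assms by (auto simp: sq_integrable_def)
  show "(\<lambda>x. f x * g x) \<in> borel_measurable (lebesgue_on {0..1})"
    using assms by (auto simp: sq_integrable_def)
  have "\<bar>a * b\<bar> \<le> a\<^sup>2 + b\<^sup>2" for a b :: real
  proof -
    have "2 * (\<bar>a\<bar> * \<bar>b\<bar>) \<le> \<bar>a\<bar>\<^sup>2 + \<bar>b\<bar>\<^sup>2"
      using sum_squares_bound[of "\<bar>a\<bar>" "\<bar>b\<bar>"] by simp
    moreover have "0 \<le> \<bar>a\<bar> * \<bar>b\<bar>" by simp
    ultimately show ?thesis unfolding abs_mult by (simp only: power2_abs)
  qed
  then show "AE x in lebesgue_on {0..1}. norm (f x * g x) \<le> norm ((f x)\<^sup>2 + (g x)\<^sup>2)"
    by (auto intro: order_trans)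
qed

lemma sq_integrable_add:
  assumes "sq_integrable f" "sq_integrable g"
  shows "sq_integrable (\<lambda>x. f x + g x)"
proof -
  have "integrable (lebesgue_on {0..1}) (\<lambda>x. (f x)\<^sup>2 + (g x)\<^sup>2 + 2 * (f x * g x))"
    using assms sq_integrable_mult[OF assms] by (auto simp: sq_integrable_def)
  then show ?thesis
    using assms by (auto simp: sq_integrable_def power2_sum mult.assoc)
qed

quotient_type L2 = "real \<Rightarrow> real" / partial:
  "\<lambda>f g. sq_integrable f \<and> sq_integrable g \<and> (AE x in lebesgue_on {0..1}. f x = g x)"
proof (rule part_equivpI)
  show "\<exists>f. sq_integrable f \<and> sq_integrable f \<and> (AE x in lebesgue_on {0..1}. f x = f x)"
    using sq_integrable_zero by auto
  show "symp (\<lambda>f g. sq_integrable f \<and> sq_integrable g \<and> (AE x in lebesgue_on {0..1}. f x = g x))"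
    by (auto intro!: sympI elim: AE_mp)
  show "transp (\<lambda>f g. sq_integrable f \<and> sq_integrable g \<and> (AE x in lebesgue_on {0..1}. f x = g x))"
    by (rule transpI) (auto elim: AE_mp)
qed

instantiation L2 :: real_inner
begin

lift_definition zero_L2 :: L2 is "\<lambda>x. 0"
  by (simp add: sq_integrable_zero)

lift_definition plus_L2 :: "L2 \<Rightarrow> L2 \<Rightarrow> L2" is "\<lambda>f g x. f x + g x"
  by (auto simp: sq_integrable_add)

lift_definition scaleR_L2 :: "real \<Rightarrow> L2 \<Rightarrow> L2" is "\<lambda>c f x. c * f x"
  by (auto simp: sq_integrable_scale)

lift_definition uminus_L2 :: "L2 \<Rightarrow> L2" is "\<lambda>f x. - f x"
  using sq_integrable_scale[where c = "-1"] by auto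

lift_definition minus_L2 :: "L2 \<Rightarrow> L2 \<Rightarrow> L2" is "\<lambda>f g x. f x - g x"
  using sq_integrable_add[OF _ sq_integrable_scale[where c = "-1"]] by auto

lift_definition inner_L2 :: "L2 \<Rightarrow> L2 \<Rightarrow> real" is
  "\<lambda>f g. LINT x|lebesgue_on {0..1}. f x * g x"
proof -
  fix f f' g g' :: "real \<Rightarrow> real"
  assume f: "sq_integrable f \<and> sq_integrable f' \<and> (AE x in lebesgue_on {0..1}. f x = f' x)"
    and g: "sq_integrable g \<and> sq_integrable g' \<and> (AE x in lebesgue_on {0..1}. g x = g' x)"
  show "(LINT x|lebesgue_on {0..1}. f x * g x) = (LINT x|lebesgue_on {0..1}. f' x * g' x)"
  proof (rule integral_cong_AE)
    show "(\<lambda>x. f x * g x) \<in> borel_measurable (lebesgue_on {0..1})"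
      "(\<lambda>x. f' x * g' x) \<in> borel_measurable (lebesgue_on {0..1})"
      using f g by (auto simp: sq_integrable_def)
    show "AE x in lebesgue_on {0..1}. f x * g x = f' x * g' x"
      using f g by auto
  qed
qed

definition norm_L2 :: "L2 \<Rightarrow> real" where "norm_L2 f = sqrt (inner f f)"

definition dist_L2 :: "L2 \<Rightarrow> L2 \<Rightarrow> real" where "dist_L2 f g = norm (f - g)"

definition sgn_L2 :: "L2 \<Rightarrow> L2" where "sgn_L2 f = inverse (norm f) *\<^sub>R f"

definition uniformity_L2 :: "(L2 \<times> L2) filter" where
  "uniformity_L2 = (INF e\<in>{0<..}. principal {(x, y). dist x y < e})"

definition open_L2 :: "L2 set \<Rightarrow> bool" where
  "open_L2 U \<longleftrightarrow> (\<forall>x\<in>U. \<forall>\<^sub>F (x', y) in uniformity. x' = x \<longrightarrow> y \<in> U)"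

instance
proof
  fix a b c :: L2 and s t :: real
  show "a + b + c = a + (b + c)"
    by transfer (auto simp: sq_integrable_add add.assoc)
  show "a + b = b + a"
    by transfer (auto simp: sq_integrable_add add.commute)
  show "0 + a = a"
    by transfer auto
  show "- a + a = 0"
    by transfer (auto simp: sq_integrable_zero)
  show "a - b = a + - b"
    using sq_integrable_add[OF _ sq_integrable_scale[where c = "-1"]]
    by transfer auto
  show "s *\<^sub>R (a + b) = s *\<^sub>R a + s *\<^sub>R b"
    by transfer (auto simp: sq_integrable_add sq_integrable_scale algebra_simps)
  show "(s + t) *\<^sub>R a = s *\<^sub>R a + t *\<^sub>R a"
    by transfer (auto simp: sq_integrable_add sq_integrable_scale distrib_right)
  show "s *\<^sub>R t *\<^sub>R a = (s * t) *\<^sub>R a"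
    using sq_integrable_scale by transfer (auto simp: mult.assoc)
  show "1 *\<^sub>R a = a"
    by transfer auto
  show "dist a b = norm (a - b)" by (rule dist_L2_def)
  show "sgn a = inverse (norm a) *\<^sub>R a" by (rule sgn_L2_def)
  show "uniformity = (INF e\<in>{0<..}. principal {(x :: L2, y). dist x y < e})"
    by (rule uniformity_L2_def)
  show "open U = (\<forall>x\<in>U. \<forall>\<^sub>F (x', y) in uniformity. x' = x \<longrightarrow> y \<in> U)" for U :: "L2 set"
    by (rule open_L2_def)
  show "norm a = sqrt (inner a a)" by (rule norm_L2_def)
  show "inner a b = inner b a"
    by transfer (simp add: mult.commute)
  show "inner (a + b) c = inner a c + inner b c"
    by transfer (simp add: distrib_right sq_integrable_mult)
  show "inner (s *\<^sub>R a) b = s * inner a b"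
    by transfer (simp add: mult.assoc)
  show "0 \<le> inner a a"
    by transfer simp
  show "inner a a = 0 \<longleftrightarrow> a = 0"
  proof transfer
    fix f :: "real \<Rightarrow> real"
    assume "sq_integrable f \<and> sq_integrable f \<and> (AE x in lebesgue_on {0..1}. f x = f x)"
    then have f: "sq_integrable f" by simp
    have "(LINT x|lebesgue_on {0..1}. f x * f x) = 0 \<longleftrightarrow> (AE x in lebesgue_on {0..1}. f x * f x = 0)"
      by (rule integral_nonneg_eq_0_iff_AE[OF sq_integrable_mult[OF f f]]) simp
    then show "(LINT x|lebesgue_on {0..1}. f x * f x) = 0 \<longleftrightarrow>
        sq_integrable f \<and> sq_integrable (\<lambda>x. 0) \<and> (AE x in lebesgue_on {0..1}. f x = 0)"
      using f sq_integrable_zero by simp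
  qed
qed

end

type_synonym state = "L2 \<times> L2 \<times> L2"

definition C0_semigroup :: "(real \<Rightarrow> 'a \<Rightarrow> 'a::real_normed_vector) \<Rightarrow> bool" where
  "C0_semigroup T \<longleftrightarrow>
     (\<forall>t\<ge>0. bounded_linear (T t)) \<and>
     (\<forall>x. T 0 x = x) \<and>
     (\<forall>s\<ge>0. \<forall>t\<ge>0. \<forall>x. T (s + t) x = T s (T t x)) \<and>
     (\<forall>x. ((\<lambda>t. T t x) \<longlongrightarrow> x) (at_right 0))"

text \<open>Unbounded operators are represented by their graphs.\<close>

definition generator :: "(real \<Rightarrow> 'a \<Rightarrow> 'a::real_normed_vector) \<Rightarrow> ('a \<times> 'a) set" where
  "generator T = {(x, y). ((\<lambda>h. (T h x - x) /\<^sub>R h) \<longlongrightarrow> y) (at_right 0)}"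

record coeffs =
  lam :: real
  mu :: real
  sigp :: real
  sigm :: real
  phi :: real

text \<open>\<open>H1 f f'\<close>: the function \<open>f\<close> is the (absolutely) continuous representative on \<open>[0,1]\<close> of an
  element of the Sobolev space \<open>H\<^sup>1(0,1)\<close>, and \<open>f'\<close> represents its weak derivative.\<close>

definition H1 :: "(real \<Rightarrow> real) \<Rightarrow> (real \<Rightarrow> real) \<Rightarrow> bool" where
  "H1 f f' \<longleftrightarrow> sq_integrable f' \<and> (\<forall>x\<in>{0..1}. f x = f 0 + integral {0..x} f')"

definition control ::
  "(real \<Rightarrow> real) \<Rightarrow> (real \<Rightarrow> real \<Rightarrow> real) \<Rightarrow> (real \<Rightarrow> real \<Rightarrow> real) \<Rightarrow>
   (real \<Rightarrow> real) \<Rightarrow> (real \<Rightarrow> real) \<Rightarrow> (real \<Rightarrow> real) \<Rightarrow> real" where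
  "control p q1 q2 u v \<eta> =
     integral {0..1} (\<lambda>\<xi>. p (1 - \<xi>) * \<eta> \<xi>) +
     integral {0..1} (\<lambda>\<xi>. q1 1 \<xi> * u \<xi>) +
     integral {0..1} (\<lambda>\<xi>. q2 1 \<xi> * v \<xi>)"

text \<open>Writing the system for one fixed mode as \<open>X' = A X\<close> with \<open>X = (u, v, \<eta>)\<close>, this is the
  graph of \<open>A\<close>; the boundary conditions and the feedback law constitute its domain.\<close>

definition closed_loop_op ::
  "real \<Rightarrow> (real \<Rightarrow> real) \<Rightarrow> (real \<Rightarrow> real \<Rightarrow> real) \<Rightarrow> (real \<Rightarrow> real \<Rightarrow> real) \<Rightarrow> coeffs \<Rightarrow>
   (state \<times> state) set" where
  "closed_loop_op D p q1 q2 c =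
     {((abs_L2 u, abs_L2 v, abs_L2 \<eta>),
       (abs_L2 (\<lambda>x. - lam c * u' x + sigp c * v x),
        abs_L2 (\<lambda>x. mu c * v' x + sigm c * u x),
        abs_L2 (\<lambda>x. \<eta>' x / D))) | u v \<eta> u' v' \<eta>'.
      H1 u u' \<and> H1 v v' \<and> H1 \<eta> \<eta>' \<and>
      u 0 = phi c * v 0 \<and> v 1 = \<eta> 0 \<and> \<eta> 1 = control p q1 q2 u v \<eta>}"

text \<open>\<open>transport_on S a b f g\<close>: the function \<open>f\<close> solves \<open>a \<partial>\<^sub>x f + b \<partial>\<^sub>\<xi> f = g\<close> on the
  convex set \<open>S\<close>, integrated along characteristics.  A classical reading would be too strong:
  \<open>q\<^sub>1\<close> has incompatible boundary values at the corner \<open>(0,1)\<close> unless \<open>\<sigma>\<^sub>0\<^sup>- = 0\<close>, so \<open>q\<^sub>1\<close> and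
  \<open>q\<^sub>2\<close> jump across characteristics.\<close>

definition transport_on ::
  "(real \<times> real) set \<Rightarrow> real \<Rightarrow> real \<Rightarrow> (real \<Rightarrow> real \<Rightarrow> real) \<Rightarrow> (real \<Rightarrow> real \<Rightarrow> real) \<Rightarrow> bool" where
  "transport_on S a b f g \<longleftrightarrow>
     (\<forall>x \<xi> h. 0 \<le> h \<and> (x, \<xi>) \<in> S \<and> (x + h * a, \<xi> + h * b) \<in> S \<longrightarrow>
        ((\<lambda>s. g (x + s * a) (\<xi> + s * b)) has_integral (f (x + h * a) (\<xi> + h * b) - f x \<xi>)) {0..h})"

definition bounded_kernel :: "(real \<times> real) set \<Rightarrow> (real \<Rightarrow> real \<Rightarrow> real) \<Rightarrow> bool" where
  "bounded_kernel S f \<longleftrightarrow>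
     case_prod f \<in> borel_measurable (restrict_space borel S) \<and> bounded (case_prod f ` S)"

definition T1 :: "(real \<times> real) set" where
  "T1 = {(x, \<xi>). 0 \<le> \<xi> \<and> \<xi> \<le> x \<and> x \<le> 1}"

definition T2 :: "(real \<times> real) set" where
  "T2 = {0..1} \<times> {0..1}"

definition backstepping_kernels ::
  "coeffs \<Rightarrow> (real \<Rightarrow> real \<Rightarrow> real) \<Rightarrow> (real \<Rightarrow> real \<Rightarrow> real) \<Rightarrow> bool" where
  "backstepping_kernels c Kvu Kvv \<longleftrightarrow>
     bounded_kernel T1 Kvu \<and> bounded_kernel T1 Kvv \<and>
     transport_on T1 (mu c) (- lam c) Kvu (\<lambda>x \<xi>. sigm c * Kvv x \<xi>) \<and>
     transport_on T1 (mu c) (mu c) Kvv (\<lambda>x \<xi>. sigp c * Kvu x \<xi>) \<and>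
     (\<forall>x\<in>{0..1}. Kvu x x = - (sigm c / (lam c + mu c))) \<and>
     (\<forall>x\<in>{0..1}. Kvv x 0 = lam c * phi c / mu c * Kvu x 0)"

text \<open>The two conflicting boundary conditions for \<open>q\<^sub>1\<close> are not imposed at their common
  point \<open>(0,1)\<close>.\<close>

definition predictor_kernels ::
  "real \<Rightarrow> coeffs \<Rightarrow> (real \<Rightarrow> real \<Rightarrow> real) \<Rightarrow> (real \<Rightarrow> real \<Rightarrow> real) \<Rightarrow>
   (real \<Rightarrow> real \<Rightarrow> real) \<Rightarrow> (real \<Rightarrow> real \<Rightarrow> real) \<Rightarrow> (real \<Rightarrow> real) \<Rightarrow> bool" where
  "predictor_kernels D c Kvu Kvv q1 q2 p \<longleftrightarrow>
     bounded_kernel T2 q1 \<and> bounded_kernel T2 q2 \<and>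
     transport_on T2 (1 / D) (- lam c) q1 (\<lambda>x \<xi>. sigm c * q2 x \<xi>) \<and>
     transport_on T2 (1 / D) (mu c) q2 (\<lambda>x \<xi>. sigp c * q1 x \<xi>) \<and>
     (\<forall>x\<in>{0<..1}. q1 x 1 = 0) \<and>
     (\<forall>x\<in>{0..1}. q1 x 0 = mu c / (phi c * lam c) * q2 x 0) \<and>
     (\<forall>\<xi>\<in>{0..<1}. q1 0 \<xi> = Kvu 1 \<xi>) \<and>
     (\<forall>\<xi>\<in>{0..1}. q2 0 \<xi> = Kvv 1 \<xi>) \<and>
     (\<forall>x\<in>{0..1}. p x = D * mu c * q2 x 1)"

definition transition_probabilities ::
  "nat \<Rightarrow> (nat \<Rightarrow> nat \<Rightarrow> real \<Rightarrow> real) \<Rightarrow> (nat \<Rightarrow> nat \<Rightarrow> real \<Rightarrow> real \<Rightarrow> real) \<Rightarrow> bool" where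
  "transition_probabilities r \<tau> P \<longleftrightarrow>
     (\<forall>i\<in>{1..r}. \<forall>s\<ge>0. \<forall>t\<ge>s. (\<forall>j\<in>{1..r}. 0 \<le> P i j s t) \<and> (\<Sum>j\<in>{1..r}. P i j s t) = 1) \<and>
     (\<forall>i\<in>{1..r}. \<forall>j\<in>{1..r}. \<forall>s\<ge>0. P i j s s = (if i = j then 1 else 0)) \<and>
     (\<forall>i\<in>{1..r}. \<forall>j\<in>{1..r}. \<forall>s\<ge>0. \<forall>t\<ge>s.
        ((\<lambda>t. P i j s t) has_real_derivative
          (\<Sum>k\<in>{1..r} - {j}. P i k s t * \<tau> k j t) - P i j s t * (\<Sum>l\<in>{1..r} - {j}. \<tau> j l t))
        (at t within {s..}))"

definition past :: "'w measure \<Rightarrow> (real \<Rightarrow> 'w \<Rightarrow> nat) \<Rightarrow> real \<Rightarrow> 'w measure" where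
  "past M \<theta> s = sigma (space M) (\<Union>u\<in>{0..s}. {\<theta> u -` B \<inter> space M | B. True})"

definition markov_process ::
  "'w measure \<Rightarrow> nat \<Rightarrow> (nat \<Rightarrow> nat \<Rightarrow> real \<Rightarrow> real \<Rightarrow> real) \<Rightarrow> (real \<Rightarrow> 'w \<Rightarrow> nat) \<Rightarrow> bool" where
  "markov_process M r P \<theta> \<longleftrightarrow>
     (\<forall>t\<ge>0. \<theta> t \<in> measurable M (count_space UNIV)) \<and>
     (\<forall>\<omega>\<in>space M. \<forall>t\<ge>0. \<theta> t \<omega> \<in> {1..r}) \<and>
     (\<forall>\<omega>\<in>space M. \<forall>t\<ge>0. continuous (at_right t) (\<lambda>s. \<theta> s \<omega>)) \<and>
     (\<forall>s\<ge>0. \<forall>t\<ge>s. \<forall>j\<in>{1..r}. AE \<omega> in M.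
        real_cond_exp M (past M \<theta> s) (indicator {\<omega>\<in>space M. \<theta> t \<omega> = j}) \<omega> = P (\<theta> s \<omega>) j s t)"

definition jump_time :: "(real \<Rightarrow> nat) \<Rightarrow> real \<Rightarrow> bool" where
  "jump_time m t \<longleftrightarrow> 0 < t \<and> \<not> isCont m t"

text \<open>\<open>A j\<close> is the graph of the operator of mode \<open>j\<close>, and \<open>m\<close> is a sample path of the mode
  process.  By right-continuity the mode is \<open>m a\<close> throughout a jump-free interval \<open>[a,b)\<close>.\<close>

definition path_solution ::
  "(nat \<Rightarrow> ('a \<times> 'a) set) \<Rightarrow> (real \<Rightarrow> nat) \<Rightarrow> 'a \<Rightarrow> (real \<Rightarrow> 'a::real_normed_vector) \<Rightarrow> bool" where
  "path_solution A m x0 x \<longleftrightarrow>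
     x 0 = x0 \<and>
     (\<forall>t. jump_time m t \<longrightarrow> isCont x t) \<and>
     (\<forall>a b. (a = 0 \<or> jump_time m a) \<and> a < b \<and> (\<forall>s\<in>{a<..<b}. \<not> jump_time m s) \<longrightarrow>
        (\<exists>T. C0_semigroup T \<and> generator T = A (m a) \<and> (\<forall>t\<in>{a..<b}. x t = T (t - a) (x a))))"

definition solution ::
  "'w measure \<Rightarrow> (nat \<Rightarrow> ('a \<times> 'a) set) \<Rightarrow> (real \<Rightarrow> 'w \<Rightarrow> nat) \<Rightarrow> 'a \<Rightarrow>
   (real \<Rightarrow> 'w \<Rightarrow> 'a::real_normed_vector) \<Rightarrow> bool" where
  "solution M A \<theta> x0 X \<longleftrightarrow> (AE \<omega> in M. path_solution A (\<lambda>t. \<theta> t \<omega>) x0 (\<lambda>t. X t \<omega>))"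

end

(* In the weighted norm |u|^2 + b |v|^2 + g |eta|^2, with weights chosen once for all modes, the boundary
   terms of the energy identity have the right sign and the feedback is a bounded functional, so every
   mode operator is quasi-dissipative with the same constants.  Its resolvent equation is solved by Banach's
   fixed point theorem around the pure transport problem, which in turn reduces to coercivity of the Volterra
   operator f |-> int_0^x f.  The implicit Euler scheme then yields the mode semigroups, quasi-contractive in
   the common norm, and a C0-semigroup is determined by its generator.
   Since the jump rates are bounded, the expected number of mode changes seen on a dyadic grid is bounded
   uniformly in the mesh, so almost every path has no accumulation of jumps; along such a path the solution is
   the limit of products of semigroups with the mode frozen on dyadic intervals.  These products depend on
   finitely many values of the path, which gives measurability, and they satisfy the deterministic bound
   exp (w t) |x0|, which gives the finite second moment. *)

theory Submission
  imports Defs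
begin

subsection \<open>Strongly continuous semigroups are locally bounded\<close>

text \<open>An element of \<open>L2\<close> has no boundary values, so an \<open>H1\<close> function
  is coded by its value a at 0 and its derivative U', as U = a 1 + V U' with the Volterra operator
  V. Traces become the scalars a and a + <1,U'>, boundary conditions become algebra, and every
  integration by parts is the one identity 2 <V F,F> = <1,F>^2. \<open>path_solution\<close> admits
  any C0-semigroup with the right generator, so uniqueness has to compare the Euler semigroup with
  one for which no growth bound is given; a uniform boundedness argument supplies a local bound. The
  semigroup estimates are telescoping sums of one-step errors. Halving a step costs a quadratic
  error on the domain of A^2, hence the density of that domain. Jump times are never enumerated:
  pathwise claims go by induction over real time, and the step from [0,t) to t is where
  non-accumulation of jumps enters. The approximants are functions of finitely many natural numbers,
  so they are measurable even for the discrete sigma-algebra on the state space, and afterwards only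
  limits of their norms are taken.\<close>

lemma bounded_linear_translate_bound:
  assumes f: "bounded_linear (f :: 'a::real_normed_vector \<Rightarrow> 'b::real_normed_vector)"
    and big: "K * norm z < norm (f z)" and e: "0 < e"
  shows "\<exists>x'. norm (x' - x) \<le> e \<and> K * e \<le> norm (f x')"
proof -
  have z: "z \<noteq> 0" using big linear_0[OF bounded_linear.linear[OF f]] by auto
  interpret f: bounded_linear f by fact
  define y where "y = (e / norm z) *\<^sub>R z"
  have y: "norm y = e" using z e by (simp add: y_def)
  have fy: "K * e \<le> norm (f y)"
  proof -
    have "norm (f y) = (e / norm z) * norm (f z)" using e by (simp add: y_def f.scaleR)
    also have "\<dots> \<ge> (e / norm z) * (K * norm z)"
      using big e by (intro mult_left_mono) auto
    finally show ?thesis using z by (simp add: mult.commute)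
  qed
  \<comment> \<open>Since 2 y = (x + y) - (x - y), at least one of the two opposite displacements of
    x has an image as large as that of y, whatever f x is.\<close>
  have "2 * norm (f y) \<le> norm (f (x + y)) + norm (f (x - y))"
  proof -
    have "2 * norm (f y) = norm (f (x + y) - f (x - y))"
      by (simp add: f.add f.diff scaleR_2[symmetric])
    also have "\<dots> \<le> norm (f (x + y)) + norm (f (x - y))" by (rule norm_triangle_ineq4)
    finally show ?thesis .
  qed
  then have "K * e \<le> norm (f (x + y)) \<or> K * e \<le> norm (f (x - y))" using fy by linarith
  then show ?thesis
  proof
    assume "K * e \<le> norm (f (x + y))"
    then show ?thesis using y by (intro exI[of _ "x + y"]) simp
  next
    assume "K * e \<le> norm (f (x - y))"
    then show ?thesis using y by (intro exI[of _ "x - y"]) simp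
  qed
qed

text \<open>Gliding-hump proof: the point \<open>lim x\<^sub>n\<close>, where \<open>x\<^sub>n\<close> moves by at most \<open>3\<^sup>-\<^sup>n\<close>
  and \<open>\<parallel>F\<^sub>n x\<^sub>n\<parallel>\<close> is large, has an unbounded orbit.\<close>

lemma uniform_boundedness:
  fixes F :: "nat \<Rightarrow> 'a::banach \<Rightarrow> 'b::real_normed_vector"
  assumes F: "\<And>n. bounded_linear (F n)"
    and big: "\<And>n. \<exists>z. 12 ^ n * norm z < norm (F n z)"
  shows "\<exists>x. \<not> Bseq (\<lambda>n. F n x)"
proof -
  define K where "K n = onorm (F n)" for n
  have K_ge: "norm (F n x) \<le> K n * norm x" for n x unfolding K_def by (rule onorm[OF F])
  have K_big: "12 ^ n < K n" for n
  proof -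
    obtain z where z: "12 ^ n * norm z < norm (F n z)" using big by blast
    with K_ge[of n z] have "12 ^ n * norm z < K n * norm z" by linarith
    then show ?thesis by (simp add: mult_less_cancel_right)
  qed
  have K_pos: "0 < K n" for n using K_big[of n] by (rule less_trans[rotated]) simp
  \<comment> \<open>Any factor below 1 is exceeded by the quotient at some z. The value 3/4 also
    beats the loss 1/2 that all later moves can cause (\<open>dist_x\<close>).\<close>
  have near: "\<exists>z. (3/4 * K n) * norm z < norm (F n z)" for n
  proof (rule ccontr)
    assume "\<nexists>z. (3/4 * K n) * norm z < norm (F n z)"
    then have "norm (F n z) \<le> (3/4 * K n) * norm z" for z by (meson not_less)
    then have "K n \<le> 3/4 * K n" using K_pos[of n] unfolding K_def by (intro onorm_bound) auto
    then show False using K_pos[of n] by simp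
  qed
  have step: "\<exists>x'. norm (x' - x) \<le> (1/3)^n \<and> (3/4 * K n) * (1/3)^n \<le> norm (F n x')" for n x
    using near[of n] bounded_linear_translate_bound[OF F, of "3/4 * K n" _ n "(1/3)^n" x] by auto
  define G where "G n x = (SOME x'. norm (x' - x) \<le> (1/3)^n \<and> (3/4 * K n) * (1/3)^n \<le> norm (F n x'))" for n x
  have G: "norm (G n x - x) \<le> (1/3)^n" "(3/4 * K n) * (1/3)^n \<le> norm (F n (G n x))" for n x
    using someI_ex[OF step[of x n]] unfolding G_def by auto
  define X where "X = rec_nat 0 (\<lambda>n x. G n x)"
  have X: "X (Suc n) = G n (X n)" for n by (simp add: X_def)
  have tail: "norm (X (n + m) - X n) \<le> 3/2 * (1/3)^n * (1 - (1/3)^m)" for n m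
  proof (induction m)
    case (Suc m)
    have "norm (X (n + Suc m) - X n) \<le> norm (X (n + Suc m) - X (n + m)) + norm (X (n + m) - X n)"
      by (metis norm_triangle_ineq diff_add_cancel add_diff_eq)
    also have "\<dots> \<le> (1/3)^(n + m) + 3/2 * (1/3)^n * (1 - (1/3)^m)"
      using Suc G(1)[of "n + m" "X (n + m)"] by (simp add: X)
    also have "\<dots> = 3/2 * (1/3)^n * (1 - (1/3)^Suc m)"
      by (simp add: power_add field_simps)
    finally show ?case .
  qed simp
  have tail': "norm (X (n + m) - X n) \<le> 3/2 * (1/3)^n" for n m
  proof -
    have "3/2 * (1/3::real)^n * (1 - (1/3)^m) \<le> 3/2 * (1/3)^n * 1"
      by (intro mult_left_mono) auto
    then show ?thesis using tail[of n m] by linarith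
  qed
  have "Cauchy X"
  proof (rule metric_CauchyI)
    fix e :: real assume e: "0 < e"
    obtain n where n: "(1/3::real)^n < e/3" using real_arch_pow_inv[of "e/3" "1/3"] e by auto
    have "dist (X i) (X j) < e" if "n \<le> i" "n \<le> j" for i j
    proof -
      have "dist (X i) (X n) \<le> 3/2 * (1/3)^n" "dist (X j) (X n) \<le> 3/2 * (1/3)^n"
        using tail'[of n "i - n"] tail'[of n "j - n"] that by (simp_all add: dist_norm)
      then show ?thesis using n dist_triangle2[of "X i" "X j" "X n"] by linarith
    qed
    then show "\<exists>M. \<forall>i\<ge>M. \<forall>j\<ge>M. dist (X i) (X j) < e" by blast
  qed
  then obtain x where x: "X \<longlonglongrightarrow> x" by (auto simp: Cauchy_convergent_iff convergent_def)
  have dist_x: "norm (X (Suc n) - x) \<le> 1/2 * (1/3)^n" for n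
  proof (rule LIMSEQ_le_const2)
    show "(\<lambda>m. norm (X (Suc n) - X (Suc n + m))) \<longlonglongrightarrow> norm (X (Suc n) - x)"
      using LIMSEQ_ignore_initial_segment[OF x, of "Suc n"]
      by (intro tendsto_intros) (simp add: add.commute)
    show "\<exists>M. \<forall>m\<ge>M. norm (X (Suc n) - X (Suc n + m)) \<le> 1/2 * (1/3)^n"
      using tail'[of "Suc n"] by (simp add: norm_minus_commute)
  qed
  have "2 ^ n / 4 \<le> norm (F n x)" for n
  proof -
    interpret F: bounded_linear "F n" by fact
    have "(3/4 * K n) * (1/3)^n \<le> norm (F n (X (Suc n)))" using G(2) by (simp add: X)
    also have "\<dots> \<le> norm (F n x) + norm (F n (X (Suc n) - x))"
      by (metis F.add add.commute diff_add_cancel norm_triangle_ineq)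
    also have "norm (F n (X (Suc n) - x)) \<le> K n * (1/2 * (1/3)^n)"
      using K_ge[of n "X (Suc n) - x"] dist_x[of n] K_pos[of n]
      by (meson less_imp_le mult_left_mono order.trans)
    finally have "K n * (1/3)^n / 4 \<le> norm (F n x)" by simp
    \<comment> \<open>Norms growing like 12^n against moves of size 3^-n leave 4^n, so the orbit of
      the limit point is unbounded.\<close>
    moreover have "2 ^ n \<le> K n * (1/3)^n"
    proof -
      have "(2::real) ^ n \<le> 4 ^ n" by (rule power_mono) auto
      also have "\<dots> = 12 ^ n * (1/3) ^ n" by (simp add: power_mult_distrib[symmetric])
      also have "\<dots> \<le> K n * (1/3)^n" using K_big[of n] by (intro mult_right_mono) auto
      finally show ?thesis .
    qed
    ultimately show ?thesis by linarith
  qed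
  have "\<not> Bseq (\<lambda>n. F n x)"
  proof
    assume "Bseq (\<lambda>n. F n x)"
    then obtain B where B: "\<And>n. norm (F n x) \<le> B" by (auto simp: Bseq_def)
    obtain n where "4 * B < 2 ^ n" using real_arch_pow[of 2 "4 * B"] by auto
    then show False using B[of n] \<open>2 ^ n / 4 \<le> norm (F n x)\<close> by linarith
  qed
  then show ?thesis by blast
qed

text \<open>If 12^n failed as a bound on [0, 2^-n] for every n, the offending times t_n would tend
  to 0 and uniform boundedness would give an unbounded sequence T(t_n) x, against T(t_n) x ->
  x.\<close>

lemma C0_semigroup_bounded_near_0:
  fixes T :: "real \<Rightarrow> 'a::banach \<Rightarrow> 'a"
  assumes T: "C0_semigroup T"
  obtains \<delta> M where "0 < \<delta>" "1 \<le> M" "\<And>t x. 0 \<le> t \<Longrightarrow> t \<le> \<delta> \<Longrightarrow> norm (T t x) \<le> M * norm x"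
proof -
  have bl: "\<And>t. 0 \<le> t \<Longrightarrow> bounded_linear (T t)" and T0: "\<And>x. T 0 x = x"
    and lim: "\<And>x. ((\<lambda>t. T t x) \<longlongrightarrow> x) (at_right 0)"
    using T by (auto simp: C0_semigroup_def)
  have "\<exists>n. \<forall>t x. 0 \<le> t \<longrightarrow> t \<le> (1/2)^n \<longrightarrow> norm (T t x) \<le> 12^n * norm x"
  proof (rule ccontr)
    assume "\<not> ?thesis"
    then have "\<forall>n. \<exists>t. 0 \<le> t \<and> t \<le> (1/2)^n \<and> (\<exists>x. 12^n * norm x < norm (T t x))"
      by (meson not_less)
    then obtain t where t: "\<And>n. 0 \<le> t n" "\<And>n. t n \<le> (1/2)^n" "\<And>n. \<exists>x. 12^n * norm x < norm (T (t n) x)"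
      by metis
    obtain x where x: "\<not> Bseq (\<lambda>n. T (t n) x)"
      using uniform_boundedness[of "\<lambda>n. T (t n)", OF bl[OF t(1)] t(3)] by blast
    \<comment> \<open>Strong continuity is a one-sided limit, so t n = 0 has to be excluded; there
      the operator is the identity, which does obey the bound 12^n.\<close>
    have pos: "0 < t n" for n
    proof (rule ccontr)
      assume "\<not> 0 < t n"
      then have "t n = 0" using t(1)[of n] by linarith
      then obtain z where "12^n * norm z < norm (T 0 z)" using t(3)[of n] by auto
      then have "12^n * norm z < norm z" by (simp only: T0)
      moreover have "1 * norm z \<le> 12^n * norm z" by (intro mult_right_mono) auto
      ultimately show False by simp
    qed
    have "t \<longlonglongrightarrow> 0"
      by (rule tendsto_sandwich[OF _ _ tendsto_const, of _ _ _ "\<lambda>n. (1/2)^n"])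
         (auto simp: t less_imp_le LIMSEQ_power_zero)
    then have "filterlim t (at_right 0) sequentially"
      unfolding filterlim_at using pos by (auto intro!: always_eventually simp: less_imp_neq[symmetric])
    then have "(\<lambda>n. T (t n) x) \<longlonglongrightarrow> x" by (rule filterlim_compose[OF lim])
    then have "Bseq (\<lambda>n. T (t n) x)" by (intro convergent_imp_Bseq convergentI)
    with x show False by simp
  qed
  then obtain n where n: "\<And>t x. 0 \<le> t \<Longrightarrow> t \<le> (1/2)^n \<Longrightarrow> norm (T t x) \<le> 12^n * norm x"
    by blast
  show thesis by (rule that[of "(1/2)^n" "12^n", OF _ _ n]) auto
qed

lemma C0_semigroup_locally_bounded:
  fixes T :: "real \<Rightarrow> 'a::banach \<Rightarrow> 'a"
  assumes T: "C0_semigroup T"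
  obtains M where "1 \<le> M" "\<And>s x. 0 \<le> s \<Longrightarrow> s \<le> t \<Longrightarrow> norm (T s x) \<le> M * norm x"
proof -
  obtain \<delta> M where \<delta>: "0 < \<delta>" and M: "1 \<le> M" "\<And>t x. 0 \<le> t \<Longrightarrow> t \<le> \<delta> \<Longrightarrow> norm (T t x) \<le> M * norm x"
    using C0_semigroup_bounded_near_0[OF T] by blast
  have semi: "T (s + r) x = T s (T r x)" if "0 \<le> s" "0 \<le> r" for s r x
    using T that by (auto simp: C0_semigroup_def)
  have pow: "norm (T s x) \<le> M ^ Suc n * norm x" if "0 \<le> s" "s \<le> real (Suc n) * \<delta>" for n s x
    using that
  proof (induction n arbitrary: s)
    case 0
    then show ?case using M(2)[of s x] by simp
  next
    case (Suc n)
    show ?case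
    proof (cases "s \<le> \<delta>")
      case True
      have "norm (T s x) \<le> M * norm x" using Suc.prems True M(2) by simp
      also have "\<dots> \<le> M ^ Suc (Suc n) * norm x"
        using M(1) power_increasing[of 1 "Suc (Suc n)" M] by (intro mult_right_mono) auto
      finally show ?thesis .
    next
      case False
      have "norm (T s x) = norm (T \<delta> (T (s - \<delta>) x))"
        using semi[of \<delta> "s - \<delta>"] False \<delta> by simp
      also have "\<dots> \<le> M * norm (T (s - \<delta>) x)" using M(2) \<delta> by simp
      also have "\<dots> \<le> M * (M ^ Suc n * norm x)"
        using Suc.prems False M(1) by (intro mult_left_mono Suc.IH) (auto simp: algebra_simps)
      finally show ?thesis by (simp add: mult.assoc)
    qed
  qed
  obtain n where n: "t / \<delta> \<le> real n" using real_arch_simple by blast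
  show thesis
  proof (rule that[of "M ^ Suc n"])
    show "1 \<le> M ^ Suc n" using M(1) by (rule one_le_power)
    fix s x assume s: "0 \<le> s" "s \<le> t"
    have "t \<le> real n * \<delta>" using n \<delta> by (simp add: field_simps)
    then have "s \<le> real (Suc n) * \<delta>" using s \<delta> by (simp add: algebra_simps)
    then show "norm (T s x) \<le> M ^ Suc n * norm x" using s by (intro pow)
  qed
qed

subsection \<open>Generation of semigroups by the implicit Euler scheme\<close>

text \<open>This is (I - h A)^-1 f, one implicit Euler step: x - h y = f with (x, y) in the graph
  forces y = (x - f) / h.\<close>

definition resolvent_step :: "('a::real_normed_vector \<times> 'a) set \<Rightarrow> real \<Rightarrow> 'a \<Rightarrow> 'a" where
  "resolvent_step A h f = (THE x. (x, (x - f) /\<^sub>R h) \<in> A)"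

text \<open>The hypotheses of a Lumer-Phillips theorem in the equivalent norm \<open>N\<close>.
  Quasi-dissipativity carries the factor exp (w h) instead of 1 / (1 - w h), so that n steps cost
  exactly exp (w n h).\<close>

locale m_dissipative =
  fixes A :: "('a::banach \<times> 'a) set" and N :: "'a \<Rightarrow> real" and C w h0 :: real
  assumes subspace_A: "subspace A"
    and norm_le_N: "norm x \<le> N x"
    and N_le_norm: "N x \<le> C * norm x"
    and N_triangle: "N (x + y) \<le> N x + N y"
    and N_scaleR: "N (c *\<^sub>R x) = \<bar>c\<bar> * N x"
    and w_nonneg: "0 \<le> w" and h0_pos: "0 < h0"
    and dissipative: "(x, y) \<in> A \<Longrightarrow> 0 < h \<Longrightarrow> h \<le> h0 \<Longrightarrow> N x \<le> exp (w * h) * N (x - h *\<^sub>R y)"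
    and range: "0 < h \<Longrightarrow> h \<le> h0 \<Longrightarrow> \<exists>x y. (x, y) \<in> A \<and> x - h *\<^sub>R y = f"
    and dense: "closure (fst ` A) = UNIV"
begin

lemma N_nonneg [simp]: "0 \<le> N x"
  using norm_le_N[of x] norm_ge_zero[of x] by linarith

lemma N_zero [simp]: "N 0 = 0"
  using N_scaleR[of 0 0] by simp

lemma N_minus [simp]: "N (- x) = N x"
  using N_scaleR[of "-1" x] by simp

lemma N_diff: "N (x - y) \<le> N x + N y"
  using N_triangle[of x "- y"] by simp

lemma N_diff_commute: "N (x - y) = N (y - x)"
  by (metis N_minus minus_diff_eq)

lemma N_eq_0: "N x = 0 \<Longrightarrow> x = 0"
  using norm_le_N[of x] by simp

lemma N_abs_diff: "\<bar>N x - N y\<bar> \<le> N (x - y)"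
  using N_triangle[of "x - y" y] N_triangle[of "y - x" x] N_diff_commute[of x y] by simp

lemma N_tendsto_zero: "(f \<longlongrightarrow> l) F \<Longrightarrow> ((\<lambda>x. N (f x - l)) \<longlongrightarrow> 0) F"
proof -
  assume "(f \<longlongrightarrow> l) F"
  then have "((\<lambda>x. C * norm (f x - l)) \<longlongrightarrow> C * 0) F"
    by (intro tendsto_intros tendsto_norm_zero LIM_zero)
  then have "((\<lambda>x. C * norm (f x - l)) \<longlongrightarrow> 0) F" by simp
  then show ?thesis
    by (rule tendsto_sandwich[OF _ _ tendsto_const, rotated 2]) (auto simp: N_le_norm)
qed

lemma tendsto_N: "(f \<longlongrightarrow> l) F \<Longrightarrow> ((\<lambda>x. N (f x)) \<longlongrightarrow> N l) F"
  by (rule LIM_zero_cancel, rule tendsto_rabs_zero_cancel,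
      rule tendsto_sandwich[OF _ _ tendsto_const N_tendsto_zero])
     (auto simp: N_abs_diff)

lemma N_tendsto_zeroI:
  assumes "((\<lambda>x. N (f x - l)) \<longlongrightarrow> 0) F"
  shows "(f \<longlongrightarrow> l) F"
  by (rule LIM_zero_cancel, rule tendsto_norm_zero_cancel,
      rule tendsto_sandwich[OF _ _ tendsto_const assms])
     (auto simp: norm_le_N)

lemma A_add: "(x, y) \<in> A \<Longrightarrow> (x', y') \<in> A \<Longrightarrow> (x + x', y + y') \<in> A"
  using subspace_add[OF subspace_A, of "(x, y)" "(x', y')"] by simp

lemma A_scaleR: "(x, y) \<in> A \<Longrightarrow> (c *\<^sub>R x, c *\<^sub>R y) \<in> A"
  using subspace_scale[OF subspace_A, of "(x, y)" c] by simp

lemma A_diff: "(x, y) \<in> A \<Longrightarrow> (x', y') \<in> A \<Longrightarrow> (x - x', y - y') \<in> A"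
  using subspace_diff[OF subspace_A, of "(x, y)" "(x', y')"] by simp

section \<open>The implicit Euler step: commutation with the operator and telescoping
  estimates\<close>

abbreviation "J \<equiv> resolvent_step A"

context
  fixes h assumes h: "0 < h" "h \<le> h0"
begin

text \<open>Dissipativity, applied to the difference of two solutions, makes I - h A injective, and
  \<open>range\<close> makes it surjective; thus the definite description denotes.\<close>

lemma J_mem: "(J h f, (J h f - f) /\<^sub>R h) \<in> A"
  and J_eqI: "(x, y) \<in> A \<Longrightarrow> x - h *\<^sub>R y = f \<Longrightarrow> J h f = x"
proof -
  have iff: "(x, (x - f) /\<^sub>R h) \<in> A \<longleftrightarrow> (\<exists>y. (x, y) \<in> A \<and> x - h *\<^sub>R y = f)" for x f
  proof
    assume "(x, (x - f) /\<^sub>R h) \<in> A"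
    then show "\<exists>y. (x, y) \<in> A \<and> x - h *\<^sub>R y = f" using h
      by (intro exI[of _ "(x - f) /\<^sub>R h"]) auto
  next
    assume "\<exists>y. (x, y) \<in> A \<and> x - h *\<^sub>R y = f"
    then obtain y where y: "(x, y) \<in> A" "x - h *\<^sub>R y = f" by blast
    have "(x - f) /\<^sub>R h = y" using h unfolding y(2)[symmetric] by simp
    with y show "(x, (x - f) /\<^sub>R h) \<in> A" by simp
  qed
  have uniq: "x = x'" if "(x, y) \<in> A" "x - h *\<^sub>R y = f" "(x', y') \<in> A" "x' - h *\<^sub>R y' = f" for x x' y y' f
  proof -
    have "(x - x') - h *\<^sub>R (y - y') = (x - h *\<^sub>R y) - (x' - h *\<^sub>R y')"
      by (simp add: algebra_simps)
    also have "\<dots> = 0" using that by simp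
    finally have *: "(x - x') - h *\<^sub>R (y - y') = 0" .
    have "N (x - x') \<le> 0"
      using dissipative[OF A_diff[OF that(1,3)] h] unfolding * by simp
    then have "N (x - x') = 0" using N_nonneg[of "x - x'"] by linarith
    then show ?thesis using N_eq_0[of "x - x'"] by simp
  qed
  obtain x y where xy: "(x, y) \<in> A" "x - h *\<^sub>R y = f" using range[OF h] by blast
  then have ex1: "\<exists>!x. (x, (x - f) /\<^sub>R h) \<in> A"
    unfolding iff using uniq by blast
  show "(J h f, (J h f - f) /\<^sub>R h) \<in> A"
    unfolding resolvent_step_def by (rule theI'[OF ex1])
  show "J h f = x" if "(x, y) \<in> A" "x - h *\<^sub>R y = f" for x y f
    unfolding resolvent_step_def iff using that uniq by (intro the_equality) blast+
qed

lemma J_linear: "linear (J h)"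
proof
  fix x y c
  show "J h (x + y) = J h x + J h y"
    by (rule J_eqI[OF A_add[OF J_mem J_mem]])
       (use h in \<open>simp add: scaleR_add_right\<close>)
  show "J h (c *\<^sub>R x) = c *\<^sub>R J h x"
  proof (rule J_eqI[OF A_scaleR[OF J_mem]])
    have *: "h * (c * inverse h) = c" using h by simp
    show "c *\<^sub>R J h x - h *\<^sub>R c *\<^sub>R ((J h x - x) /\<^sub>R h) = c *\<^sub>R x"
      by (simp add: * scaleR_diff_right)
  qed
qed

lemma N_J: "N (J h f) \<le> exp (w * h) * N f"
  using dissipative[OF J_mem h] h by simp

text \<open>The resolvent commutes with A, because x = J (x - h y). Increments of Euler iterates of
  x are thereby h times iterates of y, which is the source of all telescoping below.\<close>

lemma J_diff_eq: "(x, y) \<in> A \<Longrightarrow> J h x - x = h *\<^sub>R J h y"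
proof -
  assume xy: "(x, y) \<in> A"
  have "J h (x - h *\<^sub>R y) = x" using xy by (intro J_eqI) auto
  then show ?thesis
    by (simp add: linear_diff[OF J_linear] linear_cmul[OF J_linear] algebra_simps)
qed

lemma J_graph: "(x, y) \<in> A \<Longrightarrow> (J h x, J h y) \<in> A"
  using J_mem[of x] J_diff_eq[of x y] h by simp

lemma linear_J_pow: "linear (J h ^^ n)"
proof (induction n)
  case 0
  then show ?case by (simp add: linear_id[unfolded id_def] id_def)
next
  case (Suc n)
  then show ?case using linear_compose[OF Suc J_linear] by (simp add: o_def)
qed

lemma N_J_pow: "N ((J h ^^ n) f) \<le> exp (w * (real n * h)) * N f"
proof (induction n)
  case (Suc n)
  have "N ((J h ^^ Suc n) f) \<le> exp (w * h) * N ((J h ^^ n) f)"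
    using N_J by simp
  also have "\<dots> \<le> exp (w * h) * (exp (w * (real n * h)) * N f)"
    using Suc by simp
  also have "\<dots> = exp (w * (real (Suc n) * h)) * N f"
    by (simp add: exp_add[symmetric] algebra_simps)
  finally show ?case .
qed simp

lemma J_pow_graph: "(x, y) \<in> A \<Longrightarrow> ((J h ^^ n) x, (J h ^^ n) y) \<in> A"
  by (induction n) (auto intro: J_graph)

lemma exp_step_mono: "i \<le> n \<Longrightarrow> exp (w * (real i * h)) \<le> exp (w * (real n * h))"
  using h w_nonneg by (auto intro!: mult_left_mono mult_right_mono)

lemma J_pow_diff:
  assumes "(x, y) \<in> A"
  shows "N ((J h ^^ n) x - x) \<le> real n * h * exp (w * (real n * h)) * N y"
proof (induction n)
  case (Suc n)
  have "(J h ^^ Suc n) x - x = (J h ^^ n) (J h x - x) + ((J h ^^ n) x - x)"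
    by (simp add: funpow_swap1 linear_diff[OF linear_J_pow])
  also have "(J h ^^ n) (J h x - x) = h *\<^sub>R (J h ^^ Suc n) y"
    by (simp add: J_diff_eq[OF assms] linear_cmul[OF linear_J_pow] funpow_swap1)
  finally have "N ((J h ^^ Suc n) x - x) \<le> h * N ((J h ^^ Suc n) y) + N ((J h ^^ n) x - x)"
    using N_triangle h by (metis N_scaleR abs_of_pos)
  also have "\<dots> \<le> h * (exp (w * (real (Suc n) * h)) * N y) + real n * h * exp (w * (real (Suc n) * h)) * N y"
  proof (rule add_mono)
    show "h * N ((J h ^^ Suc n) y) \<le> h * (exp (w * (real (Suc n) * h)) * N y)"
      using N_J_pow[of "Suc n" y] h by (intro mult_left_mono) auto
    have "real n * h * exp (w * (real n * h)) * N y \<le> real n * h * exp (w * (real (Suc n) * h)) * N y"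
      by (intro mult_right_mono mult_left_mono exp_step_mono) (use h in auto)
    then show "N ((J h ^^ n) x - x) \<le> real n * h * exp (w * (real (Suc n) * h)) * N y"
      using Suc by linarith
  qed
  finally show ?case by (simp add: algebra_simps)
qed simp

text \<open>Since y itself need not lie in the domain, a domain element y' replaces it at the price
  of N (y - y'). The Taylor estimate then holds for every x in the domain of A, not just of
  A^2.\<close>

lemma J_pow_diff_approx:
  assumes "(y', z') \<in> A"
  shows "N ((J h ^^ n) y - y) \<le>
    (1 + exp (w * (real n * h))) * N (y - y') + real n * h * exp (w * (real n * h)) * N z'"
proof -
  have "(J h ^^ n) y - y = ((J h ^^ n) (y - y') - (y - y')) + ((J h ^^ n) y' - y')"
    by (simp add: linear_diff[OF linear_J_pow])
  then have "N ((J h ^^ n) y - y) \<le> N ((J h ^^ n) (y - y')) + N (y - y') + N ((J h ^^ n) y' - y')"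
    using N_triangle N_diff by (smt (verit, best))
  then show ?thesis
    using N_J_pow[of n "y - y'"] J_pow_diff[OF assms, of n] by (simp add: algebra_simps)
qed

lemma J_pow_taylor:
  assumes xy: "(x, y) \<in> A" and yz: "(y', z') \<in> A"
  shows "N ((J h ^^ n) x - x - (real n * h) *\<^sub>R y) \<le>
    real n * h * ((1 + exp (w * (real n * h))) * N (y - y') + real n * h * exp (w * (real n * h)) * N z')"
    (is "_ \<le> real n * h * ?e n")
proof -
  have mono: "?e i \<le> ?e n" if "i \<le> n" for i n
    by (intro add_mono mult_mono exp_step_mono that order_refl) (use h that in auto)
  show ?thesis
  proof (induction n)
    case (Suc n)
    have "(J h ^^ Suc n) x - (J h ^^ n) x = h *\<^sub>R (J h ^^ Suc n) y"
      using J_diff_eq[OF xy]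
      by (simp add: funpow_swap1 linear_diff[OF linear_J_pow, symmetric] linear_cmul[OF linear_J_pow])
    then have "(J h ^^ Suc n) x - x - (real (Suc n) * h) *\<^sub>R y =
        ((J h ^^ n) x - x - (real n * h) *\<^sub>R y) + h *\<^sub>R ((J h ^^ Suc n) y - y)"
      by (simp add: algebra_simps)
    then have "N ((J h ^^ Suc n) x - x - (real (Suc n) * h) *\<^sub>R y) \<le>
        N ((J h ^^ n) x - x - (real n * h) *\<^sub>R y) + h * N ((J h ^^ Suc n) y - y)"
      using N_triangle N_scaleR h by (metis abs_of_pos)
    also have "\<dots> \<le> real n * h * ?e (Suc n) + h * ?e (Suc n)"
    proof (rule add_mono)
      show "N ((J h ^^ n) x - x - (real n * h) *\<^sub>R y) \<le> real n * h * ?e (Suc n)"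
        using Suc mono[of n "Suc n"] h
        by (meson le_Suc_eq mult_left_mono mult_nonneg_nonneg of_nat_0_le_iff order.trans order_less_imp_le order_refl)
      show "h * N ((J h ^^ Suc n) y - y) \<le> h * ?e (Suc n)"
        using J_pow_diff_approx[OF yz, of "Suc n" y] h by (intro mult_left_mono) auto
    qed
    finally show ?case by (simp add: algebra_simps)
  qed simp
qed

end

text \<open>Expanding one step of size h and two of size h/2 along x, y, z, the terms x and h y
  cancel, and only second-order multiples of resolvents of z remain.\<close>

lemma half_step:
  assumes h: "0 < h" "h \<le> h0" and xy: "(x, y) \<in> A" and yz: "(y, z) \<in> A"
  shows "N (J h x - J (h/2) (J (h/2) x)) \<le> 2 * h\<^sup>2 * exp (w * h) * N z"
proof -
  define k where "k = h/2"
  have k: "0 < k" "k \<le> h0" and hk: "h = 2 * k" using h by (auto simp: k_def)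
  note lin = linear_add[OF J_linear[OF k]] linear_cmul[OF J_linear[OF k]]
  have 1: "J h x = x + h *\<^sub>R J h y" "J h y = y + h *\<^sub>R J h z"
    using J_diff_eq[OF h xy] J_diff_eq[OF h yz] by (simp_all add: algebra_simps)
  have 2: "J k x = x + k *\<^sub>R J k y" "J k y = y + k *\<^sub>R J k z"
    using J_diff_eq[OF k xy] J_diff_eq[OF k yz] by (simp_all add: algebra_simps)
  have a: "J h x = x + h *\<^sub>R (y + h *\<^sub>R J h z)" using 1 by metis
  have b1: "J k x = x + k *\<^sub>R (y + k *\<^sub>R J k z)" using 2 by metis
  then have "J k (J k x) = J k x + k *\<^sub>R (J k y + k *\<^sub>R J k (J k z))"
    by (simp add: lin)
  also have "\<dots> = x + k *\<^sub>R (y + k *\<^sub>R J k z) + k *\<^sub>R (y + k *\<^sub>R J k z + k *\<^sub>R J k (J k z))"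
    using b1 2(2) by metis
  finally have b: "J k (J k x) = x + k *\<^sub>R (y + k *\<^sub>R J k z) + k *\<^sub>R (y + k *\<^sub>R J k z + k *\<^sub>R J k (J k z))" .
  have "J h x - J k (J k x) = (4 * k\<^sup>2) *\<^sub>R J h z - ((2 * k\<^sup>2) *\<^sub>R J k z + k\<^sup>2 *\<^sub>R J k (J k z))"
  proof -
    have "(s * 2) *\<^sub>R v = s *\<^sub>R v + s *\<^sub>R v" "(s * (r * 2)) *\<^sub>R v = (s * r) *\<^sub>R v + (s * r) *\<^sub>R v"
      "(s * (r * 4)) *\<^sub>R v = (s * r) *\<^sub>R v + (s * r) *\<^sub>R v + (s * r) *\<^sub>R v + (s * r) *\<^sub>R v"
      for s r and v :: 'a
      by (simp_all add: scaleR_add_left[symmetric])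
    then show ?thesis
      unfolding a b unfolding hk by (simp add: algebra_simps power2_eq_square)
  qed
  then have "N (J h x - J k (J k x)) \<le> 4 * k\<^sup>2 * N (J h z) + (2 * k\<^sup>2 * N (J k z) + k\<^sup>2 * N (J k (J k z)))"
    using order.trans[OF N_diff add_left_mono[OF N_triangle],
        of "(4 * k\<^sup>2) *\<^sub>R J h z" "(2 * k\<^sup>2) *\<^sub>R J k z" "k\<^sup>2 *\<^sub>R J k (J k z)"]
    by (simp add: N_scaleR)
  also have "\<dots> \<le> 4 * k\<^sup>2 * (exp (w * h) * N z) + (2 * k\<^sup>2 * (exp (w * h) * N z) + k\<^sup>2 * (exp (w * h) * N z))"
  proof -
    have "N (J k z) \<le> exp (w * h) * N z"
      by (rule order.trans[OF N_J[OF k]], rule mult_right_mono)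
         (use k w_nonneg hk in \<open>auto intro: mult_left_mono\<close>)
    moreover have "N (J k (J k z)) \<le> exp (w * h) * N z"
      using N_J_pow[OF k, of 2 z] hk by (simp add: numeral_2_eq_2)
    ultimately show ?thesis
      using N_J[OF h, of z] by (intro add_mono mult_left_mono) auto
  qed
  \<comment> \<open>With k = h/2 the coefficients add up to 4 k^2 + 2 k^2 + k^2 = 7 k^2.\<close>
  also have "\<dots> = (7/4) * (h\<^sup>2 * exp (w * h) * N z)"
    by (simp add: hk power2_eq_square)
  also have "\<dots> \<le> 2 * (h\<^sup>2 * exp (w * h) * N z)"
    by (intro mult_right_mono) auto
  finally show ?thesis by (simp add: k_def)
qed

text \<open>The iterates with half the step stay in the domain of A^2, with J^(2n) z as second
  image, so the local estimate applies at every step. For bounded n h the n errors of order h^2 add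
  up to order h.\<close>

lemma half_step_pow:
  assumes h: "0 < h" "h \<le> h0" and xy: "(x, y) \<in> A" and yz: "(y, z) \<in> A"
  shows "N ((J h ^^ n) x - (J (h/2) ^^ (2*n)) x) \<le> real n * (2 * h\<^sup>2 * exp (w * (real n * h)) * N z)"
proof (induction n)
  case (Suc n)
  have k: "0 < h/2" "h/2 \<le> h0" using h by auto
  let ?k = "h/2"
  let ?x = "(J ?k ^^ (2*n)) x" and ?z = "(J ?k ^^ (2*n)) z"
  have "(J h ^^ Suc n) x - (J ?k ^^ (2 * Suc n)) x =
      J h ((J h ^^ n) x - ?x) + (J h ?x - J ?k (J ?k ?x))"
    by (simp add: linear_diff[OF J_linear[OF h]])
  then have "N ((J h ^^ Suc n) x - (J ?k ^^ (2 * Suc n)) x) \<le>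
      N (J h ((J h ^^ n) x - ?x)) + N (J h ?x - J ?k (J ?k ?x))"
    using N_triangle by metis
  also have "N (J h ((J h ^^ n) x - ?x)) \<le> exp (w * h) * (real n * (2 * h\<^sup>2 * exp (w * (real n * h)) * N z))"
    using N_J[OF h] Suc by (meson exp_ge_zero mult_left_mono order.trans)
  also have "N (J h ?x - J ?k (J ?k ?x)) \<le> 2 * h\<^sup>2 * exp (w * h) * N ?z"
    by (rule half_step[OF h J_pow_graph[OF k xy] J_pow_graph[OF k yz]])
  also have "N ?z \<le> exp (w * (real n * h)) * N z"
    using N_J_pow[OF k, of "2*n" z] by simp
  finally have "N ((J h ^^ Suc n) x - (J ?k ^^ (2 * Suc n)) x)
    \<le> exp (w * h) * (real n * (2 * h\<^sup>2 * exp (w * (real n * h)) * N z)) +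
       2 * h\<^sup>2 * exp (w * h) * (exp (w * (real n * h)) * N z)"
    by (simp add: mult_left_mono)
  also have "\<dots> = real (Suc n) * (2 * h\<^sup>2 * (exp (w * h) * exp (w * (real n * h))) * N z)"
    by (simp add: algebra_simps)
  also have "exp (w * h) * exp (w * (real n * h)) = exp (w * (real (Suc n) * h))"
    by (simp add: exp_add[symmetric] algebra_simps)
  finally show ?case .
qed simp

section \<open>The limit of the Euler scheme along dyadic step sizes\<close>

text \<open>Step sizes halve from level to level, which makes consecutive levels comparable by
  \<open>half_step_pow\<close>; the time is rounded down to the grid.\<close>

definition euler :: "nat \<Rightarrow> real \<Rightarrow> 'a \<Rightarrow> 'a" where
  "euler m t = J (h0 / 2^m) ^^ nat \<lfloor>t * 2^m / h0\<rfloor>"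

definition T :: "real \<Rightarrow> 'a \<Rightarrow> 'a" where
  "T t x = lim (\<lambda>m. euler m t x)"

lemma mesh: "0 < h0 / 2^m" "h0 / 2^m \<le> h0"
  using h0_pos by (auto simp: field_simps)

lemma mesh_le:
  assumes "0 \<le> t"
  shows "real (nat \<lfloor>t * 2^m / h0\<rfloor>) * (h0 / 2^m) \<le> t"
proof -
  have "real (nat \<lfloor>t * 2^m / h0\<rfloor>) \<le> t * 2^m / h0"
    using assms h0_pos by (intro of_nat_floor) auto
  then show ?thesis using h0_pos by (simp add: field_simps)
qed

lemma mesh_tendsto_0: "(\<lambda>m. h0 / 2^m) \<longlonglongrightarrow> 0"
proof -
  have "(\<lambda>m. h0 * (1/2)^m) \<longlonglongrightarrow> h0 * 0"
    by (intro tendsto_intros LIMSEQ_power_zero) auto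
  then show ?thesis by (simp add: power_divide)
qed

lemma mesh_tendsto:
  assumes "0 \<le> t"
  shows "(\<lambda>m. real (nat \<lfloor>t * 2^m / h0\<rfloor>) * (h0 / 2^m)) \<longlonglongrightarrow> t"
proof (rule tendsto_sandwich[of "\<lambda>m. t - h0 / 2^m" _ _ "\<lambda>m. t"])
  have "t - h0 / 2^m \<le> real (nat \<lfloor>t * 2^m / h0\<rfloor>) * (h0 / 2^m)" for m
  proof -
    have "t * 2^m / h0 \<le> real (nat \<lfloor>t * 2^m / h0\<rfloor>) + 1"
      using assms h0_pos by linarith
    then have "(t * 2^m / h0) * (h0 / 2^m) \<le> (real (nat \<lfloor>t * 2^m / h0\<rfloor>) + 1) * (h0 / 2^m)"
      using h0_pos by (intro mult_right_mono) auto
    moreover have "(t * 2^m / h0) * (h0 / 2^m) = t" using h0_pos by simp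
    ultimately show ?thesis unfolding distrib_right by linarith
  qed
  then show "\<forall>\<^sub>F m in sequentially. t - h0 / 2^m \<le> real (nat \<lfloor>t * 2^m / h0\<rfloor>) * (h0 / 2^m)" by simp
  show "\<forall>\<^sub>F m in sequentially. real (nat \<lfloor>t * 2^m / h0\<rfloor>) * (h0 / 2^m) \<le> t"
    using mesh_le[OF assms] by simp
  show "(\<lambda>m. t - h0 / 2^m) \<longlonglongrightarrow> t"
    using tendsto_diff[OF tendsto_const[of t] mesh_tendsto_0] by simp
qed simp

lemma exp_mesh_le:
  assumes "0 \<le> t" "i \<le> nat \<lfloor>t * 2^m / h0\<rfloor>"
  shows "exp (w * (real i * (h0 / 2^m))) \<le> exp (w * t)"
proof -
  have "real i * (h0 / 2^m) \<le> real (nat \<lfloor>t * 2^m / h0\<rfloor>) * (h0 / 2^m)"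
    using assms mesh(1)[of m] by (intro mult_right_mono) auto
  then show ?thesis
    unfolding exp_le_cancel_iff using mesh_le[OF assms(1), of m] w_nonneg by (intro mult_left_mono) linarith+
qed

lemma linear_euler: "linear (euler m t)"
  unfolding euler_def by (rule linear_J_pow[OF mesh])

lemma N_euler: "0 \<le> t \<Longrightarrow> N (euler m t x) \<le> exp (w * t) * N x"
  unfolding euler_def
  by (rule order.trans[OF N_J_pow[OF mesh]], intro mult_right_mono exp_mesh_le) auto

lemma euler_step:
  assumes t: "0 \<le> t" and xy: "(x, y) \<in> A" and yz: "(y, z) \<in> A"
  shows "N (euler (Suc m) t x - euler m t x) \<le> (h0 / 2^m) * (exp (w * t) * (2 * t * N z + N y))"
proof -
  define h where "h = h0 / 2^m"
  define n where "n = nat \<lfloor>t * 2^m / h0\<rfloor>"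
  define n' where "n' = nat \<lfloor>t * 2^Suc m / h0\<rfloor>"
  have h: "0 < h" "h \<le> h0" and k: "0 < h/2" "h/2 \<le> h0"
    using mesh[of m] by (auto simp: h_def)
  have hm: "h0 / 2 ^ Suc m = h/2" by (simp add: h_def)
  have nt: "real n * h \<le> t" unfolding n_def h_def by (rule mesh_le[OF t])
  \<comment> \<open>The finer grid may have one more point up to t; this extra half step costs a
    multiple of h N y, which is estimate 2.\<close>
  have n': "n' = 2 * n \<or> n' = Suc (2 * n)"
  proof -
    have "\<lfloor>2 * s\<rfloor> = 2 * \<lfloor>s\<rfloor> \<or> \<lfloor>2 * s\<rfloor> = 2 * \<lfloor>s\<rfloor> + 1" for s :: real
      by linarith
    from this[of "t * 2^m / h0"] show ?thesis
      using t h0_pos by (auto simp: n_def n'_def mult.commute mult.left_commute nat_add_distrib nat_mult_distrib)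
  qed
  have 1: "N ((J h ^^ n) x - (J (h/2) ^^ (2*n)) x) \<le> h * (exp (w * t) * (2 * t * N z))"
  proof -
    have "N ((J h ^^ n) x - (J (h/2) ^^ (2*n)) x) \<le> real n * (2 * h\<^sup>2 * exp (w * (real n * h)) * N z)"
      by (rule half_step_pow[OF h xy yz])
    also have "\<dots> = (real n * h) * (exp (w * (real n * h)) * (2 * h * N z))"
      by (simp add: power2_eq_square)
    also have "\<dots> \<le> t * (exp (w * t) * (2 * h * N z))"
    proof (rule mult_mono[OF nt])
      show "exp (w * (real n * h)) * (2 * h * N z) \<le> exp (w * t) * (2 * h * N z)"
        using mult_left_mono[OF nt w_nonneg] h by (intro mult_right_mono) auto
    qed (use t h in auto)
    finally show ?thesis by (simp add: algebra_simps)
  qed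
  have 2: "N ((J (h/2) ^^ n') x - (J (h/2) ^^ (2*n)) x) \<le> h * (exp (w * t) * N y)"
    using n'
  proof
    assume n': "n' = Suc (2 * n)"
    have "(J (h/2) ^^ n') x - (J (h/2) ^^ (2*n)) x = (J (h/2) ^^ (2*n)) (J (h/2) x - x)"
      unfolding n' linear_diff[OF linear_J_pow[OF k]] by (simp add: funpow_swap1)
    also have "\<dots> = (h/2) *\<^sub>R (J (h/2) ^^ n') y"
      unfolding n' J_diff_eq[OF k xy] linear_cmul[OF linear_J_pow[OF k]] by (simp add: funpow_swap1)
    finally have eq: "(J (h/2) ^^ n') x - (J (h/2) ^^ (2*n)) x = (h/2) *\<^sub>R (J (h/2) ^^ n') y" .
    have "N ((J (h/2) ^^ n') x - (J (h/2) ^^ (2*n)) x) = (h/2) * N ((J (h/2) ^^ n') y)"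
      unfolding eq N_scaleR using h by simp
    also have "N ((J (h/2) ^^ n') y) \<le> N (euler (Suc m) t y)"
      unfolding euler_def hm n'_def by simp
    also have "\<dots> \<le> exp (w * t) * N y" by (rule N_euler[OF t])
    finally have "N ((J (h/2) ^^ n') x - (J (h/2) ^^ (2*n)) x) \<le> h/2 * (exp (w * t) * N y)"
      using h by (simp add: mult_left_mono)
    also have "\<dots> \<le> h * (exp (w * t) * N y)"
      using h by (intro mult_right_mono) auto
    finally show ?thesis .
  qed (use h in simp)
  have "euler (Suc m) t x - euler m t x =
      ((J (h/2) ^^ n') x - (J (h/2) ^^ (2*n)) x) - ((J h ^^ n) x - (J (h/2) ^^ (2*n)) x)"
    unfolding euler_def hm n'_def[symmetric] n_def[symmetric] h_def[symmetric] by simp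
  then have "N (euler (Suc m) t x - euler m t x) \<le> h * (exp (w * t) * N y) + h * (exp (w * t) * (2 * t * N z))"
    using order.trans[OF N_diff add_mono[OF 2 1]] by simp
  then show ?thesis unfolding h_def by (simp add: algebra_simps)
qed

text \<open>A domain element x1 near x is smoothed by the resolvent: A J x1 = J y1 lies in the
  domain again, so J x1 is in the domain of A^2, and J x1 - x1 = h J y1 is small.\<close>

lemma A2_dense:
  assumes "0 < e"
  obtains x' y z where "(x', y) \<in> A" "(y, z) \<in> A" "N (x - x') < e"
proof -
  have "x \<in> closure (fst ` A)" using dense by simp
  then obtain x1 where x1: "x1 \<in> fst ` A" "dist x1 x < e / (2 * (\<bar>C\<bar> + 1))"
    using assms unfolding closure_approachable by (metis abs_ge_zero add_nonneg_pos divide_pos_pos mult_pos_pos zero_less_numeral zero_less_one)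
  then obtain y1 where xy: "(x1, y1) \<in> A" by auto
  have "N (x - x1) \<le> (\<bar>C\<bar> + 1) * norm (x - x1)"
    by (rule order.trans[OF N_le_norm]) (intro mult_right_mono, auto)
  also have "\<dots> < (\<bar>C\<bar> + 1) * (e / (2 * (\<bar>C\<bar> + 1)))"
    using x1(2) by (intro mult_strict_left_mono) (auto simp: dist_norm norm_minus_commute)
  also have "\<dots> = e/2"
    using abs_ge_zero[of C] by (simp add: field_simps)
  finally have 1: "N (x - x1) < e/2" .
  have "(\<lambda>m. (h0 / 2^m) * (exp (w * h0) * N y1)) \<longlonglongrightarrow> 0 * (exp (w * h0) * N y1)"
    by (intro tendsto_intros mesh_tendsto_0)
  then have "\<forall>\<^sub>F m in sequentially. (h0 / 2^m) * (exp (w * h0) * N y1) < e/2"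
    using assms by (intro order_tendstoD(2)) auto
  then obtain m where m: "(h0 / 2^m) * (exp (w * h0) * N y1) < e/2"
    by (auto simp: eventually_sequentially)
  define h where "h = h0 / 2^m"
  have h: "0 < h" "h \<le> h0" using mesh[of m] by (auto simp: h_def)
  have "N (J h x1 - x1) = h * N (J h y1)"
    using J_diff_eq[OF h xy] h by (simp add: N_scaleR)
  also have "\<dots> \<le> h * (exp (w * h0) * N y1)"
  proof -
    have "N (J h y1) \<le> exp (w * h) * N y1" by (rule N_J[OF h])
    also have "\<dots> \<le> exp (w * h0) * N y1"
      using h w_nonneg by (intro mult_right_mono) (auto intro: mult_left_mono)
    finally show ?thesis using h by simp
  qed
  also have "\<dots> < e/2" using m by (simp add: h_def)
  finally have 2: "N (x1 - J h x1) < e/2" using N_diff_commute by metis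
  have "N (x - J h x1) < e"
    using N_triangle[of "x - x1" "x1 - J h x1"] 1 2 by simp
  with that[OF J_graph[OF h xy] J_mem[OF h]] show ?thesis by blast
qed

lemma convergent_euler_A2:
  assumes t: "0 \<le> t" and xy: "(x, y) \<in> A" and yz: "(y, z) \<in> A"
  shows "convergent (\<lambda>m. euler m t x)"
proof -
  let ?K = "h0 * (exp (w * t) * (2 * t * N z + N y))"
  have "summable (\<lambda>m. euler (Suc m) t x - euler m t x)"
  proof (rule summable_comparison_test)
    show "\<exists>M. \<forall>m\<ge>M. norm (euler (Suc m) t x - euler m t x) \<le> ?K * (1/2)^m"
      using order.trans[OF norm_le_N euler_step[OF assms]] by (simp add: power_divide)
    show "summable (\<lambda>m. ?K * (1/2)^m)"
      by (intro summable_mult summable_geometric) auto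
  qed
  then have "convergent (\<lambda>n. \<Sum>m<n. (euler (Suc m) t x - euler m t x))"
    by (simp add: summable_iff_convergent)
  then have "convergent (\<lambda>n. (\<Sum>m<n. (euler (Suc m) t x - euler m t x)) + euler 0 t x)"
    by (intro convergent_add convergent_const)
  moreover have "(\<Sum>m<n. (euler (Suc m) t x - euler m t x)) + euler 0 t x = euler n t x" for n
    by (subst sum_lessThan_telescope) simp
  ultimately show ?thesis by simp
qed

text \<open>The errors between levels are geometric on the domain of A^2. Convergence extends to all
  x since the bound exp (w t) of the approximants does not depend on m.\<close>

lemma euler_LIMSEQ:
  assumes t: "0 \<le> t"
  shows "(\<lambda>m. euler m t x) \<longlonglongrightarrow> T t x"
proof -
  have "Cauchy (\<lambda>m. euler m t x)"
  proof (rule metric_CauchyI)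
    fix e :: real assume e: "0 < e"
    define \<delta> where "\<delta> = e / (3 * exp (w * t))"
    have "\<delta> > 0" using e by (simp add: \<delta>_def)
    then obtain x' y z where x': "(x', y) \<in> A" "(y, z) \<in> A" "N (x - x') < \<delta>"
      using A2_dense by blast
    have "Cauchy (\<lambda>m. euler m t x')"
      using convergent_euler_A2[OF t x'(1,2)] by (simp add: Cauchy_convergent_iff)
    then obtain M where M: "\<And>m n. m \<ge> M \<Longrightarrow> n \<ge> M \<Longrightarrow> dist (euler m t x') (euler n t x') < e/3"
      using e by (meson metric_CauchyD zero_less_divide_iff zero_less_numeral)
    have *: "dist (euler m t x) (euler m t x') < e/3" for m
    proof -
      have "dist (euler m t x) (euler m t x') \<le> N (euler m t (x - x'))"
        unfolding dist_norm linear_diff[OF linear_euler] by (rule norm_le_N)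
      also have "\<dots> \<le> exp (w * t) * N (x - x')" by (rule N_euler[OF t])
      also have "\<dots> < exp (w * t) * \<delta>" using x' by simp
      also have "\<dots> = e/3" by (simp add: \<delta>_def)
      finally show ?thesis .
    qed
    have "dist (euler m t x) (euler n t x) < e" if "m \<ge> M" "n \<ge> M" for m n
      using *[of m] *[of n] M[OF that]
        dist_triangle[of "euler m t x" "euler n t x" "euler m t x'"] dist_triangle[of "euler m t x'" "euler n t x" "euler n t x'"]
      by (simp add: dist_commute)
    then show "\<exists>M. \<forall>m\<ge>M. \<forall>n\<ge>M. dist (euler m t x) (euler n t x) < e" by blast
  qed
  then show ?thesis
    unfolding T_def by (simp add: Cauchy_convergent_iff convergent_LIMSEQ_iff)
qed

lemma N_T: "0 \<le> t \<Longrightarrow> N (T t x) \<le> exp (w * t) * N x"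
  by (rule tendsto_upperbound[OF tendsto_N[OF euler_LIMSEQ]]) (auto simp: N_euler)

lemma T_zero: "T 0 x = x"
  using LIMSEQ_unique[OF euler_LIMSEQ[of 0 x], of x] by (simp add: euler_def)

lemma linear_T: "0 \<le> t \<Longrightarrow> linear (T t)"
proof
  fix x y :: 'a and c :: real assume t: "0 \<le> t"
  show "T t (x + y) = T t x + T t y"
    by (rule LIMSEQ_unique[OF euler_LIMSEQ[OF t]])
       (unfold linear_add[OF linear_euler], intro tendsto_add euler_LIMSEQ t)
  show "T t (c *\<^sub>R x) = c *\<^sub>R T t x"
    by (rule LIMSEQ_unique[OF euler_LIMSEQ[OF t]])
       (unfold linear_cmul[OF linear_euler], intro tendsto_intros euler_LIMSEQ t)
qed

lemma bounded_linear_T: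
  assumes t: "0 \<le> t"
  shows "bounded_linear (T t)"
proof (rule bounded_linear_intro[where K="exp (w * t) * C"])
  fix x
  have "norm (T t x) \<le> exp (w * t) * N x"
    using norm_le_N N_T[OF t] by (rule order.trans)
  also have "\<dots> \<le> exp (w * t) * (C * norm x)"
    by (simp add: N_le_norm)
  finally show "norm (T t x) \<le> norm x * (exp (w * t) * C)" by (simp add: mult_ac)
qed (auto simp: linear_add[OF linear_T[OF t]] linear_cmul[OF linear_T[OF t]])

lemma T_taylor:
  assumes t: "0 \<le> t" and xy: "(x, y) \<in> A" and yz: "(y', z') \<in> A"
  shows "N (T t x - x - t *\<^sub>R y) \<le> t * ((1 + exp (w * t)) * N (y - y') + t * exp (w * t) * N z')"
proof (rule LIMSEQ_le)
  let ?s = "\<lambda>m. real (nat \<lfloor>t * 2^m / h0\<rfloor>) * (h0 / 2^m)"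
  note s = mesh_tendsto[OF t]
  show "(\<lambda>m. N (euler m t x - x - ?s m *\<^sub>R y)) \<longlonglongrightarrow> N (T t x - x - t *\<^sub>R y)"
    by (intro tendsto_N tendsto_diff tendsto_scaleR euler_LIMSEQ s t tendsto_const)
  show "(\<lambda>m. ?s m * ((1 + exp (w * ?s m)) * N (y - y') + ?s m * exp (w * ?s m) * N z'))
      \<longlonglongrightarrow> t * ((1 + exp (w * t)) * N (y - y') + t * exp (w * t) * N z')"
    by (intro tendsto_mult tendsto_add tendsto_exp s tendsto_const)
  show "\<exists>M. \<forall>m\<ge>M. N (euler m t x - x - ?s m *\<^sub>R y) \<le>
      ?s m * ((1 + exp (w * ?s m)) * N (y - y') + ?s m * exp (w * ?s m) * N z')"
    unfolding euler_def using J_pow_taylor[OF mesh xy yz] by blast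
qed

lemma T_diff:
  assumes t: "0 \<le> t" and xy: "(x, y) \<in> A"
  shows "N (T t x - x) \<le> t * exp (w * t) * N y"
proof (rule LIMSEQ_le)
  let ?s = "\<lambda>m. real (nat \<lfloor>t * 2^m / h0\<rfloor>) * (h0 / 2^m)"
  note s = mesh_tendsto[OF t]
  show "(\<lambda>m. N (euler m t x - x)) \<longlonglongrightarrow> N (T t x - x)"
    by (intro tendsto_N tendsto_diff euler_LIMSEQ t tendsto_const)
  show "(\<lambda>m. ?s m * exp (w * ?s m) * N y) \<longlonglongrightarrow> t * exp (w * t) * N y"
    by (intro tendsto_mult tendsto_exp s tendsto_const)
  show "\<exists>M. \<forall>m\<ge>M. N (euler m t x - x) \<le> ?s m * exp (w * ?s m) * N y"
    unfolding euler_def using J_pow_diff[OF mesh xy] by blast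
qed

text \<open>On each grid the rounded times s and t add up to the rounded s + t or fall short by one
  step, and one Euler step moves an element of the domain by order h only.\<close>

lemma T_semigroup_A:
  assumes s: "0 \<le> s" and t: "0 \<le> t" and xy: "(x, y) \<in> A"
  shows "T (s + t) x = T s (T t x)"
proof (rule LIMSEQ_unique)
  show "(\<lambda>m. euler m (s + t) x) \<longlonglongrightarrow> T (s + t) x"
    using s t by (intro euler_LIMSEQ) auto
  have 1: "(\<lambda>m. euler m s (euler m t x)) \<longlonglongrightarrow> T s (T t x)"
  proof -
    have "(\<lambda>m. exp (w * s) * N (euler m t x - T t x)) \<longlonglongrightarrow> exp (w * s) * 0"
      by (intro tendsto_intros N_tendsto_zero euler_LIMSEQ t)
    then have lim: "(\<lambda>m. exp (w * s) * N (euler m t x - T t x)) \<longlonglongrightarrow> 0" by simp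
    have "(\<lambda>m. N (euler m s (euler m t x - T t x) - 0)) \<longlonglongrightarrow> 0"
      by (rule tendsto_sandwich[OF _ _ tendsto_const lim]) (auto simp: N_euler[OF s])
    then have "(\<lambda>m. euler m s (euler m t x - T t x) + euler m s (T t x)) \<longlonglongrightarrow> 0 + T s (T t x)"
      by (intro tendsto_add euler_LIMSEQ s N_tendsto_zeroI)
    then show ?thesis by (simp add: linear_diff[OF linear_euler])
  qed
  have 2: "(\<lambda>m. euler m (s + t) x - euler m s (euler m t x)) \<longlonglongrightarrow> 0"
  proof -
    have lim: "(\<lambda>m. h0 / 2^m * (exp (w * (s + t)) * N y)) \<longlonglongrightarrow> 0"
      using tendsto_mult[OF mesh_tendsto_0 tendsto_const[of "exp (w * (s + t)) * N y"]] by simp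
    have "N (euler m (s + t) x - euler m s (euler m t x)) \<le> h0 / 2^m * (exp (w * (s + t)) * N y)" for m
    proof -
      define h where "h = h0 / 2^m"
      have h: "0 < h" "h \<le> h0" using mesh[of m] by (auto simp: h_def)
      define a where "a = nat \<lfloor>s * 2^m / h0\<rfloor>"
      define b where "b = nat \<lfloor>t * 2^m / h0\<rfloor>"
      define c where "c = nat \<lfloor>(s + t) * 2^m / h0\<rfloor>"
      have "\<lfloor>p + q\<rfloor> = \<lfloor>p\<rfloor> + \<lfloor>q\<rfloor> \<or> \<lfloor>p + q\<rfloor> = \<lfloor>p\<rfloor> + \<lfloor>q\<rfloor> + 1" for p q :: real
        by linarith
      from this[of "s * 2^m / h0" "t * 2^m / h0"] have "c = a + b \<or> c = Suc (a + b)"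
        using s t h0_pos by (auto simp: a_def b_def c_def distrib_right add_divide_distrib nat_add_distrib)
      then show ?thesis
      proof
        assume c: "c = a + b"
        have "euler m (s + t) x - euler m s (euler m t x) = 0"
          unfolding euler_def a_def[symmetric] b_def[symmetric] c_def[symmetric] c
          by (simp add: funpow_add)
        then show ?thesis using h0_pos by simp
      next
        assume c: "c = Suc (a + b)"
        have "euler m (s + t) x - euler m s (euler m t x) = (J h ^^ (a + b)) (J h x - x)"
          unfolding euler_def a_def[symmetric] b_def[symmetric] c_def[symmetric] h_def[symmetric]
            linear_diff[OF linear_J_pow[OF h]] unfolding c
          by (simp add: funpow_add funpow_swap1)
        also have "\<dots> = h *\<^sub>R (J h ^^ c) y"
          unfolding J_diff_eq[OF h xy] linear_cmul[OF linear_J_pow[OF h]] c by (simp add: funpow_swap1)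
        also have "(J h ^^ c) y = euler m (s + t) y"
          by (simp add: euler_def h_def c_def)
        finally have "N (euler m (s + t) x - euler m s (euler m t x)) = h * N (euler m (s + t) y)"
          using h by (simp add: N_scaleR)
        also have "\<dots> \<le> h * (exp (w * (s + t)) * N y)"
          using h s t by (intro mult_left_mono N_euler) auto
        finally show ?thesis by (simp add: h_def)
      qed
    qed
    then have "(\<lambda>m. N (euler m (s + t) x - euler m s (euler m t x) - 0)) \<longlonglongrightarrow> 0"
      by (intro tendsto_sandwich[OF _ _ tendsto_const lim]) auto
    then show ?thesis by (rule N_tendsto_zeroI)
  qed
  show "(\<lambda>m. euler m (s + t) x) \<longlonglongrightarrow> T s (T t x)"
    using tendsto_add[OF 2 1] by simp
qed

lemma dense_ext:
  assumes f: "bounded_linear f" and g: "bounded_linear g"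
    and eq: "\<And>x y z. (x, y) \<in> A \<Longrightarrow> (y, z) \<in> A \<Longrightarrow> f x = g x"
  shows "f x = (g x :: 'b::real_normed_vector)"
proof -
  have bl: "bounded_linear (\<lambda>x. f x - g x)" using f g by (rule bounded_linear_sub)
  then obtain K where K: "0 < K" "\<And>x. norm (f x - g x) \<le> norm x * K"
    using bounded_linear.pos_bounded by blast
  have "norm (f x - g x) \<le> e" if "0 < e" for e
  proof -
    have "0 < e / K" using that K by simp
    then obtain x' y z where x': "(x', y) \<in> A" "(y, z) \<in> A" "N (x - x') < e / K"
      using A2_dense by blast
    have "f x - g x = f (x - x') - g (x - x')"
      using eq[OF x'(1,2)] bounded_linear.linear[OF f] bounded_linear.linear[OF g] by (simp add: linear_diff)
    then have "norm (f x - g x) \<le> norm (x - x') * K" using K by simp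
    also have "\<dots> \<le> (e / K) * K"
      using x'(3) norm_le_N[of "x - x'"] K by (intro mult_right_mono) auto
    finally show ?thesis using K by simp
  qed
  then have "norm (f x - g x) \<le> 0" by (rule field_le_epsilon[of _ 0, simplified])
  then show ?thesis by simp
qed

lemma T_semigroup:
  assumes s: "0 \<le> s" and t: "0 \<le> t"
  shows "T (s + t) x = T s (T t x)"
proof (rule dense_ext[of "T (s + t)" "\<lambda>x. T s (T t x)"])
  show "bounded_linear (T (s + t))" using s t by (intro bounded_linear_T) simp
  show "bounded_linear (\<lambda>x. T s (T t x))"
    by (rule bounded_linear_compose[OF bounded_linear_T[OF s] bounded_linear_T[OF t]])
qed (rule T_semigroup_A[OF s t])

lemma T_continuous_0: "((\<lambda>t. T t x) \<longlongrightarrow> x) (at_right 0)"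
proof (rule tendstoI)
  fix e :: real assume e: "0 < e"
  define \<delta> where "\<delta> = e / (3 * exp w)"
  have "\<delta> > 0" using e by (simp add: \<delta>_def)
  then obtain x' y z where x': "(x', y) \<in> A" "(y, z) \<in> A" "N (x - x') < \<delta>"
    using A2_dense by blast
  have "((\<lambda>t. t * exp (w * t) * N y) \<longlongrightarrow> 0 * exp (w * 0) * N y) (at_right 0)"
    by (intro tendsto_intros)
  then have "\<forall>\<^sub>F t in at_right 0. t * exp (w * t) * N y < e/3"
    using e by (intro order_tendstoD(2)) auto
  moreover have "\<forall>\<^sub>F t in at_right (0::real). 0 < t \<and> t < 1"
    by (metis (mono_tags, lifting) eventually_at_right_field zero_less_one)
  ultimately show "\<forall>\<^sub>F t in at_right 0. dist (T t x) x < e"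
  proof eventually_elim
    case (elim t)
    have "N (T t (x - x')) \<le> exp (w * t) * N (x - x')" using elim by (intro N_T) auto
    also have "\<dots> \<le> exp w * N (x - x')"
      using elim w_nonneg by (intro mult_right_mono) (auto intro: mult_left_le)
    also have "\<dots> < exp w * \<delta>" using x' by simp
    also have "\<dots> = e/3" by (simp add: \<delta>_def)
    finally have 1: "N (T t (x - x')) < e/3" .
    have 2: "N (T t x' - x') < e/3" using T_diff[of t, OF _ x'(1)] elim by linarith
    have "1 \<le> exp w" using w_nonneg by simp
    then have "e / (3 * exp w) \<le> e/3" using e by (intro frac_le) auto
    then have 3: "N (x' - x) < e/3"
      using x'(3) by (simp add: \<delta>_def N_diff_commute[of x' x])
    have "T t x - x = T t (x - x') + (T t x' - x') + (x' - x)"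
      using elim by (simp add: linear_diff[OF linear_T])
    then have "N (T t x - x) < e"
      using 1 2 3 N_triangle[of "T t (x - x') + (T t x' - x')" "x' - x"]
        N_triangle[of "T t (x - x')" "T t x' - x'"] by simp
    then show ?case using norm_le_N[of "T t x - x"] by (simp add: dist_norm)
  qed
qed

lemma C0_semigroup_T: "C0_semigroup T"
  unfolding C0_semigroup_def
  using bounded_linear_T T_zero T_semigroup T_continuous_0 by blast

section \<open>The generator of the limit semigroup, and uniqueness\<close>

text \<open>By \<open>T_taylor\<close> the difference quotient misses y by a multiple of N (y - y')
  plus a term of order t. First y' in the domain is chosen close to y, then t is sent to 0.\<close>

lemma A_subset_generator: "A \<subseteq> generator T"
proof
  fix a assume "a \<in> A"
  then obtain x y where a: "a = (x, y)" and xy: "(x, y) \<in> A" by (cases a) auto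
  have "((\<lambda>h. (T h x - x) /\<^sub>R h) \<longlongrightarrow> y) (at_right 0)"
  proof (rule N_tendsto_zeroI, rule tendstoI)
    fix e :: real assume e: "0 < e"
    have "0 < e / (2 * (1 + exp w))" using e by (simp add: add_pos_pos)
    then obtain y' z' z'' where y': "(y', z') \<in> A" "N (y - y') < e / (2 * (1 + exp w))"
      using A2_dense by blast
    have 1: "(1 + exp w) * N (y - y') < e/2"
    proof -
      have "1 + exp w > 0" by (simp add: add_pos_pos)
      then have "(1 + exp w) * N (y - y') < (1 + exp w) * (e / (2 * (1 + exp w)))"
        using y'(2) \<open>1 + exp w > 0\<close> by (intro mult_strict_left_mono)
      also have "\<dots> = e/2" using \<open>1 + exp w > 0\<close> by (simp add: field_simps)
      finally show ?thesis .
    qed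
    have "((\<lambda>t. t * exp (w * t) * N z') \<longlongrightarrow> 0 * exp (w * 0) * N z') (at_right 0)"
      by (intro tendsto_intros)
    then have "\<forall>\<^sub>F t in at_right 0. t * exp (w * t) * N z' < e/2"
      using e by (intro order_tendstoD(2)) auto
    moreover have "\<forall>\<^sub>F t in at_right (0::real). 0 < t \<and> t < 1"
      by (metis (mono_tags, lifting) eventually_at_right_field zero_less_one)
    ultimately show "\<forall>\<^sub>F t in at_right 0. dist (N ((T t x - x) /\<^sub>R t - y)) 0 < e"
    proof eventually_elim
      case (elim t)
      have eq: "(T t x - x) /\<^sub>R t - y = (T t x - x - t *\<^sub>R y) /\<^sub>R t"
        using elim by (simp add: scaleR_diff_right)
      have "N ((T t x - x) /\<^sub>R t - y) = N (T t x - x - t *\<^sub>R y) / t"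
      proof -
        have "\<bar>inverse t\<bar> = 1 / t" using elim by (simp add: inverse_eq_divide)
        then show ?thesis unfolding eq N_scaleR by simp
      qed
      also have "\<dots> \<le> (1 + exp (w * t)) * N (y - y') + t * exp (w * t) * N z'"
        using T_taylor[OF _ xy y'(1), of t] elim by (simp add: pos_divide_le_eq mult_ac)
      also have "\<dots> \<le> (1 + exp w) * N (y - y') + t * exp (w * t) * N z'"
        using elim w_nonneg by (intro add_mono mult_right_mono) (auto intro: mult_left_le)
      also have "\<dots> < e" using 1 elim by simp
      finally show ?case by simp
    qed
  qed
  then show "a \<in> generator T" by (simp add: a generator_def)
qed

text \<open>A has no proper extension that generates T: for (x, y) in the generator, x' - h y' = x -
  h y is solved within A, and d = x - x' is mapped by the generator to d / h. Growth at rate 1/h > w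
  contradicts \<open>N_T\<close> unless d = 0.\<close>

lemma generator_T: "generator T = A"
proof
  show "generator T \<subseteq> A"
  proof
    fix a assume "a \<in> generator T"
    then obtain x y where a: "a = (x, y)" and xy: "((\<lambda>h. (T h x - x) /\<^sub>R h) \<longlongrightarrow> y) (at_right 0)"
      by (auto simp: generator_def)
    \<comment> \<open>The bound 1 / (w + 1) ensures w h < 1.\<close>
    define h where "h = min h0 (1 / (w + 1))"
    have h: "0 < h" "h \<le> h0" using h0_pos w_nonneg by (auto simp: h_def)
    have hw: "w < 1/h"
    proof -
      have "w * h \<le> w * (1 / (w + 1))" using w_nonneg by (intro mult_left_mono) (auto simp: h_def)
      also have "\<dots> < 1" using w_nonneg by (simp add: field_simps)
      finally show ?thesis using h by (simp add: field_simps)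
    qed
    obtain x' y' where x': "(x', y') \<in> A" "x' - h *\<^sub>R y' = x - h *\<^sub>R y" using range[OF h] by blast
    define d where "d = x - x'"
    have "((\<lambda>s. (T s x' - x') /\<^sub>R s) \<longlongrightarrow> y') (at_right 0)"
      using A_subset_generator x'(1) by (auto simp: generator_def)
    with xy have "((\<lambda>s. (T s x - x) /\<^sub>R s - (T s x' - x') /\<^sub>R s) \<longlongrightarrow> y - y') (at_right 0)"
      by (rule tendsto_diff)
    moreover have "y - y' = d /\<^sub>R h"
    proof -
      have "d = h *\<^sub>R (y - y')" using x'(2) by (simp add: d_def algebra_simps)
      then show ?thesis using h by simp
    qed
    moreover have "\<forall>\<^sub>F s in at_right 0. (T s x - x) /\<^sub>R s - (T s x' - x') /\<^sub>R s = (T s d - d) /\<^sub>R s"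
      by (rule eventually_at_rightI[of 0 1])
         (auto simp: d_def linear_diff[OF linear_T] algebra_simps)
    ultimately have lim: "((\<lambda>s. (T s d - d) /\<^sub>R s) \<longlongrightarrow> d /\<^sub>R h) (at_right 0)"
      by (simp add: filterlim_cong)
    have "((\<lambda>s. (1/h) * N d - N ((T s d - d) /\<^sub>R s - d /\<^sub>R h)) \<longlongrightarrow> (1/h) * N d - 0) (at_right 0)"
      by (intro tendsto_diff tendsto_const N_tendsto_zero lim)
    moreover have "((\<lambda>s. (exp (w * s) - 1) / s * N d) \<longlongrightarrow> w * N d) (at_right 0)"
    proof -
      have "((\<lambda>s. exp (w * s)) has_real_derivative w) (at 0)"
        by (auto intro!: derivative_eq_intros)
      then have "((\<lambda>s. (exp (w * s) - 1) / s) \<longlongrightarrow> w) (at 0)"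
        by (simp add: has_field_derivative_iff)
      then have "((\<lambda>s. (exp (w * s) - 1) / s) \<longlongrightarrow> w) (at_right 0)"
        by (rule tendsto_within_subset) auto
      then show ?thesis by (intro tendsto_intros)
    qed
    moreover have "\<forall>\<^sub>F s in at_right 0. (1/h) * N d - N ((T s d - d) /\<^sub>R s - d /\<^sub>R h) \<le> (exp (w * s) - 1) / s * N d"
    proof (rule eventually_at_rightI[of 0 1])
      fix s :: real assume s: "s \<in> {0<..<1}"
      \<comment> \<open>T s d = (1 + s/h) d + s q with q -> 0. Comparing with N (T s d) \<le> exp (w
        s) N d and dividing by s gives (1/h) N d \<le> w N d in the limit.\<close>
      define q where "q = (T s d - d) /\<^sub>R s - d /\<^sub>R h"
      have "T s d = (1 + s / h) *\<^sub>R d + s *\<^sub>R q"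
        using s h by (simp add: q_def scaleR_diff_right scaleR_add_left divide_inverse)
      then have "(1 + s / h) *\<^sub>R d = T s d - s *\<^sub>R q" by simp
      then have "(1 + s / h) * N d \<le> N (T s d) + s * N q"
        using N_diff[of "T s d" "s *\<^sub>R q"] N_scaleR s h
        by (metis abs_of_nonneg add_nonneg_nonneg divide_nonneg_nonneg greaterThanLessThan_iff less_imp_le zero_le_one)
      also have "\<dots> \<le> exp (w * s) * N d + s * N q" using N_T[of s d] s by simp
      finally have "s * ((1/h) * N d - N q) \<le> (exp (w * s) - 1) * N d" by (simp add: algebra_simps)
      then show "(1/h) * N d - N ((T s d - d) /\<^sub>R s - d /\<^sub>R h) \<le> (exp (w * s) - 1) / s * N d"
        using s by (simp add: q_def field_simps)
    qed simp
    ultimately have "(1/h) * N d - 0 \<le> w * N d"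
      using tendsto_le[OF trivial_limit_at_right_real] by blast
    then have "(1/h - w) * N d \<le> 0" by (simp add: algebra_simps)
    with hw have "N d \<le> 0" by (simp add: mult_le_0_iff)
    then have "d = 0" using N_eq_0[of d] N_nonneg[of d] by linarith
    then have "x = x'" "y = y'" using x'(2) h by (auto simp: d_def)
    then show "a \<in> A" using a x'(1) by simp
  qed
qed (rule A_subset_generator)

text \<open>Cut [0,t] into n steps of length h = t/n. The error between S and T is the sum of the
  local discrepancies at the points S (k h) x, propagated by T; each is o(h), so the sum vanishes as
  n grows.\<close>

lemma semigroup_unique:
  assumes S: "C0_semigroup S" and gen: "generator S = A" and t: "0 \<le> t"
  shows "S t x = T t x"
proof (cases "t = 0")
  case True
  then show ?thesis using S by (simp add: T_zero C0_semigroup_def)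
next
  case False
  with t have t: "0 < t" by simp
  have bl: "\<And>s. 0 \<le> s \<Longrightarrow> bounded_linear (S s)" and S0: "\<And>x. S 0 x = x"
    and semi: "\<And>s r x. 0 \<le> s \<Longrightarrow> 0 \<le> r \<Longrightarrow> S (s + r) x = S s (S r x)"
    using S by (auto simp: C0_semigroup_def)
  \<comment> \<open>S maps the graph of its generator into itself. Hence S (k h) x stays in the
    domain of A^2, and \<open>T_taylor\<close> applies there with y' equal to y, so that its
    first-order term is zero.\<close>
  have graph: "(S s x, S s y) \<in> A" if xy: "(x, y) \<in> A" and s: "0 \<le> s" for s x y
  proof -
    interpret Ss: bounded_linear "S s" by (rule bl[OF s])
    have "((\<lambda>h. (S h x - x) /\<^sub>R h) \<longlongrightarrow> y) (at_right 0)"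
      using xy by (simp add: gen[symmetric] generator_def)
    then have "((\<lambda>h. S s ((S h x - x) /\<^sub>R h)) \<longlongrightarrow> S s y) (at_right 0)" by (rule Ss.tendsto)
    moreover have "\<forall>\<^sub>F h in at_right 0. S s ((S h x - x) /\<^sub>R h) = (S h (S s x) - S s x) /\<^sub>R h"
    proof (rule eventually_at_rightI[of 0 1])
      fix h :: real assume "h \<in> {0<..<1}"
      then show "S s ((S h x - x) /\<^sub>R h) = (S h (S s x) - S s x) /\<^sub>R h"
        using semi[of s h x] semi[of h s x] s by (simp add: Ss.scaleR Ss.diff add.commute)
    qed simp
    ultimately show ?thesis
      by (simp add: gen[symmetric] generator_def filterlim_cong)
  qed
  obtain M where M: "1 \<le> M" "\<And>s x. 0 \<le> s \<Longrightarrow> s \<le> t \<Longrightarrow> norm (S s x) \<le> M * norm x"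
    using C0_semigroup_locally_bounded[OF S, of t] by blast
  define K where "K = \<bar>C\<bar> * M"
  have K: "0 \<le> K" using M by (simp add: K_def)
  have NS: "N (S s x) \<le> K * norm x" if "0 \<le> s" "s \<le> t" for s x
  proof -
    have "N (S s x) \<le> \<bar>C\<bar> * norm (S s x)"
      by (rule order.trans[OF N_le_norm]) (simp add: mult_right_mono)
    also have "\<dots> \<le> \<bar>C\<bar> * (M * norm x)" using M(2)[OF that] by (simp add: mult_left_mono)
    finally show ?thesis by (simp add: K_def mult.assoc)
  qed
  show ?thesis
  proof (rule dense_ext[OF bl[OF less_imp_le[OF t]] bounded_linear_T[OF less_imp_le[OF t]]])
    fix x y z assume xy: "(x, y) \<in> A" and yz: "(y, z) \<in> A"
    \<comment> \<open>The local discrepancy: the remainder of S at x, carried to S (k h) x by the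
      bound K, plus the quadratic remainder of T. It is the same for all k.\<close>
    define b where "b h = K * norm (S h x - x - h *\<^sub>R y) + h * (h * exp (w * h) * (K * norm z))" for h
    have step: "N (S (real k * h) x - T (real k * h) x) \<le> real k * (exp (w * (real k * h)) * b h)"
      if h: "0 < h" and kh: "real k * h \<le> t" for h k
      using kh
    proof (induction k)
      case 0
      then show ?case by (simp add: S0 T_zero)
    next
      case (Suc k)
      have k0: "0 \<le> real k * h" using h by simp
      have Suc_eq: "real (Suc k) * h = h + real k * h" by (simp add: algebra_simps)
      have kt: "real k * h \<le> t" "h \<le> t" using Suc.prems h k0 unfolding Suc_eq by linarith+
      define \<xi> \<eta> \<zeta> where "\<xi> = S (real k * h) x" and "\<eta> = S (real k * h) y" and "\<zeta> = S (real k * h) z"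
      have b0: "0 \<le> b h" using h K by (simp add: b_def)
      have "S h \<xi> = S (real k * h) (S h x)"
        using semi[of h "real k * h" x] semi[of "real k * h" h x] h k0 by (simp add: \<xi>_def add.commute)
      then have e1: "S h \<xi> - \<xi> - h *\<^sub>R \<eta> = S (real k * h) (S h x - x - h *\<^sub>R y)"
        using bounded_linear.linear[OF bl[OF k0]]
        by (simp add: \<xi>_def \<eta>_def linear_diff linear_cmul)
      have 1: "N (S h \<xi> - \<xi> - h *\<^sub>R \<eta>) \<le> K * norm (S h x - x - h *\<^sub>R y)"
        unfolding e1 by (rule NS[OF k0 kt(1)])
      have "N (T h \<xi> - \<xi> - h *\<^sub>R \<eta>) \<le> h * (h * exp (w * h) * N \<zeta>)"
        using T_taylor[of h \<xi> \<eta> \<eta> \<zeta>] graph[OF xy k0] graph[OF yz k0] h by (simp add: \<xi>_def \<eta>_def \<zeta>_def)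
      also have "\<dots> \<le> h * (h * exp (w * h) * (K * norm z))"
        using NS[OF k0 kt(1), of z] h by (intro mult_left_mono) (auto simp: \<zeta>_def)
      finally have 2: "N (T h \<xi> - \<xi> - h *\<^sub>R \<eta>) \<le> h * (h * exp (w * h) * (K * norm z))" .
      have "N (S h \<xi> - T h \<xi>) \<le> b h"
        using N_diff[of "S h \<xi> - \<xi> - h *\<^sub>R \<eta>" "T h \<xi> - \<xi> - h *\<^sub>R \<eta>"] 1 2 by (simp add: b_def)
      moreover have "S (real (Suc k) * h) x - T (real (Suc k) * h) x =
          T h (\<xi> - T (real k * h) x) + (S h \<xi> - T h \<xi>)"
        unfolding Suc_eq using h k0
        by (simp add: semi T_semigroup \<xi>_def linear_diff[OF linear_T])
      ultimately have "N (S (real (Suc k) * h) x - T (real (Suc k) * h) x) \<le>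
          N (T h (\<xi> - T (real k * h) x)) + b h"
        using N_triangle[of "T h (\<xi> - T (real k * h) x)" "S h \<xi> - T h \<xi>"] by simp
      also have "N (T h (\<xi> - T (real k * h) x)) \<le> exp (w * h) * (real k * (exp (w * (real k * h)) * b h))"
      proof (rule order.trans[OF N_T])
        show "exp (w * h) * N (\<xi> - T (real k * h) x) \<le> exp (w * h) * (real k * (exp (w * (real k * h)) * b h))"
          unfolding \<xi>_def by (intro mult_left_mono Suc.IH kt(1)) simp
      qed (use h in simp)
      also have "\<dots> = real k * (exp (w * (real (Suc k) * h)) * b h)"
        unfolding Suc_eq by (simp add: distrib_left exp_add)
      also have "real k * (exp (w * (real (Suc k) * h)) * b h) + b h \<le> real (Suc k) * (exp (w * (real (Suc k) * h)) * b h)"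
      proof -
        have "0 \<le> w * (real (Suc k) * h)" using w_nonneg h by simp
        then have "1 * b h \<le> exp (w * (real (Suc k) * h)) * b h"
          using b0 by (intro mult_right_mono) auto
        then show ?thesis by (simp add: distrib_right)
      qed
      finally show ?case by simp
    qed
    have bound: "N (S t x - T t x) \<le> real (Suc n) * (exp (w * t) * b (t / real (Suc n)))" for n
      using step[of "t / real (Suc n)" "Suc n"] t by simp
    have tn: "(\<lambda>n. t / real (Suc n)) \<longlonglongrightarrow> 0"
      using LIMSEQ_Suc[OF lim_const_over_n[of t]] by simp
    then have tn': "filterlim (\<lambda>n. t / real (Suc n)) (at_right 0) sequentially"
      unfolding filterlim_at using t by simp
    have "((\<lambda>h. (S h x - x) /\<^sub>R h) \<longlongrightarrow> y) (at_right 0)"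
      using xy by (simp add: gen[symmetric] generator_def)
    then have "((\<lambda>h. norm ((S h x - x) /\<^sub>R h - y)) \<longlongrightarrow> 0) (at_right 0)"
      by (intro tendsto_norm_zero LIM_zero)
    then have l1: "(\<lambda>n. norm ((S (t / real (Suc n)) x - x) /\<^sub>R (t / real (Suc n)) - y)) \<longlonglongrightarrow> 0"
      by (rule filterlim_compose[OF _ tn'])
    have eq: "real (Suc n) * b (t / real (Suc n)) =
      K * (t * norm ((S (t / real (Suc n)) x - x) /\<^sub>R (t / real (Suc n)) - y)) +
      t * (t / real (Suc n) * exp (w * (t / real (Suc n))) * (K * norm z))" for n
    proof -
      define h where "h = t / real (Suc n)"
      have h: "0 < h" "real (Suc n) * h = t" using t by (auto simp: h_def)
      have "norm (S h x - x - h *\<^sub>R y) = h * norm ((S h x - x) /\<^sub>R h - y)"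
      proof -
        have "S h x - x - h *\<^sub>R y = h *\<^sub>R ((S h x - x) /\<^sub>R h - y)" using h by (simp add: scaleR_diff_right)
        then show ?thesis using h by simp
      qed
      then have "real (Suc n) * b h = K * ((real (Suc n) * h) * norm ((S h x - x) /\<^sub>R h - y)) +
          (real (Suc n) * h) * (h * exp (w * h) * (K * norm z))"
        unfolding b_def by (simp only: algebra_simps)
      then show ?thesis unfolding h(2) unfolding h_def .
    qed
    have "(\<lambda>n. exp (w * t) * (K * (t * norm ((S (t / real (Suc n)) x - x) /\<^sub>R (t / real (Suc n)) - y)) +
      t * (t / real (Suc n) * exp (w * (t / real (Suc n))) * (K * norm z))))
      \<longlonglongrightarrow> exp (w * t) * (K * (t * 0) + t * (0 * exp (w * 0) * (K * norm z)))"
      by (intro tendsto_mult tendsto_add tendsto_exp tendsto_const l1 tn)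
    then have "(\<lambda>n. exp (w * t) * (real (Suc n) * b (t / real (Suc n)))) \<longlonglongrightarrow> 0"
      unfolding eq by simp
    then have "N (S t x - T t x) \<le> 0"
      by (rule LIMSEQ_le_const) (use bound in \<open>auto simp: mult_ac\<close>)
    then have "N (S t x - T t x) = 0" using N_nonneg[of "S t x - T t x"] by linarith
    then show "S t x = T t x" using N_eq_0[of "S t x - T t x"] by simp
  qed
qed

end

subsection \<open>The Hilbert space of square-integrable functions\<close>

abbreviation "I01 \<equiv> lebesgue_on {0..1::real}"

lemma emeasure_I01 [simp]: "emeasure I01 {0..1} = 1" "measure I01 {0..1} = 1"
  by (simp_all add: emeasure_restrict_space measure_restrict_space)

lemma finite_measure_I01: "finite_measure I01"
  by (rule finite_measureI) (simp add: emeasure_restrict_space)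

lemma sq_integrable_rep: "sq_integrable (rep_L2 F)"
  using Quotient3_rep_reflp[OF Quotient3_L2, of F] by simp

lemma abs_rep_L2 [simp]: "abs_L2 (rep_L2 F) = F"
  by (rule Quotient3_abs_rep[OF Quotient3_L2])

lemma abs_L2_eq_iff:
  assumes "sq_integrable f" "sq_integrable g"
  shows "abs_L2 f = abs_L2 g \<longleftrightarrow> (AE x in I01. f x = g x)"
  using Quotient3_rel[OF Quotient3_L2, of f g] assms by auto

lemma abs_L2_cong:
  assumes "sq_integrable f" "\<And>x. x \<in> {0..1} \<Longrightarrow> f x = g x"
  shows "sq_integrable g" "abs_L2 f = abs_L2 g"
proof -
  show g: "sq_integrable g"
    unfolding sq_integrable_def
  proof
    show "g \<in> borel_measurable I01"
      using assms measurable_cong[of I01 f g borel] by (simp add: sq_integrable_def)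
    have "integrable I01 (\<lambda>x. (f x)\<^sup>2) \<longleftrightarrow> integrable I01 (\<lambda>x. (g x)\<^sup>2)"
      by (rule Bochner_Integration.integrable_cong) (auto simp: assms(2))
    then show "integrable I01 (\<lambda>x. (g x)\<^sup>2)"
      using assms(1) by (simp add: sq_integrable_def)
  qed
  show "abs_L2 f = abs_L2 g"
    using assms(2) by (subst abs_L2_eq_iff[OF assms(1) g]) (auto intro!: AE_I2)
qed

lemma L2_cases:
  obtains f where "sq_integrable f" "F = abs_L2 f"
  using sq_integrable_rep abs_rep_L2 by metis

lemma sq_integrable_diff: "sq_integrable f \<Longrightarrow> sq_integrable g \<Longrightarrow> sq_integrable (\<lambda>x. f x - g x)"
  using sq_integrable_add[OF _ sq_integrable_scale[where c = "-1"]] by simp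

lemma abs_L2_add: "sq_integrable f \<Longrightarrow> sq_integrable g \<Longrightarrow> abs_L2 f + abs_L2 g = abs_L2 (\<lambda>x. f x + g x)"
  by (rule plus_L2.abs_eq) auto

lemma abs_L2_diff: "sq_integrable f \<Longrightarrow> sq_integrable g \<Longrightarrow> abs_L2 f - abs_L2 g = abs_L2 (\<lambda>x. f x - g x)"
  by (rule minus_L2.abs_eq) auto

lemma abs_L2_scaleR: "sq_integrable f \<Longrightarrow> c *\<^sub>R abs_L2 f = abs_L2 (\<lambda>x. c * f x)"
  by (rule scaleR_L2.abs_eq) auto

lemma inner_abs_L2: "sq_integrable f \<Longrightarrow> sq_integrable g \<Longrightarrow> inner (abs_L2 f) (abs_L2 g) = (LINT x|I01. f x * g x)"
  by (rule inner_L2.abs_eq) auto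

lemma norm_abs_L2: "sq_integrable f \<Longrightarrow> (norm (abs_L2 f))\<^sup>2 = (LINT x|I01. (f x)\<^sup>2)"
  unfolding power2_norm_eq_inner by (simp add: inner_abs_L2 power2_eq_square)

lemma bounded_sq_integrable:
  assumes f: "f \<in> borel_measurable I01" and B: "\<And>x. x \<in> {0..1} \<Longrightarrow> \<bar>f x\<bar> \<le> B"
  shows "sq_integrable f" "norm (abs_L2 f) \<le> B"
proof -
  interpret finite_measure I01 by (rule finite_measure_I01)
  have B0: "0 \<le> B" using B[of 0] by simp
  have le: "(f x)\<^sup>2 \<le> B\<^sup>2" if "x \<in> {0..1}" for x
    using B[OF that] power_mono[of "\<bar>f x\<bar>" B 2] by simp
  have int: "integrable I01 (\<lambda>x. (f x)\<^sup>2)"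
    by (rule integrable_const_bound[of _ "B\<^sup>2"]) (use f le in \<open>auto intro!: AE_I2\<close>)
  then show sq: "sq_integrable f" using f by (simp add: sq_integrable_def)
  have "(LINT x|I01. (f x)\<^sup>2) \<le> (LINT x|I01. B\<^sup>2)"
    by (rule integral_mono[OF int]) (use le in auto)
  also have "\<dots> = B\<^sup>2" by (simp add: measure_def)
  finally have "(norm (abs_L2 f))\<^sup>2 \<le> B\<^sup>2" by (simp add: norm_abs_L2[OF sq])
  then show "norm (abs_L2 f) \<le> B" using B0 by (rule power2_le_imp_le)
qed

lemma continuous_sq_integrable:
  assumes "continuous_on {0..1} f"
  shows "sq_integrable f"
proof -
  have "compact (f ` {0..1})" using assms by (intro compact_continuous_image) auto
  then have "\<exists>B. \<forall>x\<in>{0..1}. \<bar>f x\<bar> \<le> B"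
    using compact_imp_bounded[of "f ` {0..1}"] by (simp add: bounded_iff)
  then obtain B where "\<forall>x\<in>{0..1}. \<bar>f x\<bar> \<le> B" ..
  then show ?thesis
    using assms by (intro bounded_sq_integrable(1)[of f B] continuous_imp_measurable_on_sets_lebesgue) auto
qed

definition one_L2 :: L2 where "one_L2 = abs_L2 (\<lambda>x. 1)"

lemma sq_integrable_const: "sq_integrable (\<lambda>x. c)"
  by (rule continuous_sq_integrable) auto

lemma norm_one_L2 [simp]: "norm one_L2 = 1"
proof -
  have "(norm one_L2)\<^sup>2 = 1"
    unfolding one_L2_def norm_abs_L2[OF sq_integrable_const] by (simp add: measure_def)
  then show ?thesis by (simp add: power2_eq_1_iff) (metis norm_ge_zero not_one_le_zero neg_0_le_iff_le)
qed

lemma sq_integrable_imp_integrable: "sq_integrable f \<Longrightarrow> integrable I01 f"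
  using sq_integrable_mult[of f "\<lambda>x. 1"] sq_integrable_const[of 1] by simp

lemma sq_integrable_abs: "sq_integrable f \<Longrightarrow> sq_integrable (\<lambda>x. \<bar>f x\<bar>)"
  by (auto simp: sq_integrable_def)

text \<open>Cauchy-Schwarz against the constant 1 on an interval of measure 1.\<close>

lemma integral_abs_le_norm:
  assumes f: "sq_integrable f"
  shows "(LINT x|I01. \<bar>f x\<bar>) \<le> norm (abs_L2 f)"
proof -
  have n: "norm (abs_L2 (\<lambda>x. \<bar>f x\<bar>)) = norm (abs_L2 f)"
    by (rule power2_eq_imp_eq) (simp_all add: norm_abs_L2 f sq_integrable_abs)
  have "(LINT x|I01. \<bar>f x\<bar>) = inner one_L2 (abs_L2 (\<lambda>x. \<bar>f x\<bar>))"
    unfolding one_L2_def by (simp add: inner_abs_L2 sq_integrable_const sq_integrable_abs f)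
  also have "\<dots> \<le> norm one_L2 * norm (abs_L2 (\<lambda>x. \<bar>f x\<bar>))" by (rule norm_cauchy_schwarz)
  finally show ?thesis by (simp add: n)
qed

section \<open>Completeness\<close>

text \<open>Riesz-Fischer: along a fast subsequence the increments are summable in L1, hence
  absolutely summable almost everywhere. Fatou's lemma then bounds the L2 distance to the pointwise
  limit.\<close>

lemma L2_complete:
  fixes X :: "nat \<Rightarrow> L2"
  assumes "Cauchy X"
  shows "convergent X"
proof -
  have "\<forall>k. \<exists>M. \<forall>m\<ge>M. \<forall>n\<ge>M. norm (X m - X n) < (1/2)^k"
    using CauchyD[OF assms] by simp
  then obtain M where M: "\<And>k m n. M k \<le> m \<Longrightarrow> M k \<le> n \<Longrightarrow> norm (X m - X n) < (1/2)^k"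
    by metis
  \<comment> \<open>Summing the thresholds makes r strictly increasing and r n at least M k for
    every k \<le> n.\<close>
  define r where "r n = n + (\<Sum>i\<le>n. M i)" for n
  have r: "M k \<le> r n" if "k \<le> n" for k n
  proof -
    have "M k \<le> (\<Sum>i\<le>n. M i)" using that by (intro member_le_sum) auto
    then show ?thesis by (simp add: r_def)
  qed
  have "strict_mono r" by (simp add: strict_mono_Suc_iff r_def)
  define f where "f n = rep_L2 (X (r n))" for n
  have f: "sq_integrable (f n)" and Xf: "X (r n) = abs_L2 (f n)" for n
    by (simp_all add: f_def sq_integrable_rep)
  have fm [measurable]: "f n \<in> borel_measurable I01" for n using f[of n] by (simp add: sq_integrable_def)
  have "AE x in I01. convergent (\<lambda>n. f n x)"
  proof -
    define d where "d n x = f (Suc n) x - f n x" for n x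
    have d: "sq_integrable (d n)" for n unfolding d_def by (intro sq_integrable_diff f)
    have dm [measurable]: "d n \<in> borel_measurable I01" for n using d[of n] by (simp add: sq_integrable_def)
    have dn: "(\<integral>\<^sup>+x. ennreal \<bar>d n x\<bar> \<partial>I01) \<le> ennreal ((1/2)^n)" for n
    proof -
      have "(\<integral>\<^sup>+x. ennreal \<bar>d n x\<bar> \<partial>I01) = ennreal (LINT x|I01. \<bar>d n x\<bar>)"
        by (intro nn_integral_eq_integral sq_integrable_imp_integrable sq_integrable_abs d) auto
      also have "(LINT x|I01. \<bar>d n x\<bar>) \<le> norm (abs_L2 (d n))" by (rule integral_abs_le_norm[OF d])
      also have "abs_L2 (d n) = X (r (Suc n)) - X (r n)"
        by (simp add: Xf abs_L2_diff f d_def[abs_def])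
      also have "norm \<dots> \<le> (1/2)^n" using M[OF r r, of n "Suc n" n] by simp
      finally show ?thesis by (simp add: ennreal_leI)
    qed
    have "(\<integral>\<^sup>+x. (\<Sum>n. ennreal \<bar>d n x\<bar>) \<partial>I01) = (\<Sum>n. \<integral>\<^sup>+x. ennreal \<bar>d n x\<bar> \<partial>I01)"
      by (rule nn_integral_suminf) simp
    also have "\<dots> \<le> (\<Sum>n. ennreal ((1/2)^n))" by (intro suminf_le dn summableI)
    also have "\<dots> = ennreal (\<Sum>n. (1/2)^n)" by (intro suminf_ennreal2 summable_geometric) auto
    finally have "(\<integral>\<^sup>+x. (\<Sum>n. ennreal \<bar>d n x\<bar>) \<partial>I01) \<noteq> \<infinity>"
      by (auto simp: top_unique)
    then have "AE x in I01. (\<Sum>n. ennreal \<bar>d n x\<bar>) \<noteq> \<infinity>"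
      by (intro nn_integral_noteq_infinite) auto
    then show ?thesis
    proof (rule AE_mp, intro AE_I2 impI)
      fix x assume "(\<Sum>n. ennreal \<bar>d n x\<bar>) \<noteq> \<infinity>"
      then have "summable (\<lambda>n. \<bar>d n x\<bar>)" by (intro summable_suminf_not_top) auto
      then have "summable (\<lambda>n. d n x)" by (rule summable_rabs_cancel)
      then have "convergent (\<lambda>n. (\<Sum>i<n. d i x) + f 0 x)"
        by (intro convergent_add convergent_const) (simp add: summable_iff_convergent)
      moreover have "(\<Sum>i<n. d i x) + f 0 x = f n x" for n
        unfolding d_def by (subst sum_lessThan_telescope) simp
      ultimately show "convergent (\<lambda>n. f n x)" by simp
    qed
  qed
  then have lim: "AE x in I01. (\<lambda>n. f n x) \<longlonglongrightarrow> lim (\<lambda>n. f n x)"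
    by (rule AE_mp) (auto simp: convergent_LIMSEQ_iff)
  define l where "l x = lim (\<lambda>n. f n x)" for x
  have lm [measurable]: "l \<in> borel_measurable I01" unfolding l_def by (rule borel_measurable_lim_metric) simp
  have bound: "(\<integral>\<^sup>+x. ennreal ((l x - f n x)\<^sup>2) \<partial>I01) \<le> ennreal (((1/2)^n)\<^sup>2)" for n
  proof -
    have "(\<integral>\<^sup>+x. ennreal ((l x - f n x)\<^sup>2) \<partial>I01) = (\<integral>\<^sup>+x. liminf (\<lambda>m. ennreal ((f m x - f n x)\<^sup>2)) \<partial>I01)"
    proof (rule nn_integral_cong_AE, rule AE_mp[OF lim], intro AE_I2 impI)
      fix x assume "(\<lambda>n. f n x) \<longlonglongrightarrow> lim (\<lambda>n. f n x)"
      then have "(\<lambda>m. ennreal ((f m x - f n x)\<^sup>2)) \<longlonglongrightarrow> ennreal ((l x - f n x)\<^sup>2)"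
        unfolding l_def by (intro tendsto_intros)
      then show "ennreal ((l x - f n x)\<^sup>2) = liminf (\<lambda>m. ennreal ((f m x - f n x)\<^sup>2))"
        by (rule lim_imp_Liminf[OF trivial_limit_sequentially, symmetric])
    qed
    also have "\<dots> \<le> liminf (\<lambda>m. \<integral>\<^sup>+x. ennreal ((f m x - f n x)\<^sup>2) \<partial>I01)"
      by (rule nn_integral_liminf) simp
    also have "\<dots> \<le> ennreal (((1/2)^n)\<^sup>2)"
    proof -
      have "(\<integral>\<^sup>+x. ennreal ((f m x - f n x)\<^sup>2) \<partial>I01) \<le> ennreal (((1/2)^n)\<^sup>2)" if "n \<le> m" for m
      proof -
        have "(\<integral>\<^sup>+x. ennreal ((f m x - f n x)\<^sup>2) \<partial>I01) = ennreal (LINT x|I01. (f m x - f n x)\<^sup>2)"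
          using sq_integrable_diff[OF f f, of m n]
          by (intro nn_integral_eq_integral) (auto simp: sq_integrable_def)
        also have "(LINT x|I01. (f m x - f n x)\<^sup>2) = (norm (X (r m) - X (r n)))\<^sup>2"
          by (simp add: Xf abs_L2_diff f norm_abs_L2 sq_integrable_diff)
        also have "\<dots> \<le> ((1/2)^n)\<^sup>2"
          using M[OF r r, of n m n] that by (intro power_mono) auto
        finally show ?thesis by (simp add: ennreal_leI)
      qed
      then have "eventually (\<lambda>m. (\<integral>\<^sup>+x. ennreal ((f m x - f n x)\<^sup>2) \<partial>I01) \<le> ennreal (((1/2)^n)\<^sup>2)) sequentially"
        by (auto simp: eventually_sequentially)
      then have "liminf (\<lambda>m. \<integral>\<^sup>+x. ennreal ((f m x - f n x)\<^sup>2) \<partial>I01) \<le> liminf (\<lambda>m. ennreal (((1/2)^n)\<^sup>2))"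
        by (rule Liminf_mono)
      then show ?thesis by (simp add: Liminf_const)
    qed
    finally show ?thesis .
  qed
  have dl: "sq_integrable (\<lambda>x. l x - f n x)" for n
  proof -
    have "(\<integral>\<^sup>+x. ennreal ((l x - f n x)\<^sup>2) \<partial>I01) < \<infinity>"
      using bound[of n] by (rule le_less_trans) simp
    then have "integrable I01 (\<lambda>x. (l x - f n x)\<^sup>2)" by (intro integrableI_nonneg) auto
    then show ?thesis by (simp add: sq_integrable_def)
  qed
  have l: "sq_integrable l" using sq_integrable_add[OF dl[of 0] f[of 0]] by simp
  have near: "norm (X (r n) - abs_L2 l) \<le> (1/2)^n" for n
  proof -
    have "ennreal (LINT x|I01. (l x - f n x)\<^sup>2) = (\<integral>\<^sup>+x. ennreal ((l x - f n x)\<^sup>2) \<partial>I01)"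
      using dl[of n] by (intro nn_integral_eq_integral[symmetric]) (auto simp: sq_integrable_def)
    then have "ennreal (LINT x|I01. (l x - f n x)\<^sup>2) \<le> ennreal (((1/2)^n)\<^sup>2)"
      using bound[of n] by (simp only:)
    then have "(LINT x|I01. (l x - f n x)\<^sup>2) \<le> ((1/2)^n)\<^sup>2"
      by (subst (asm) ennreal_le_iff) auto
    then have "(norm (abs_L2 l - X (r n)))\<^sup>2 \<le> ((1/2)^n)\<^sup>2"
      by (simp add: Xf abs_L2_diff f l norm_abs_L2 dl)
    then have "norm (abs_L2 l - X (r n)) \<le> (1/2)^n" by (rule power2_le_imp_le) simp
    then show ?thesis by (simp add: norm_minus_commute)
  qed
  have "(\<lambda>n. (1/2)^n) \<longlonglongrightarrow> (0::real)" by (rule LIMSEQ_power_zero) auto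
  then have "(\<lambda>n. X (r n) - abs_L2 l) \<longlonglongrightarrow> 0"
    by (rule Lim_null_comparison[rotated]) (simp add: near)
  then have "(X \<circ> r) \<longlonglongrightarrow> abs_L2 l" unfolding o_def by (rule LIM_zero_cancel)
  then have "X \<longlonglongrightarrow> abs_L2 l"
    by (rule Cauchy_converges_subseq[OF assms \<open>strict_mono r\<close>])
  then show ?thesis by (rule convergentI)
qed

instance L2 :: banach
  by standard (rule L2_complete)

section \<open>Density of polynomials\<close>

text \<open>Dominated convergence for the squared difference. Square integrability of the difference
  is part of the conclusion because \<open>abs_L2\<close> is meaningful only on such
  functions.\<close>

lemma norm_abs_L2_tendsto_zero:
  assumes g: "\<And>n. g n \<in> borel_measurable I01" and f: "f \<in> borel_measurable I01"
    and dom: "integrable I01 w" "\<And>n. AE x in I01. (f x - g n x)\<^sup>2 \<le> w x"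
    and lim: "AE x in I01. (\<lambda>n. g n x) \<longlonglongrightarrow> f x"
  shows "(\<lambda>n. norm (abs_L2 (\<lambda>x. f x - g n x))) \<longlonglongrightarrow> 0" "sq_integrable (\<lambda>x. f x - g n x)"
proof -
  have m: "(\<lambda>x. (f x - g n x)\<^sup>2) \<in> borel_measurable I01" for n using f g[of n] by simp
  have sq: "sq_integrable (\<lambda>x. f x - g n x)" for n
    unfolding sq_integrable_def
  proof
    show "(\<lambda>x. f x - g n x) \<in> borel_measurable I01" using f g[of n] by simp
    show "integrable I01 (\<lambda>x. (f x - g n x)\<^sup>2)"
    proof (rule Bochner_Integration.integrable_bound[OF dom(1) m])
      show "AE x in I01. norm ((f x - g n x)\<^sup>2) \<le> norm (w x)"
        using dom(2)[of n] by eventually_elim (simp add: abs_le_iff order_trans[OF _ abs_ge_self])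
    qed
  qed
  show "sq_integrable (\<lambda>x. f x - g n x)" by (rule sq)
  have "(\<lambda>n. LINT x|I01. (f x - g n x)\<^sup>2) \<longlonglongrightarrow> (LINT x|I01. 0)"
  proof (rule integral_dominated_convergence[OF _ m dom(1)])
    show "AE x in I01. (\<lambda>n. (f x - g n x)\<^sup>2) \<longlonglongrightarrow> 0"
      using lim
    proof eventually_elim
      case (elim x)
      have "(\<lambda>n. (f x - g n x)\<^sup>2) \<longlonglongrightarrow> (f x - f x)\<^sup>2" by (intro tendsto_intros elim)
      then show ?case by simp
    qed
    show "AE x in I01. norm ((f x - g n x)\<^sup>2) \<le> w x" for n using dom(2)[of n] by simp
  qed simp
  then have "(\<lambda>n. (norm (abs_L2 (\<lambda>x. f x - g n x)))\<^sup>2) \<longlonglongrightarrow> 0"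
    by (simp add: norm_abs_L2 sq)
  then have "(\<lambda>n. sqrt ((norm (abs_L2 (\<lambda>x. f x - g n x)))\<^sup>2)) \<longlonglongrightarrow> sqrt 0"
    by (rule tendsto_real_sqrt)
  then show "(\<lambda>n. norm (abs_L2 (\<lambda>x. f x - g n x))) \<longlonglongrightarrow> 0" by simp
qed

definition clamp_to :: "real \<Rightarrow> real \<Rightarrow> real" where
  "clamp_to k y = max (- k) (min k y)"

lemma clamp_to_bound: "0 \<le> k \<Longrightarrow> \<bar>clamp_to k y\<bar> \<le> k"
  by (auto simp: clamp_to_def)

text \<open>Truncation, almost everywhere approximation by continuous functions, and Weierstrass
  cost e/3 each. Polynomials are the target because trace identities are classical for them.\<close>

lemma polynomials_dense_L2:
  assumes e: "0 < e"
  obtains p where "real_polynomial_function p" "norm (F - abs_L2 p) < e"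
proof -
  obtain f where f: "sq_integrable f" and F: "F = abs_L2 f" by (rule L2_cases)
  have fm: "f \<in> borel_measurable I01" and fi: "integrable I01 (\<lambda>x. (f x)\<^sup>2)"
    using f by (auto simp: sq_integrable_def)
  have clamp_m: "(\<lambda>x. clamp_to k (h x)) \<in> borel_measurable I01" if "h \<in> borel_measurable I01" for h k
    using that unfolding clamp_to_def by simp
  have "(\<lambda>n. norm (abs_L2 (\<lambda>x. f x - clamp_to (real n) (f x)))) \<longlonglongrightarrow> 0"
  proof (rule norm_abs_L2_tendsto_zero(1)[OF clamp_m[OF fm] fm fi])
    show "AE x in I01. (f x - clamp_to (real n) (f x))\<^sup>2 \<le> (f x)\<^sup>2" for n
    proof (rule AE_I2)
      fix x
      have "\<bar>f x - clamp_to (real n) (f x)\<bar> \<le> \<bar>f x\<bar>" by (auto simp: clamp_to_def)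
      then show "(f x - clamp_to (real n) (f x))\<^sup>2 \<le> (f x)\<^sup>2" by (simp add: abs_le_square_iff)
    qed
    show "AE x in I01. (\<lambda>n. clamp_to (real n) (f x)) \<longlonglongrightarrow> f x"
    proof (rule AE_I2)
      fix x
      obtain N where "\<bar>f x\<bar> \<le> real N" using real_arch_simple by blast
      then have "clamp_to (real n) (f x) = f x" if "N \<le> n" for n
        using that by (auto simp: clamp_to_def)
      then have "eventually (\<lambda>n. clamp_to (real n) (f x) = f x) sequentially"
        by (auto simp: eventually_sequentially)
      then show "(\<lambda>n. clamp_to (real n) (f x)) \<longlonglongrightarrow> f x" by (rule tendsto_eventually)
    qed
  qed
  then have "\<forall>\<^sub>F n in sequentially. norm (abs_L2 (\<lambda>x. f x - clamp_to (real n) (f x))) < e/3"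
    using e by (intro order_tendstoD(2)) auto
  then obtain k where k: "norm (abs_L2 (\<lambda>x. f x - clamp_to (real k) (f x))) < e/3"
    by (auto simp: eventually_sequentially)
  define f1 where "f1 x = clamp_to (real k) (f x)" for x
  have f1m: "f1 \<in> borel_measurable I01" unfolding f1_def by (rule clamp_m[OF fm])
  have f1b: "\<bar>f1 x\<bar> \<le> real k" for x by (simp add: f1_def clamp_to_bound)
  have f1: "sq_integrable f1" by (rule bounded_sq_integrable(1)[OF f1m f1b])
  have "(\<lambda>x. if x \<in> {0..1} then f1 x else 0) \<in> borel_measurable lebesgue"
    using f1m by (subst borel_measurable_if) auto
  then have "(\<lambda>x. if x \<in> {0..1} then f1 x else 0) measurable_on UNIV"
    by (rule lebesgue_measurable_imp_measurable_on_real) simp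
  then obtain Z g where Z: "negligible Z" and g: "\<And>n. continuous_on UNIV (g n)"
    and lim: "\<And>x. x \<notin> Z \<Longrightarrow> (\<lambda>n. g n x) \<longlonglongrightarrow> (if x \<in> {0..1} then f1 x else 0)"
    unfolding measurable_on_def by auto
  \<comment> \<open>The continuous approximants come without a common bound. Clamping them at the
    truncation level preserves continuity and their limit f1, and supplies a constant
    majorant.\<close>
  have gc: "continuous_on {0..1} (\<lambda>x. clamp_to (real k) (g n x))" for n
    unfolding clamp_to_def by (intro continuous_intros continuous_on_subset[OF g]) auto
  have "(\<lambda>n. norm (abs_L2 (\<lambda>x. f1 x - clamp_to (real k) (g n x)))) \<longlonglongrightarrow> 0"
  proof (rule norm_abs_L2_tendsto_zero(1)[OF _ f1m, of _ "\<lambda>x. (2 * real k)\<^sup>2"])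
    show "(\<lambda>x. clamp_to (real k) (g n x)) \<in> borel_measurable I01" for n
      using continuous_sq_integrable[OF gc] by (simp add: sq_integrable_def)
    show "integrable I01 (\<lambda>x. (2 * real k)\<^sup>2)"
      using sq_integrable_const[of "2 * real k"] by (simp add: sq_integrable_def)
    show "AE x in I01. (f1 x - clamp_to (real k) (g n x))\<^sup>2 \<le> (2 * real k)\<^sup>2" for n
    proof (rule AE_I2)
      fix x
      have "\<bar>f1 x - clamp_to (real k) (g n x)\<bar> \<le> 2 * real k"
        using f1b[of x] clamp_to_bound[of "real k" "g n x"] by linarith
      then have "\<bar>f1 x - clamp_to (real k) (g n x)\<bar>\<^sup>2 \<le> (2 * real k)\<^sup>2" by (rule power_mono) simp
      then show "(f1 x - clamp_to (real k) (g n x))\<^sup>2 \<le> (2 * real k)\<^sup>2" by simp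
    qed
    have "AE x in lebesgue. x \<notin> Z"
      using Z by (simp add: negligible_iff_null_sets AE_not_in)
    then have "AE x in I01. x \<notin> Z" by (subst AE_restrict_space_iff) auto
    then show "AE x in I01. (\<lambda>n. clamp_to (real k) (g n x)) \<longlonglongrightarrow> f1 x"
    proof (rule AE_mp, intro AE_I2 impI)
      fix x assume x: "x \<in> space I01" "x \<notin> Z"
      then have "(\<lambda>n. clamp_to (real k) (g n x)) \<longlonglongrightarrow> clamp_to (real k) (f1 x)"
        unfolding clamp_to_def using lim[of x] by (intro tendsto_intros) auto
      moreover have "clamp_to (real k) (f1 x) = f1 x"
        using f1b[of x] by (auto simp: clamp_to_def)
      ultimately show "(\<lambda>n. clamp_to (real k) (g n x)) \<longlonglongrightarrow> f1 x" by simp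
    qed
  qed
  then have "\<forall>\<^sub>F n in sequentially. norm (abs_L2 (\<lambda>x. f1 x - clamp_to (real k) (g n x))) < e/3"
    using e by (intro order_tendstoD(2)) auto
  then obtain n where n: "norm (abs_L2 (\<lambda>x. f1 x - clamp_to (real k) (g n x))) < e/3"
    by (auto simp: eventually_sequentially)
  define f2 where "f2 x = clamp_to (real k) (g n x)" for x
  have f2c: "continuous_on {0..1} f2" unfolding f2_def by (rule gc)
  then have f2: "sq_integrable f2" by (rule continuous_sq_integrable)
  obtain p where p: "real_polynomial_function p" "\<And>x. x \<in> {0..1} \<Longrightarrow> \<bar>f2 x - p x\<bar> < e/3"
    using Stone_Weierstrass_real_polynomial_function[OF _ f2c, of "e/3"] e by auto
  have pc: "continuous_on {0..1} p"
    using p(1) by (simp add: continuous_on_polymonial_function real_polynomial_function_eq)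
  then have psq: "sq_integrable p" by (rule continuous_sq_integrable)
  have "norm (abs_L2 (\<lambda>x. f2 x - p x)) \<le> e/3"
    by (rule bounded_sq_integrable(2))
       (use sq_integrable_diff[OF f2 psq] p(2) in \<open>auto simp: sq_integrable_def intro: less_imp_le\<close>)
  then have "norm (F - abs_L2 f1) + norm (abs_L2 f1 - abs_L2 f2) + norm (abs_L2 f2 - abs_L2 p) < e"
    using k n unfolding f1_def[symmetric] f2_def[symmetric] F by (simp add: abs_L2_diff f f1 f2 psq)
  moreover have "norm (F - abs_L2 p) \<le> norm (F - abs_L2 f1) + norm (abs_L2 f1 - abs_L2 f2) + norm (abs_L2 f2 - abs_L2 p)"
    using norm_triangle_ineq[of "F - abs_L2 f1 + (abs_L2 f1 - abs_L2 f2)" "abs_L2 f2 - abs_L2 p"]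
      norm_triangle_ineq[of "F - abs_L2 f1" "abs_L2 f1 - abs_L2 f2"] by simp
  ultimately show thesis using p(1) by (intro that) auto
qed

section \<open>The Volterra operator\<close>

definition volterra :: "L2 \<Rightarrow> L2" where
  "volterra F = abs_L2 (\<lambda>x. integral {0..x} (rep_L2 F))"

lemma sq_integrable_hk:
  assumes f: "sq_integrable f" and x: "x \<in> {0..1}"
  shows "f integrable_on {0..x}"
proof -
  have "f integrable_on {0..1}"
    by (rule integrable_on_lebesgue_on[OF sq_integrable_imp_integrable[OF f]]) simp
  then show ?thesis by (rule integrable_on_subinterval) (use x in auto)
qed

lemma lint_eq_integral:
  assumes f: "sq_integrable f"
  shows "(LINT x|I01. f x) = integral {0..1} f"
  by (rule lebesgue_integral_eq_integral[OF sq_integrable_imp_integrable[OF f]]) simp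

lemma abs_integral_le_norm:
  assumes f: "sq_integrable f" and x: "x \<in> {0..1}"
  shows "\<bar>integral {0..x} f\<bar> \<le> norm (abs_L2 f)"
proof -
  note a = sq_integrable_abs[OF f]
  have "\<bar>integral {0..x} f\<bar> \<le> integral {0..x} (\<lambda>x. \<bar>f x\<bar>)"
    using integral_norm_bound_integral[OF sq_integrable_hk[OF f x] sq_integrable_hk[OF a x]] by simp
  also have "\<dots> \<le> integral {0..1} (\<lambda>x. \<bar>f x\<bar>)"
    by (rule integral_subset_le) (use x sq_integrable_hk[OF a] in auto)
  also have "\<dots> = (LINT x|I01. \<bar>f x\<bar>)" by (rule lint_eq_integral[OF a, symmetric])
  also have "\<dots> \<le> norm (abs_L2 f)" by (rule integral_abs_le_norm[OF f])
  finally show ?thesis .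
qed

lemma continuous_primitive:
  assumes f: "sq_integrable f"
  shows "continuous_on {0..1} (\<lambda>x. integral {0..x} f)"
  by (rule indefinite_integral_continuous_1) (use sq_integrable_hk[OF f, of 1] in simp)

lemma sq_integrable_primitive: "sq_integrable f \<Longrightarrow> sq_integrable (\<lambda>x. integral {0..x} f)"
  by (rule continuous_sq_integrable[OF continuous_primitive])

lemma integral_diff_primitive:
  assumes "sq_integrable f" "sq_integrable g" "x \<in> {0..1}"
  shows "integral {0..x} (\<lambda>y. f y - g y) = integral {0..x} f - integral {0..x} g"
  using assms by (intro integral_diff sq_integrable_hk)

text \<open>The difference of two representatives is zero in \<open>L2\<close>, and
  \<open>abs_integral_le_norm\<close> bounds its integral by its norm; so \<open>volterra\<close>
  does not depend on the representative.\<close>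

lemma integral_rep_abs:
  assumes f: "sq_integrable f" and x: "x \<in> {0..1}"
  shows "integral {0..x} (rep_L2 (abs_L2 f)) = integral {0..x} f"
proof -
  let ?r = "rep_L2 (abs_L2 f)"
  have "\<bar>integral {0..x} (\<lambda>y. ?r y - f y)\<bar> \<le> norm (abs_L2 (\<lambda>y. ?r y - f y))"
    by (intro abs_integral_le_norm sq_integrable_diff sq_integrable_rep f x)
  also have "abs_L2 (\<lambda>y. ?r y - f y) = abs_L2 ?r - abs_L2 f"
    by (simp only: abs_L2_diff sq_integrable_rep f)
  finally show ?thesis
    by (simp add: integral_diff_primitive[OF sq_integrable_rep f x])
qed

lemma volterra_abs:
  assumes f: "sq_integrable f"
  shows "volterra (abs_L2 f) = abs_L2 (\<lambda>x. integral {0..x} f)"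
  unfolding volterra_def
  by (rule abs_L2_cong(2)[OF sq_integrable_primitive[OF sq_integrable_rep]]) (rule integral_rep_abs[OF f])

lemma inner_one_abs:
  assumes f: "sq_integrable f"
  shows "inner one_L2 (abs_L2 f) = integral {0..1} f"
  unfolding one_L2_def by (simp add: inner_abs_L2 sq_integrable_const f lint_eq_integral)

lemma volterra_add: "volterra (F + G) = volterra F + volterra G"
proof -
  obtain f g where f: "sq_integrable f" "F = abs_L2 f" and g: "sq_integrable g" "G = abs_L2 g"
    by (metis L2_cases)
  have "abs_L2 (\<lambda>x. integral {0..x} (\<lambda>x. f x + g x)) = abs_L2 (\<lambda>x. integral {0..x} f + integral {0..x} g)"
    by (rule abs_L2_cong(2))
       (auto intro!: sq_integrable_primitive sq_integrable_add f g integral_add sq_integrable_hk)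
  then show ?thesis
    by (simp add: f g abs_L2_add volterra_abs sq_integrable_add sq_integrable_primitive)
qed

lemma volterra_scaleR: "volterra (c *\<^sub>R F) = c *\<^sub>R volterra F"
proof -
  obtain f where f: "sq_integrable f" "F = abs_L2 f" by (rule L2_cases)
  show ?thesis
    by (simp add: f abs_L2_scaleR volterra_abs sq_integrable_scale sq_integrable_primitive)
qed

lemma norm_volterra: "norm (volterra F) \<le> norm F"
proof -
  obtain f where f: "sq_integrable f" "F = abs_L2 f" by (rule L2_cases)
  have "norm (abs_L2 (\<lambda>x. integral {0..x} f)) \<le> norm (abs_L2 f)"
    using sq_integrable_primitive[OF f(1)]
    by (intro bounded_sq_integrable(2) abs_integral_le_norm f) (auto simp: sq_integrable_def)
  then show ?thesis by (simp add: f volterra_abs)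
qed

lemma bounded_linear_volterra: "bounded_linear volterra"
  by (rule bounded_linear_intro[where K=1]) (simp_all add: volterra_add volterra_scaleR norm_volterra)

lemma polynomial_continuous_01: "real_polynomial_function p \<Longrightarrow> continuous_on {0..1::real} p"
  by (simp add: continuous_on_polymonial_function real_polynomial_function_eq)

text \<open>Integration by parts \<open>2 \<integral> u u' = u(1)\<^sup>2\<close> for \<open>u(0) = 0\<close>; it is classical for continuous \<open>u'\<close>
  and extends by density.\<close>

lemma inner_volterra: "2 * inner (volterra F) F = (inner one_L2 F)\<^sup>2"
proof -
  define q where "q G = 2 * inner (volterra G) G - (inner one_L2 G)\<^sup>2" for G
  have poly: "q (abs_L2 p) = 0" if "real_polynomial_function p" for p
  proof -
    have pc: "continuous_on {0..1} p" by (rule polynomial_continuous_01[OF that])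
    then have p: "sq_integrable p" by (rule continuous_sq_integrable)
    define P where "P x = integral {0..x} p" for x
    have P: "continuous_on {0..1} P" unfolding P_def by (rule continuous_primitive[OF p])
    have "((\<lambda>x. 2 * (P x * p x)) has_integral (P 1)\<^sup>2 - (P 0)\<^sup>2) {0..1}"
    proof (rule fundamental_theorem_of_calculus)
      fix x :: real assume "x \<in> {0..1}"
      then have "(P has_real_derivative p x) (at x within {0..1})"
        unfolding P_def[abs_def] has_real_derivative_iff_has_vector_derivative
        by (rule integral_has_vector_derivative[OF pc])
      then have "((\<lambda>x. (P x)\<^sup>2) has_real_derivative 2 * (P x * p x)) (at x within {0..1})"
        by (auto intro!: derivative_eq_intros)
      then show "((\<lambda>x. (P x)\<^sup>2) has_vector_derivative 2 * (P x * p x)) (at x within {0..1})"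
        by (simp only: has_real_derivative_iff_has_vector_derivative)
    qed simp
    then have I: "integral {0..1} (\<lambda>x. 2 * (P x * p x)) = (P 1)\<^sup>2"
      by (subst integral_unique) (simp_all add: P_def)
    have "continuous_on {0..1} (\<lambda>x. P x * p x)" by (intro continuous_intros P pc)
    then have Pp: "sq_integrable (\<lambda>x. P x * p x)" by (rule continuous_sq_integrable)
    have "2 * inner (volterra (abs_L2 p)) (abs_L2 p) = integral {0..1} (\<lambda>x. 2 * (P x * p x))"
      using sq_integrable_primitive[OF p] lint_eq_integral[OF Pp]
      by (simp add: volterra_abs p inner_abs_L2 P_def[abs_def])
    then show ?thesis
      unfolding q_def I by (simp add: inner_one_abs[OF p] P_def)
  qed
  have "continuous_on UNIV q"
    unfolding q_def
    by (intro continuous_intros bounded_linear.continuous_on[OF bounded_linear_volterra])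
  then have cont: "isCont q F" by (simp add: continuous_on_eq_continuous_at)
  have "\<exists>p. real_polynomial_function p \<and> norm (F - abs_L2 p) < 1 / real (Suc n)" for n
    using polynomials_dense_L2[of "1 / real (Suc n)" F] by auto
  then obtain p where p: "\<And>n. real_polynomial_function (p n)" "\<And>n. norm (F - abs_L2 (p n)) < 1 / real (Suc n)"
    by metis
  have "(\<lambda>n. abs_L2 (p n) - F) \<longlonglongrightarrow> 0"
    by (rule Lim_null_comparison[OF _ LIMSEQ_Suc[OF lim_1_over_n]])
       (use p(2) in \<open>auto simp: norm_minus_commute less_imp_le\<close>)
  then have "(\<lambda>n. abs_L2 (p n)) \<longlonglongrightarrow> F" by (rule LIM_zero_cancel)
  then have "(\<lambda>n. q (abs_L2 (p n))) \<longlonglongrightarrow> q F" by (rule isCont_tendsto_compose[OF cont])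
  then have "q F = 0" by (simp add: poly p(1) LIMSEQ_const_iff)
  then show ?thesis by (simp add: q_def)
qed

section \<open>Sobolev functions and their traces\<close>

lemma H1_continuous: "H1 u u' \<Longrightarrow> continuous_on {0..1} u"
proof -
  assume "H1 u u'"
  then have u': "sq_integrable u'" and u: "\<And>x. x \<in> {0..1} \<Longrightarrow> u x = u 0 + integral {0..x} u'"
    unfolding H1_def by blast+
  have "continuous_on {0..1} (\<lambda>x. u 0 + integral {0..x} u')"
    by (intro continuous_intros continuous_primitive u')
  then show ?thesis by (rule continuous_on_eq) (rule u[symmetric])
qed

lemma H1_sq_integrable: "H1 u u' \<Longrightarrow> sq_integrable u" "H1 u u' \<Longrightarrow> sq_integrable u'"
  by (simp_all add: continuous_sq_integrable H1_continuous) (simp add: H1_def)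

text \<open>The dictionary between functions and classes: from here on boundary values are the
  scalars a and b, and representatives disappear until the comparison with
  \<open>closed_loop_op\<close>.\<close>

lemma H1_iff_volterra:
  "(\<exists>u u'. H1 u u' \<and> U = abs_L2 u \<and> U' = abs_L2 u' \<and> u 0 = a \<and> u 1 = b) \<longleftrightarrow>
    U = a *\<^sub>R one_L2 + volterra U' \<and> b = a + inner one_L2 U'" (is "?L \<longleftrightarrow> ?R")
proof
  assume ?L
  then obtain u u' where u: "H1 u u'" "U = abs_L2 u" "U' = abs_L2 u'" "u 0 = a" "u 1 = b" by blast
  then have u': "sq_integrable u'" and ux: "\<And>x. x \<in> {0..1} \<Longrightarrow> u x = a + integral {0..x} u'"
    unfolding H1_def by blast+
  have "abs_L2 u = abs_L2 (\<lambda>x. a + integral {0..x} u')"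
    by (rule abs_L2_cong(2)[OF H1_sq_integrable(1)[OF u(1)] ux])
  also have "\<dots> = a *\<^sub>R one_L2 + volterra U'"
    unfolding u(3) one_L2_def
    by (simp add: volterra_abs u' abs_L2_scaleR abs_L2_add sq_integrable_const sq_integrable_primitive)
  finally show ?R using u ux[of 1] by (simp add: inner_one_abs u')
next
  assume ?R
  define u where "u x = a + integral {0..x} (rep_L2 U')" for x
  have r: "sq_integrable (rep_L2 U')" by (rule sq_integrable_rep)
  have "H1 u (rep_L2 U')" by (simp add: H1_def u_def r)
  moreover have "abs_L2 u = U"
    using \<open>?R\<close> unfolding u_def one_L2_def volterra_def
    by (simp add: r abs_L2_scaleR abs_L2_add sq_integrable_const sq_integrable_primitive)
  moreover have "u 0 = a" "u 1 = b"
    using \<open>?R\<close> inner_one_abs[OF r] by (simp_all add: u_def)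
  ultimately show ?L
    by (intro exI[of _ u] exI[of _ "rep_L2 U'"]) auto
qed

lemma polynomial_trace:
  assumes "real_polynomial_function p"
  obtains P' where "abs_L2 p = p 0 *\<^sub>R one_L2 + volterra P'" "p 1 = p 0 + inner one_L2 P'"
proof -
  obtain p' where p': "real_polynomial_function p'" "\<And>x. (p has_real_derivative p' x) (at x)"
    using has_real_derivative_polynomial_function[of p] assms by (auto simp: real_polynomial_function_eq)
  have "sq_integrable p'" by (rule continuous_sq_integrable[OF polynomial_continuous_01[OF p'(1)]])
  moreover have "p x = p 0 + integral {0..x} p'" if "x \<in> {0..1}" for x
  proof -
    have "(p' has_integral (p x - p 0)) {0..x}"
      using that p'(2) by (intro fundamental_theorem_of_calculus)
        (auto simp: has_real_derivative_iff_has_vector_derivative[symmetric] intro: has_field_derivative_at_within)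
    then show ?thesis by (simp add: integral_unique)
  qed
  ultimately have "H1 p p'" unfolding H1_def by blast
  then have "abs_L2 p = p 0 *\<^sub>R one_L2 + volterra (abs_L2 p') \<and> p 1 = p 0 + inner one_L2 (abs_L2 p')"
    by (subst H1_iff_volterra[symmetric]) blast
  then show thesis using that by blast
qed

text \<open>The trace conditions do not obstruct density: boundary values are corrected by \<open>x\<^sup>n\<close> and \<open>(1 - x)\<^sup>n\<close>,
  which tend to \<open>0\<close> in \<open>L\<^sup>2\<close>.\<close>

lemma H1_traces_dense:
  assumes e: "0 < e"
  obtains U' where "norm (F - (a *\<^sub>R one_L2 + volterra U')) < e" "b = a + inner one_L2 U'"
proof -
  obtain p where p: "real_polynomial_function p" "norm (F - abs_L2 p) < e/2"
    using polynomials_dense_L2[of "e/2" F] e by auto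
  \<comment> \<open>The exponent Suc n makes each correction vanish at the opposite endpoint even
    for n = 0, so every r n has the exact traces a and b.\<close>
  define r where "r n x = p x + ((b - p 1) * x ^ Suc n + (a - p 0) * (1 - x) ^ Suc n)" for n and x :: real
  have "real_polynomial_function (\<lambda>x::real. x)"
    by (rule real_polynomial_function.intros(1)[OF bounded_linear_ident])
  then have r: "real_polynomial_function (r n)" for n
    unfolding r_def
    by (intro real_polynomial_function.intros(2-4) real_polynomial_function_power
        real_polynomial_function_diff p(1))
  have sq: "sq_integrable (r n)" "sq_integrable p" for n
    using r p(1) by (auto intro!: continuous_sq_integrable polynomial_continuous_01)
  have "(\<lambda>n. norm (abs_L2 (\<lambda>x. p x - r n x))) \<longlonglongrightarrow> 0"
  proof (rule norm_abs_L2_tendsto_zero(1)[of r p "\<lambda>x. (\<bar>b - p 1\<bar> + \<bar>a - p 0\<bar>)\<^sup>2"])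
    show "integrable I01 (\<lambda>x. (\<bar>b - p 1\<bar> + \<bar>a - p 0\<bar>)\<^sup>2)"
      using sq_integrable_const[of "\<bar>b - p 1\<bar> + \<bar>a - p 0\<bar>"] by (simp add: sq_integrable_def)
    show "AE x in I01. (p x - r n x)\<^sup>2 \<le> (\<bar>b - p 1\<bar> + \<bar>a - p 0\<bar>)\<^sup>2" for n
    proof (rule AE_I2)
      fix x assume "x \<in> space I01"
      then have x: "0 \<le> x" "x \<le> 1" by auto
      have "\<bar>c * y ^ Suc n\<bar> \<le> \<bar>c\<bar>" if "0 \<le> y" "y \<le> 1" for c y :: real
      proof -
        have "\<bar>c\<bar> * y ^ Suc n \<le> \<bar>c\<bar> * 1"
          using that by (intro mult_left_mono power_le_one) auto
        moreover have "\<bar>y ^ Suc n\<bar> = y ^ Suc n" using that by (intro abs_of_nonneg zero_le_power)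
        ultimately show ?thesis by (simp only: abs_mult mult_1_right)
      qed
      from this[of x "b - p 1"] this[of "1 - x" "a - p 0"] x
      have "\<bar>(b - p 1) * x ^ Suc n\<bar> \<le> \<bar>b - p 1\<bar>" "\<bar>(a - p 0) * (1 - x) ^ Suc n\<bar> \<le> \<bar>a - p 0\<bar>"
        by simp_all
      then have "\<bar>p x - r n x\<bar> \<le> \<bar>b - p 1\<bar> + \<bar>a - p 0\<bar>" unfolding r_def by linarith
      then have "\<bar>p x - r n x\<bar>\<^sup>2 \<le> (\<bar>b - p 1\<bar> + \<bar>a - p 0\<bar>)\<^sup>2" by (rule power_mono) simp
      then show "(p x - r n x)\<^sup>2 \<le> (\<bar>b - p 1\<bar> + \<bar>a - p 0\<bar>)\<^sup>2" by simp
    qed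
    have "AE x in lebesgue. x \<notin> {0, 1::real}"
      by (intro AE_not_in) (simp add: negligible_iff_null_sets[symmetric] negligible_finite)
    then have "AE x in I01. x \<notin> {0, 1}" by (subst AE_restrict_space_iff) auto
    then show "AE x in I01. (\<lambda>n. r n x) \<longlonglongrightarrow> p x"
    proof (rule AE_mp, intro AE_I2 impI)
      fix x :: real assume "x \<in> space I01" "x \<notin> {0, 1}"
      then have x: "0 < x" "x < 1" by auto
      have "(\<lambda>n. r n x) \<longlonglongrightarrow> p x + ((b - p 1) * 0 + (a - p 0) * 0)"
        unfolding r_def using x
        by (intro tendsto_intros LIMSEQ_Suc[OF LIMSEQ_power_zero]) auto
      then show "(\<lambda>n. r n x) \<longlonglongrightarrow> p x" by simp
    qed
  qed (use sq in \<open>auto simp: sq_integrable_def\<close>)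
  then have "\<forall>\<^sub>F n in sequentially. norm (abs_L2 (\<lambda>x. p x - r n x)) < e/2"
    using e by (intro order_tendstoD(2)) auto
  then obtain n where n: "norm (abs_L2 p - abs_L2 (r n)) < e/2"
    by (auto simp: eventually_sequentially abs_L2_diff sq)
  obtain U' where U': "abs_L2 (r n) = r n 0 *\<^sub>R one_L2 + volterra U'" "r n 1 = r n 0 + inner one_L2 U'"
    by (rule polynomial_trace[OF r])
  have ab: "r n 0 = a" "r n 1 = b" by (simp_all add: r_def)
  have "norm (F - abs_L2 (r n)) < e"
    using p(2) n norm_triangle_ineq[of "F - abs_L2 p" "abs_L2 p - abs_L2 (r n)"] by simp
  then show thesis using that[of U'] U' unfolding ab by simp
qed

subsection \<open>The operators of the modes\<close>

text \<open>Lax-Milgram: x -> x - e (B x - g) is a contraction for e = c / K^2, the minimiser of 1 -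
  2 e c + (e K)^2.\<close>

lemma coercive_surj:
  fixes B :: "'a::{real_inner,banach} \<Rightarrow> 'a"
  assumes B: "bounded_linear B" and c: "0 < c" and coercive: "\<And>x. c * (norm x)\<^sup>2 \<le> inner (B x) x"
  obtains x where "B x = g"
proof -
  interpret B: bounded_linear B by fact
  obtain K0 where K0: "\<And>x. norm (B x) \<le> norm x * K0" using B.bounded by blast
  \<comment> \<open>Raising the bound to at least c keeps 1 - (c / K)^2 nonnegative, so that the
    contraction constant q is a genuine square root.\<close>
  define K where "K = max K0 c"
  have K: "norm (B x) \<le> K * norm x" for x
  proof -
    have "norm x * K0 \<le> norm x * K" by (intro mult_left_mono) (auto simp: K_def)
    then show ?thesis using K0[of x] by (simp add: mult.commute)
  qed
  have cK: "c \<le> K" "0 < K" using c by (auto simp: K_def)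
  define e where "e = c / K\<^sup>2"
  define q where "q = sqrt (1 - (c / K)\<^sup>2)"
  have cK1: "(c / K)\<^sup>2 \<le> 1" "0 < (c / K)\<^sup>2"
    using cK c by (auto intro!: power_le_one)
  have q: "0 \<le> q" "q < 1" "q\<^sup>2 = 1 - (c / K)\<^sup>2"
    using cK1 by (auto simp: q_def)
  define f where "f x = x - e *\<^sub>R (B x - g)" for x
  have contr: "dist (f x) (f y) \<le> q * dist x y" for x y
  proof -
    define d where "d = x - y"
    have eq: "f x - f y = d - e *\<^sub>R B d" by (simp add: f_def d_def B.diff algebra_simps)
    have "(norm (f x - f y))\<^sup>2 = (norm d)\<^sup>2 - 2 * e * inner (B d) d + e\<^sup>2 * (norm (B d))\<^sup>2"
      unfolding power2_norm_eq_inner eq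
      by (simp add: inner_diff_left inner_diff_right inner_commute power2_eq_square algebra_simps)
    also have "\<dots> \<le> (norm d)\<^sup>2 - 2 * e * (c * (norm d)\<^sup>2) + e\<^sup>2 * (K * norm d)\<^sup>2"
      using coercive[of d] K[of d] c cK
      by (intro add_mono diff_left_mono mult_left_mono power_mono) (auto simp: e_def)
    also have "\<dots> = (1 - 2 * e * c + (e * K)\<^sup>2) * (norm d)\<^sup>2"
      by (simp add: power_mult_distrib algebra_simps)
    also have "1 - 2 * e * c + (e * K)\<^sup>2 = q\<^sup>2"
      unfolding q(3) e_def using cK by (simp add: power2_eq_square field_simps)
    finally have "(norm (f x - f y))\<^sup>2 \<le> (q * norm d)\<^sup>2" by (simp add: power_mult_distrib)
    then have "norm (f x - f y) \<le> q * norm d" by (rule power2_le_imp_le) (use q in simp)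
    then show ?thesis by (simp add: dist_norm d_def)
  qed
  obtain x where "f x = x"
    using banach_fix_type[of q f] contr q by auto
  then have "e *\<^sub>R (B x - g) = 0" by (simp add: f_def)
  then have "B x = g" using c cK by (simp add: e_def)
  then show thesis by (rule that)
qed

text \<open>The right side is U(1)^2 - U(0)^2, so this is the fundamental theorem for the square of
  an \<open>H1\<close> function.\<close>

lemma trace_energy:
  assumes "U = a *\<^sub>R one_L2 + volterra U'"
  shows "2 * inner U' U = (a + inner one_L2 U')\<^sup>2 - a\<^sup>2"
  using inner_volterra[of U'] unfolding assms
  by (simp add: inner_add_right inner_commute power2_eq_square algebra_simps)

lemma volterra_accretive: "0 \<le> inner (volterra F) F"
  using inner_volterra[of F] zero_le_power2[of "inner one_L2 F"] by linarith

text \<open>With the derivative as unknown, u + \<alpha> u' = G and u(0) = a read (\<alpha> I + V)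
  U' = G - a 1, which is coercive because V is accretive.\<close>

lemma solve_from_left:
  assumes "0 < \<alpha>"
  obtains U' where "(a *\<^sub>R one_L2 + volterra U') + \<alpha> *\<^sub>R U' = G"
proof -
  obtain U' where "\<alpha> *\<^sub>R U' + volterra U' = G - a *\<^sub>R one_L2"
  proof (rule coercive_surj[of "\<lambda>F. \<alpha> *\<^sub>R F + volterra F" \<alpha>])
    show "bounded_linear (\<lambda>F. \<alpha> *\<^sub>R F + volterra F)"
      by (intro bounded_linear_add bounded_linear_scaleR_right bounded_linear_volterra)
    show "\<alpha> * (norm F)\<^sup>2 \<le> inner (\<alpha> *\<^sub>R F + volterra F) F" for F
      using volterra_accretive[of F] by (simp add: inner_add_left power2_norm_eq_inner)
  qed (use assms in auto)
  then show thesis by (intro that[of U']) (simp add: algebra_simps)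
qed

text \<open>If u(1) = b is prescribed, the operator to add to \<alpha> I is F -> integral of F from
  x to 1, that is <1,F> 1 - V F. It is accretive, since <1,F>^2 - <V F,F> = <1,F>^2 / 2.\<close>

lemma solve_from_right:
  assumes "0 < \<alpha>"
  obtains a U' where "(a *\<^sub>R one_L2 + volterra U') - \<alpha> *\<^sub>R U' = G" "a + inner one_L2 U' = b"
proof -
  obtain U' where U': "\<alpha> *\<^sub>R U' + (inner one_L2 U' *\<^sub>R one_L2 - volterra U') = b *\<^sub>R one_L2 - G"
  proof (rule coercive_surj[of "\<lambda>F. \<alpha> *\<^sub>R F + (inner one_L2 F *\<^sub>R one_L2 - volterra F)" \<alpha>])
    show "bounded_linear (\<lambda>F. \<alpha> *\<^sub>R F + (inner one_L2 F *\<^sub>R one_L2 - volterra F))"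
      by (intro bounded_linear_add bounded_linear_sub bounded_linear_scaleR_right bounded_linear_volterra
          bounded_linear_scaleR_const bounded_linear_inner_right)
    show "\<alpha> * (norm F)\<^sup>2 \<le> inner (\<alpha> *\<^sub>R F + (inner one_L2 F *\<^sub>R one_L2 - volterra F)) F" for F
    proof -
      have "inner (\<alpha> *\<^sub>R F + (inner one_L2 F *\<^sub>R one_L2 - volterra F)) F =
          \<alpha> * (norm F)\<^sup>2 + ((inner one_L2 F)\<^sup>2 - inner (volterra F) F)"
        by (simp add: inner_add_left inner_diff_left power2_norm_eq_inner power2_eq_square[of "inner one_L2 F"])
      then show ?thesis using inner_volterra[of F] volterra_accretive[of F] by linarith
    qed
  qed (use assms in auto)
  show thesis
  proof (rule that[of "b - inner one_L2 U'" U'])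
    show "((b - inner one_L2 U') *\<^sub>R one_L2 + volterra U') - \<alpha> *\<^sub>R U' = G"
      using U' by (simp add: algebra_simps)
  qed simp
qed

text \<open>\<open>transport c D X Y k\<close>: \<open>X\<close> satisfies the boundary conditions with the prescribed input \<open>\<eta>(1) = k\<close>,
  and \<open>Y\<close> is the image of \<open>X\<close> under the transport part of the operator.\<close>

definition transport :: "coeffs \<Rightarrow> real \<Rightarrow> state \<Rightarrow> state \<Rightarrow> real \<Rightarrow> bool" where
  "transport c D X Y k \<longleftrightarrow> (\<exists>U' V' E' a.
     X = ((phi c * a) *\<^sub>R one_L2 + volterra U', a *\<^sub>R one_L2 + volterra V',
          (a + inner one_L2 V') *\<^sub>R one_L2 + volterra E') \<and>
     Y = (- lam c *\<^sub>R U', mu c *\<^sub>R V', (1 / D) *\<^sub>R E') \<and>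
     k = a + inner one_L2 V' + inner one_L2 E')"

definition reaction :: "coeffs \<Rightarrow> state \<Rightarrow> state" where
  "reaction c X = (sigp c *\<^sub>R fst (snd X), sigm c *\<^sub>R fst X, 0)"

text \<open>The feedback appears as a bounded functional with Riesz vector \<kappa>; it enters
  through the boundary value \<eta>(1) only and therefore shapes the domain, not the action.\<close>

definition loop_op :: "state \<Rightarrow> real \<Rightarrow> coeffs \<Rightarrow> (state \<times> state) set" where
  "loop_op \<kappa> D c = {(X, Y + reaction c X) | X Y. transport c D X Y (inner \<kappa> X)}"

lemma loop_opI: "transport c D X Y (inner \<kappa> X) \<Longrightarrow> (X, Y + reaction c X) \<in> loop_op \<kappa> D c"
  unfolding loop_op_def by blast

lemma transport_add:
  assumes "transport c D X Y k" "transport c D X' Y' k'"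
  shows "transport c D (X + X') (Y + Y') (k + k')"
proof -
  obtain U1 V1 E1 a1 where 1: "X = ((phi c * a1) *\<^sub>R one_L2 + volterra U1, a1 *\<^sub>R one_L2 + volterra V1,
          (a1 + inner one_L2 V1) *\<^sub>R one_L2 + volterra E1)"
     "Y = (- lam c *\<^sub>R U1, mu c *\<^sub>R V1, (1 / D) *\<^sub>R E1)" "k = a1 + inner one_L2 V1 + inner one_L2 E1"
    using assms(1) unfolding transport_def by blast
  obtain U2 V2 E2 a2 where 2: "X' = ((phi c * a2) *\<^sub>R one_L2 + volterra U2, a2 *\<^sub>R one_L2 + volterra V2,
          (a2 + inner one_L2 V2) *\<^sub>R one_L2 + volterra E2)"
     "Y' = (- lam c *\<^sub>R U2, mu c *\<^sub>R V2, (1 / D) *\<^sub>R E2)" "k' = a2 + inner one_L2 V2 + inner one_L2 E2"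
    using assms(2) unfolding transport_def by blast
  show ?thesis
    unfolding transport_def
    by (intro exI[of _ "U1 + U2"] exI[of _ "V1 + V2"] exI[of _ "E1 + E2"] exI[of _ "a1 + a2"])
       (simp add: 1 2 volterra_add inner_add_right scaleR_add_left scaleR_add_right distrib_left)
qed

lemma transport_scaleR:
  assumes "transport c D X Y k"
  shows "transport c D (s *\<^sub>R X) (s *\<^sub>R Y) (s * k)"
proof -
  obtain U1 V1 E1 a1 where 1: "X = ((phi c * a1) *\<^sub>R one_L2 + volterra U1, a1 *\<^sub>R one_L2 + volterra V1,
          (a1 + inner one_L2 V1) *\<^sub>R one_L2 + volterra E1)"
     "Y = (- lam c *\<^sub>R U1, mu c *\<^sub>R V1, (1 / D) *\<^sub>R E1)" "k = a1 + inner one_L2 V1 + inner one_L2 E1"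
    using assms(1) unfolding transport_def by blast
  show ?thesis
    unfolding transport_def
    by (intro exI[of _ "s *\<^sub>R U1"] exI[of _ "s *\<^sub>R V1"] exI[of _ "s *\<^sub>R E1"] exI[of _ "s * a1"])
       (simp add: 1 volterra_scaleR scaleR_add_right distrib_left mult_ac)
qed

lemma transport_diff:
  assumes "transport c D X Y k" "transport c D X' Y' k'"
  shows "transport c D (X - X') (Y - Y') (k - k')"
  using transport_add[OF assms(1) transport_scaleR[OF assms(2), of "-1"]] by simp

text \<open>The equations form a cascade driven by the input: \<eta> is solved from \<eta>(1) = k,
  its value at 0 is the datum v(1), and phi v(0) is the inflow of u. Each is solved from the end
  where its datum sits.\<close>

lemma transport_solve:
  assumes "0 < h" "0 < lam c" "0 < mu c" "0 < D"
  obtains X Y where "transport c D X Y k" "X - h *\<^sub>R Y = G"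
proof -
  obtain F1 F2 F3 where G: "G = (F1, F2, F3)" by (cases G) auto
  obtain d E' where E: "(d *\<^sub>R one_L2 + volterra E') - (h / D) *\<^sub>R E' = F3" "d + inner one_L2 E' = k"
    by (rule solve_from_right[OF divide_pos_pos[OF assms(1,4)]])
  obtain a V' where V: "(a *\<^sub>R one_L2 + volterra V') - (h * mu c) *\<^sub>R V' = F2" "a + inner one_L2 V' = d"
    by (rule solve_from_right[OF mult_pos_pos[OF assms(1,3)]])
  obtain U' where U: "((phi c * a) *\<^sub>R one_L2 + volterra U') + (h * lam c) *\<^sub>R U' = F1"
    by (rule solve_from_left[OF mult_pos_pos[OF assms(1,2)]])
  show thesis
  proof (rule that)
    show "transport c D ((phi c * a) *\<^sub>R one_L2 + volterra U', a *\<^sub>R one_L2 + volterra V', d *\<^sub>R one_L2 + volterra E')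
      (- lam c *\<^sub>R U', mu c *\<^sub>R V', (1 / D) *\<^sub>R E') k"
      unfolding transport_def
      by (intro exI[of _ U'] exI[of _ V'] exI[of _ E'] exI[of _ a]) (simp add: V(2) E(2))
    show "((phi c * a) *\<^sub>R one_L2 + volterra U', a *\<^sub>R one_L2 + volterra V', d *\<^sub>R one_L2 + volterra E')
      - h *\<^sub>R (- lam c *\<^sub>R U', mu c *\<^sub>R V', (1 / D) *\<^sub>R E') = G"
      using E V U by (simp add: G)
  qed
qed

lemma reaction_linear: "reaction c (X + X') = reaction c X + reaction c X'" "reaction c (s *\<^sub>R X) = s *\<^sub>R reaction c X"
  by (simp_all add: reaction_def scaleR_add_right)

lemma norm_state: "(norm X)\<^sup>2 = (norm (fst X))\<^sup>2 + (norm (fst (snd X)))\<^sup>2 + (norm (snd (snd X)))\<^sup>2" for X :: state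
  by (simp add: norm_prod_def add.assoc)

text \<open>The weights make the boundary terms of the energy identity nonpositive for all modes at once, so
  that all mode semigroups are quasi-contractive in one common norm.\<close>

locale coupled_bounds =
  fixes \<kappa> :: state and D lamh mul muh phih s :: real
  assumes D_pos: "0 < D" and mul_pos: "0 < mul" and lamh_nonneg: "0 \<le> lamh" and muh_nonneg: "0 \<le> muh"
    and s_nonneg: "0 \<le> s"
begin

section \<open>Energy estimates in the weighted norm\<close>

text \<open>In \<open>transport_energy\<close> b mu has to absorb lam phi^2 at v(0), and g / D has
  to absorb b mu at v(1) = \<eta>(0), for the extreme coefficients. The summand 1 keeps
  \<open>N\<close> above the plain norm.\<close>

definition b :: real where "b = 1 + lamh * phih\<^sup>2 / mul"
definition g :: real where "g = 1 + D * muh * b"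
definition weighted :: "state \<Rightarrow> state" where
  "weighted X = (fst X, sqrt b *\<^sub>R fst (snd X), sqrt g *\<^sub>R snd (snd X))"
definition N :: "state \<Rightarrow> real" where "N X = norm (weighted X)"
text \<open>The first term bounds the energy injected through \<eta>(1), the second that of the
  reaction. As a rate for N^2 this would give w/2 for N; the spare factor 2 is spent on turning 1 /
  (1 - w h) into an exponential.\<close>

definition w :: real where "w = (g / D) * (norm \<kappa>)\<^sup>2 + s * (1 + b)"
definition L :: real where "L = (g / D) * (norm \<kappa>)\<^sup>2 + (b * g * s)\<^sup>2"
text \<open>L times h bounds the squared Lipschitz constant of the map in
  \<open>loop_op_range\<close>, which h L \<le> 1/4 makes a 1/2-contraction. The other bound gives w
  h \<le> 1/2 for \<open>loop_op_dissipative\<close>.\<close>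

definition h0 :: real where "h0 = min (1 / (4 * (L + 1))) (1 / (2 * (w + 1)))"

definition admissible :: "coeffs \<Rightarrow> bool" where
  "admissible c \<longleftrightarrow> 0 < lam c \<and> lam c \<le> lamh \<and> mul \<le> mu c \<and> mu c \<le> muh \<and> \<bar>phi c\<bar> \<le> phih \<and>
     \<bar>sigp c\<bar> \<le> s \<and> \<bar>sigm c\<bar> \<le> s"

lemma b_ge: "1 \<le> b" using lamh_nonneg mul_pos by (simp add: b_def)
lemma g_ge: "1 \<le> g" using b_ge D_pos muh_nonneg by (simp add: g_def)
lemma w_nonneg: "0 \<le> w" using b_ge g_ge D_pos s_nonneg by (simp add: w_def)
lemma L_nonneg: "0 \<le> L" using g_ge D_pos by (simp add: L_def)
lemma h0_pos: "0 < h0" using L_nonneg w_nonneg by (simp add: h0_def)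
lemma h0_le: "h0 \<le> 1" "h0 * L \<le> 1/4" "h0 * w \<le> 1/2"
proof -
  have pos: "0 < 4 * (L + 1)" "0 < 2 * (w + 1)" using L_nonneg w_nonneg by auto
  have "h0 \<le> 1 / (4 * (L + 1))" "h0 \<le> 1 / (2 * (w + 1))" by (simp_all add: h0_def)
  then have "h0 * (4 * (L + 1)) \<le> 1" "h0 * (2 * (w + 1)) \<le> 1"
    using pos_le_divide_eq[OF pos(1)] pos_le_divide_eq[OF pos(2)] by blast+
  then show "h0 \<le> 1" "h0 * L \<le> 1/4" "h0 * w \<le> 1/2"
    using h0_pos mult_nonneg_nonneg[OF less_imp_le[OF h0_pos] L_nonneg] by (auto simp: algebra_simps)
qed

lemma weighted_add: "weighted (X + Y) = weighted X + weighted Y"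
  by (simp add: weighted_def scaleR_add_right)

lemma weighted_scaleR: "weighted (c *\<^sub>R X) = c *\<^sub>R weighted X"
  by (simp add: weighted_def)

lemma N_square: "(N X)\<^sup>2 = (norm (fst X))\<^sup>2 + b * (norm (fst (snd X)))\<^sup>2 + g * (norm (snd (snd X)))\<^sup>2"
  using b_ge g_ge by (simp add: N_def norm_state weighted_def power_mult_distrib)

lemma N_nonneg: "0 \<le> N X" by (simp add: N_def)

lemma norm_le_N: "norm X \<le> N X"
proof (rule power2_le_imp_le[OF _ N_nonneg])
  have "1 * (norm (fst (snd X)))\<^sup>2 \<le> b * (norm (fst (snd X)))\<^sup>2" "1 * (norm (snd (snd X)))\<^sup>2 \<le> g * (norm (snd (snd X)))\<^sup>2"
    using b_ge g_ge by (intro mult_right_mono; simp)+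
  then show "(norm X)\<^sup>2 \<le> (N X)\<^sup>2" unfolding N_square norm_state[of X] by simp
qed

lemma N_le_norm: "N X \<le> b * g * norm X"
proof (rule power2_le_imp_le)
  have bg: "1 \<le> b * g" "b \<le> b * g" "g \<le> b * g" "0 \<le> b * g"
    using b_ge g_ge mult_mono[of 1 b 1 g] by (auto intro: mult_le_cancel_left1[THEN iffD2] mult_le_cancel_right1[THEN iffD2])
  have "(N X)\<^sup>2 \<le> (b * g) * (norm X)\<^sup>2"
  proof -
    have "1 * (norm (fst X))\<^sup>2 \<le> (b * g) * (norm (fst X))\<^sup>2"
      "b * (norm (fst (snd X)))\<^sup>2 \<le> (b * g) * (norm (fst (snd X)))\<^sup>2"
      "g * (norm (snd (snd X)))\<^sup>2 \<le> (b * g) * (norm (snd (snd X)))\<^sup>2"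
      using bg by (intro mult_right_mono; simp)+
    then show ?thesis unfolding N_square norm_state[of X] by (simp add: distrib_left)
  qed
  also have "\<dots> \<le> (b * g)\<^sup>2 * (norm X)\<^sup>2"
    using bg(1) by (intro mult_right_mono) (auto simp: power2_eq_square mult_le_cancel_left1)
  finally show "(N X)\<^sup>2 \<le> (b * g * norm X)\<^sup>2" by (simp add: power_mult_distrib)
  show "0 \<le> b * g * norm X" using bg by simp
qed

lemma transport_energy:
  assumes c: "admissible c" and tr: "transport c D X Y k"
  shows "2 * inner (weighted Y) (weighted X) \<le> (g / D) * k\<^sup>2"
proof -
  obtain U' V' E' a where X: "X = ((phi c * a) *\<^sub>R one_L2 + volterra U', a *\<^sub>R one_L2 + volterra V',
          (a + inner one_L2 V') *\<^sub>R one_L2 + volterra E')"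
     and Y: "Y = (- lam c *\<^sub>R U', mu c *\<^sub>R V', (1 / D) *\<^sub>R E')" and k: "k = a + inner one_L2 V' + inner one_L2 E'"
    using tr unfolding transport_def by blast
  obtain U V E where X': "X = (U, V, E)" by (cases X) auto
  define d where "d = a + inner one_L2 V'"
  define u1 where "u1 = phi c * a + inner one_L2 U'"
  have e: "2 * inner U' U = u1\<^sup>2 - (phi c * a)\<^sup>2" "2 * inner V' V = d\<^sup>2 - a\<^sup>2" "2 * inner E' E = k\<^sup>2 - d\<^sup>2"
    using X X' trace_energy[of U "phi c * a" U'] trace_energy[of V a V'] trace_energy[of E d E']
    by (simp_all add: u1_def d_def k)
  have "inner (weighted Y) (weighted X) = - lam c * inner U' U + b * mu c * inner V' V + (g / D) * inner E' E"
    using b_ge g_ge unfolding X' Y by (simp add: weighted_def inner_prod_def mult.assoc[symmetric])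
  then have "2 * inner (weighted Y) (weighted X) =
      - lam c * (2 * inner U' U) + b * mu c * (2 * inner V' V) + (g / D) * (2 * inner E' E)"
    by simp
  \<comment> \<open>Outflow at u(1) dissipates, the weights settle the signs at v(0) and at v(1) =
    \<eta>(0), and only k = \<eta>(1) injects energy.\<close>
  also have "\<dots> = - (lam c * u1\<^sup>2) + (lam c * (phi c)\<^sup>2 - b * mu c) * a\<^sup>2 + (b * mu c - g / D) * d\<^sup>2 + (g / D) * k\<^sup>2"
  proof -
    have "- l * (x\<^sup>2 - (p * y)\<^sup>2) + m * (z\<^sup>2 - y\<^sup>2) + r * (k\<^sup>2 - z\<^sup>2) =
        - (l * x\<^sup>2) + (l * p\<^sup>2 - m) * y\<^sup>2 + (m - r) * z\<^sup>2 + r * k\<^sup>2" for l m p r x y z k :: real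
      by (simp add: power2_eq_square algebra_simps)
    then show ?thesis unfolding e .
  qed
  also have "\<dots> \<le> (g / D) * k\<^sup>2"
  proof -
    have "lam c * (phi c)\<^sup>2 \<le> b * mu c"
    proof -
      have "lam c * (phi c)\<^sup>2 \<le> lamh * phih\<^sup>2"
        using c power_mono[of "\<bar>phi c\<bar>" phih 2] by (intro mult_mono) (auto simp: admissible_def)
      also have "\<dots> \<le> b * mul" using mul_pos by (simp add: b_def field_simps)
      also have "\<dots> \<le> b * mu c" using b_ge c by (intro mult_left_mono) (auto simp: admissible_def)
      finally show ?thesis .
    qed
    moreover have "b * mu c \<le> g / D"
    proof -
      have "b * mu c \<le> b * muh" using b_ge c by (intro mult_left_mono) (auto simp: admissible_def)
      also have "\<dots> \<le> g / D" using D_pos by (simp add: g_def field_simps)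
      finally show ?thesis .
    qed
    moreover have "0 \<le> lam c * u1\<^sup>2" using c by (simp add: admissible_def)
    ultimately show ?thesis
      using mult_nonpos_nonneg[of "lam c * (phi c)\<^sup>2 - b * mu c" "a\<^sup>2"]
        mult_nonpos_nonneg[of "b * mu c - g / D" "d\<^sup>2"] by simp
  qed
  finally show ?thesis .
qed

text \<open>Pair X = h Y + G with X. In 2 <G,X> \<le> N(G)^2 + N(X)^2 one N(X)^2 is absorbed, and
  the energy estimate controls h <Y,X>.\<close>

lemma transport_bound:
  assumes c: "admissible c" and tr: "transport c D X Y k" and h: "0 < h"
  shows "(N X)\<^sup>2 \<le> h * ((g / D) * k\<^sup>2) + (N (X - h *\<^sub>R Y))\<^sup>2"
proof -
  let ?G = "X - h *\<^sub>R Y"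
  have "X = h *\<^sub>R Y + ?G" by simp
  then have "weighted X = h *\<^sub>R weighted Y + weighted ?G"
    using weighted_add[of "h *\<^sub>R Y" ?G] by (simp add: weighted_scaleR)
  then have "(N X)\<^sup>2 = h * inner (weighted Y) (weighted X) + inner (weighted ?G) (weighted X)"
    unfolding N_def power2_norm_eq_inner by (metis inner_add_left inner_scaleR_left)
  moreover have "2 * inner (weighted ?G) (weighted X) \<le> (N ?G)\<^sup>2 + (N X)\<^sup>2"
  proof -
    have "0 \<le> (norm (weighted ?G - weighted X))\<^sup>2" by simp
    then show ?thesis
      unfolding N_def power2_norm_eq_inner
      by (simp add: inner_diff_left inner_diff_right inner_commute)
  qed
  moreover have "h * (2 * inner (weighted Y) (weighted X)) \<le> h * ((g / D) * k\<^sup>2)"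
    using transport_energy[OF c tr] h by (intro mult_left_mono) auto
  ultimately show ?thesis by (simp add: algebra_simps)
qed

lemma norm_reaction:
  assumes c: "admissible c"
  shows "norm (reaction c X) \<le> s * norm X"
proof (rule power2_le_imp_le)
  have sq: "(sigp c)\<^sup>2 \<le> s\<^sup>2" "(sigm c)\<^sup>2 \<le> s\<^sup>2"
    using c power_mono[of "\<bar>sigp c\<bar>" s 2] power_mono[of "\<bar>sigm c\<bar>" s 2] by (auto simp: admissible_def)
  have "(norm (reaction c X))\<^sup>2 = (sigp c)\<^sup>2 * (norm (fst (snd X)))\<^sup>2 + (sigm c)\<^sup>2 * (norm (fst X))\<^sup>2"
    by (simp add: norm_state reaction_def power_mult_distrib)
  also have "\<dots> \<le> s\<^sup>2 * (norm (fst (snd X)))\<^sup>2 + s\<^sup>2 * (norm (fst X))\<^sup>2"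
    using sq by (intro add_mono mult_right_mono) auto
  also have "\<dots> \<le> s\<^sup>2 * (norm X)\<^sup>2" by (simp add: norm_state[of X] distrib_left)
  finally show "(norm (reaction c X))\<^sup>2 \<le> (s * norm X)\<^sup>2" by (simp add: power_mult_distrib)
  show "0 \<le> s * norm X" using s_nonneg by simp
qed

lemma reaction_energy:
  assumes c: "admissible c"
  shows "2 * inner (weighted (reaction c X)) (weighted X) \<le> s * (1 + b) * (norm X)\<^sup>2"
proof -
  obtain U V E where X: "X = (U, V, E)" by (cases X) auto
  have "2 * inner (weighted (reaction c X)) (weighted X) = (sigp c + b * sigm c) * (2 * inner U V)"
    using b_ge unfolding X
    by (simp add: weighted_def reaction_def inner_prod_def inner_commute mult.assoc[symmetric] distrib_right)
  also have "\<dots> \<le> \<bar>sigp c + b * sigm c\<bar> * \<bar>2 * inner U V\<bar>"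
    by (metis abs_ge_self abs_mult)
  also have "\<dots> \<le> (s * (1 + b)) * (norm X)\<^sup>2"
  proof (rule mult_mono)
    have "\<bar>b * sigm c\<bar> \<le> b * s"
      unfolding abs_mult using c b_ge by (intro mult_mono) (auto simp: admissible_def)
    then show "\<bar>sigp c + b * sigm c\<bar> \<le> s * (1 + b)"
      using c by (auto simp: admissible_def algebra_simps)
    have "2 * \<bar>inner U V\<bar> \<le> 2 * (norm U * norm V)" using Cauchy_Schwarz_ineq2[of U V] by simp
    also have "\<dots> \<le> (norm U)\<^sup>2 + (norm V)\<^sup>2" using sum_squares_bound[of "norm U" "norm V"] by simp
    also have "\<dots> \<le> (norm X)\<^sup>2" unfolding X norm_state by simp
    finally show "\<bar>2 * inner U V\<bar> \<le> (norm X)\<^sup>2" by (simp add: abs_mult)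
  qed (use s_nonneg b_ge in auto)
  finally show ?thesis .
qed

lemma inner_kappa_square: "(inner \<kappa> X)\<^sup>2 \<le> (norm \<kappa>)\<^sup>2 * (norm X)\<^sup>2"
  using Cauchy_Schwarz_ineq[of \<kappa> X] by (simp add: power2_norm_eq_inner)

lemma loop_op_dissipative:
  assumes c: "admissible c" and XY: "(X, Y) \<in> loop_op \<kappa> D c" and h: "0 < h" "h \<le> h0"
  shows "N X \<le> exp (w * h) * N (X - h *\<^sub>R Y)"
proof -
  obtain Y0 where Y: "Y = Y0 + reaction c X" and tr: "transport c D X Y0 (inner \<kappa> X)"
    using XY by (auto simp: loop_op_def)
  have "2 * inner (weighted Y) (weighted X) \<le> (g / D) * (inner \<kappa> X)\<^sup>2 + s * (1 + b) * (norm X)\<^sup>2"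
    using transport_energy[OF c tr] reaction_energy[OF c, of X]
    by (simp add: Y weighted_add inner_add_left)
  also have "\<dots> \<le> (g / D) * ((norm \<kappa>)\<^sup>2 * (norm X)\<^sup>2) + s * (1 + b) * (norm X)\<^sup>2"
    using g_ge D_pos by (intro add_right_mono mult_left_mono inner_kappa_square) auto
  also have "\<dots> = w * (norm X)\<^sup>2" by (simp add: w_def algebra_simps)
  also have "\<dots> \<le> w * (N X)\<^sup>2"
    using norm_le_N[of X] w_nonneg by (intro mult_left_mono power_mono) auto
  finally have e: "h * (2 * inner (weighted Y) (weighted X)) \<le> h * (w * (N X)\<^sup>2)"
    using h by (intro mult_left_mono) auto
  have eq: "weighted (X - h *\<^sub>R Y) = weighted X - h *\<^sub>R weighted Y"
    using weighted_add[of X "(- h) *\<^sub>R Y"] weighted_scaleR[of "- h" Y] by simp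
  have sq: "(N (X - h *\<^sub>R Y))\<^sup>2 = (N X)\<^sup>2 - h * (2 * inner (weighted Y) (weighted X)) + h\<^sup>2 * (N Y)\<^sup>2"
    unfolding N_def power2_norm_eq_inner eq
    by (simp add: inner_diff_left inner_diff_right inner_commute power2_eq_square algebra_simps)
  have 1: "(1 - w * h) * (N X)\<^sup>2 \<le> (N (X - h *\<^sub>R Y))\<^sup>2"
  proof -
    have "(1 - w * h) * (N X)\<^sup>2 = (N X)\<^sup>2 - h * (w * (N X)\<^sup>2)" by (simp add: algebra_simps)
    moreover have "0 \<le> h\<^sup>2 * (N Y)\<^sup>2" by simp
    ultimately show ?thesis using e sq by linarith
  qed
  have y: "0 \<le> w * h" "w * h \<le> 1/2"
    using h w_nonneg mult_left_mono[OF h(2) w_nonneg] h0_le(3) by (auto simp: mult.commute)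
  \<comment> \<open>For y = w h in [0, 1/2], (1 - y) (1 + 2 y) = 1 + y (1 - 2 y) \<ge> 1; hence 1 /
    (1 - y) \<le> exp (2 y), and taking roots leaves exp (w h).\<close>
  have "1 \<le> (1 - w * h) * (1 + 2 * (w * h))"
    using mult_nonneg_nonneg[of "w * h" "1 - 2 * (w * h)"] y by (simp add: algebra_simps)
  also have "\<dots> \<le> (1 - w * h) * exp (2 * (w * h))"
    using y exp_ge_add_one_self[of "2 * (w * h)"] by (intro mult_left_mono) auto
  finally have "1 * (N X)\<^sup>2 \<le> ((1 - w * h) * exp (2 * (w * h))) * (N X)\<^sup>2"
    by (intro mult_right_mono) auto
  also have "\<dots> = exp (2 * (w * h)) * ((1 - w * h) * (N X)\<^sup>2)" by simp
  also have "\<dots> \<le> exp (2 * (w * h)) * (N (X - h *\<^sub>R Y))\<^sup>2"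
    using 1 by (intro mult_left_mono) auto
  also have "\<dots> = (exp (w * h) * N (X - h *\<^sub>R Y))\<^sup>2"
    by (simp add: power_mult_distrib exp_double)
  finally have "(N X)\<^sup>2 \<le> (exp (w * h) * N (X - h *\<^sub>R Y))\<^sup>2" by simp
  then show ?thesis by (rule power2_le_imp_le) (simp add: N_nonneg)
qed

text \<open>With feedback and reaction evaluated at a frozen state Z, the equation is pure transport
  and has a solution f Z. A fixed point of f solves the full resolvent equation.\<close>

lemma loop_op_range:
  assumes c: "admissible c" and h: "0 < h" "h \<le> h0"
  shows "\<exists>X Y. (X, Y) \<in> loop_op \<kappa> D c \<and> X - h *\<^sub>R Y = F"
proof -
  have pos: "0 < lam c" "0 < mu c" using c mul_pos by (auto simp: admissible_def)
  have "\<exists>X Y. transport c D X Y (inner \<kappa> Z) \<and> X - h *\<^sub>R Y = F + h *\<^sub>R reaction c Z" for Z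
    using transport_solve[OF h(1) pos D_pos] by metis
  then obtain f f' where f: "\<And>Z. transport c D (f Z) (f' Z) (inner \<kappa> Z)"
    "\<And>Z. f Z - h *\<^sub>R f' Z = F + h *\<^sub>R reaction c Z" by metis
  have contr: "dist (f Z) (f Z') \<le> (1/2) * dist Z Z'" for Z Z'
  proof -
    define d where "d = Z - Z'"
    have "transport c D (f Z - f Z') (f' Z - f' Z') (inner \<kappa> d)"
      using transport_diff[OF f(1) f(1), of Z Z'] by (simp add: d_def inner_diff_right)
    note tb = transport_bound[OF c this h(1)]
    have "(f Z - f Z') - h *\<^sub>R (f' Z - f' Z') = (f Z - h *\<^sub>R f' Z) - (f Z' - h *\<^sub>R f' Z')"
      by (simp add: algebra_simps)
    also have "\<dots> = h *\<^sub>R reaction c d"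
      unfolding f(2) d_def using reaction_linear(1)[of c Z "- Z'"] reaction_linear(2)[of c "-1" Z']
      by (simp add: scaleR_diff_right)
    finally have eq: "(f Z - f Z') - h *\<^sub>R (f' Z - f' Z') = h *\<^sub>R reaction c d" .
    have "(norm (f Z - f Z'))\<^sup>2 \<le> (N (f Z - f Z'))\<^sup>2"
      using norm_le_N by (intro power_mono) auto
    also have "\<dots> \<le> h * ((g / D) * (inner \<kappa> d)\<^sup>2) + (N (h *\<^sub>R reaction c d))\<^sup>2"
      using tb unfolding eq .
    also have "N (h *\<^sub>R reaction c d) = h * N (reaction c d)"
      using h by (simp add: N_def weighted_scaleR)
    also have "h * ((g / D) * (inner \<kappa> d)\<^sup>2) + (h * N (reaction c d))\<^sup>2 \<le>
        h * ((g / D) * ((norm \<kappa>)\<^sup>2 * (norm d)\<^sup>2)) + h * (b * g * s * norm d)\<^sup>2"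
    proof (rule add_mono)
      show "h * ((g / D) * (inner \<kappa> d)\<^sup>2) \<le> h * ((g / D) * ((norm \<kappa>)\<^sup>2 * (norm d)\<^sup>2))"
        using h g_ge D_pos by (intro mult_left_mono inner_kappa_square) auto
      have "N (reaction c d) \<le> b * g * norm (reaction c d)" by (rule N_le_norm)
      also have "\<dots> \<le> b * g * (s * norm d)"
        using norm_reaction[OF c] b_ge g_ge by (intro mult_left_mono) auto
      finally have "(N (reaction c d))\<^sup>2 \<le> (b * g * s * norm d)\<^sup>2"
        by (intro power_mono N_nonneg) (simp add: mult.assoc)
      \<comment> \<open>Since h0 \<le> 1, the quadratic contribution of the reaction can be charged
        to the first power of h and joined with the feedback term in h L.\<close>
      moreover have "h\<^sup>2 \<le> h"
        using h h0_le(1) by (simp add: power2_eq_square mult_le_cancel_left1)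
      ultimately show "(h * N (reaction c d))\<^sup>2 \<le> h * (b * g * s * norm d)\<^sup>2"
        using h unfolding power_mult_distrib[of h] by (intro mult_mono) auto
    qed
    also have "\<dots> = (h * L) * (norm d)\<^sup>2"
      by (simp add: L_def power_mult_distrib algebra_simps)
    also have "\<dots> \<le> (1/4) * (norm d)\<^sup>2"
      using mult_right_mono[OF h(2) L_nonneg] h0_le(2) by (intro mult_right_mono) auto
    also have "\<dots> = ((1/2) * norm d)\<^sup>2" by (simp add: power2_eq_square)
    finally have "norm (f Z - f Z') \<le> (1/2) * norm d" by (rule power2_le_imp_le) simp
    then show ?thesis by (simp add: dist_norm d_def)
  qed
  obtain X where X: "f X = X"
    using banach_fix_type[of "1/2" f] contr by auto
  have "(X, f' X + reaction c X) \<in> loop_op \<kappa> D c"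
    using f(1)[of X] by (intro loop_opI) (simp add: X)
  moreover have "X - h *\<^sub>R (f' X + reaction c X) = F"
    using f(2)[of X] by (simp add: X algebra_simps)
  ultimately show ?thesis by blast
qed

text \<open>The domain condition \<eta>(1) = <\<kappa>,X> is nonlocal. Zero-trace approximants are
  corrected by k R, where R is small in L2 with R(0) = 0 and R(1) = 1. As R changes the functional
  too, k has to solve k = k0 + k r.\<close>

lemma loop_op_dense: "closure (fst ` loop_op \<kappa> D c) = UNIV"
proof -
  have "\<exists>Z\<in>fst ` loop_op \<kappa> D c. dist Z X < e" if e: "0 < e" for X e
  proof -
    obtain U V E where X: "X = (U, V, E)" by (cases X) auto
    have e4: "0 < e/4" using e by simp
    obtain U' where U': "norm (U - (0 *\<^sub>R one_L2 + volterra U')) < e/4" "0 = 0 + inner one_L2 U'"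
      by (rule H1_traces_dense[OF e4])
    obtain V' where V': "norm (V - (0 *\<^sub>R one_L2 + volterra V')) < e/4" "0 = 0 + inner one_L2 V'"
      by (rule H1_traces_dense[OF e4])
    obtain E' where E': "norm (E - (0 *\<^sub>R one_L2 + volterra E')) < e/4" "0 = 0 + inner one_L2 E'"
      by (rule H1_traces_dense[OF e4])
    define k0 where "k0 = inner \<kappa> (volterra U', volterra V', volterra E')"
    define k3 where "k3 = snd (snd \<kappa>)"
    \<comment> \<open>The first bound yields |r| \<le> 1/2, so k exists and |k| \<le> 2 |k0|; the
      second keeps k R below e/4.\<close>
    define \<epsilon> where "\<epsilon> = min (1 / (2 * (norm k3 + 1))) (e / (4 * (2 * \<bar>k0\<bar> + 1)))"
    have \<epsilon>: "0 < \<epsilon>" using e by (simp add: \<epsilon>_def add_nonneg_pos)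
    obtain R' where R': "norm (0 - (0 *\<^sub>R one_L2 + volterra R')) < \<epsilon>" "1 = 0 + inner one_L2 R'"
      by (rule H1_traces_dense[OF \<epsilon>])
    define R where "R = volterra R'"
    have R: "norm R < 1 / (2 * (norm k3 + 1))" "norm R < e / (4 * (2 * \<bar>k0\<bar> + 1))"
      using R'(1) by (auto simp: R_def \<epsilon>_def)
    define r where "r = inner k3 R"
    have r: "\<bar>r\<bar> \<le> 1/2"
    proof -
      have "\<bar>r\<bar> \<le> norm k3 * norm R" unfolding r_def by (rule Cauchy_Schwarz_ineq2)
      also have "\<dots> \<le> (norm k3 + 1) * (1 / (2 * (norm k3 + 1)))"
        using R(1) by (intro mult_mono) auto
      also have "\<dots> = 1/2"
      proof -
        have "norm k3 + 1 \<noteq> 0" using norm_ge_zero[of k3] by linarith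
        then show ?thesis by simp
      qed
      finally show ?thesis .
    qed
    define k where "k = k0 / (1 - r)"
    have k: "k = k0 + k * r" "\<bar>k\<bar> \<le> 2 * \<bar>k0\<bar>"
    proof -
      have "k * (1 - r) = k0" using r by (simp add: k_def)
      then show "k = k0 + k * r" by (simp add: algebra_simps)
      have "\<bar>k0\<bar> / \<bar>1 - r\<bar> \<le> \<bar>k0\<bar> / (1/2)"
        using r by (intro divide_left_mono) auto
      then show "\<bar>k\<bar> \<le> 2 * \<bar>k0\<bar>" by (simp add: k_def)
    qed
    define Z where "Z = (volterra U', volterra V', volterra E' + k *\<^sub>R R)"
    have kZ: "inner \<kappa> Z = k"
    proof -
      have "inner \<kappa> Z = k0 + k * r"
        by (simp add: Z_def k0_def r_def k3_def inner_prod_def inner_add_right)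
      then show ?thesis using k(1) by simp
    qed
    have "transport c D Z (- lam c *\<^sub>R U', mu c *\<^sub>R V', (1 / D) *\<^sub>R (E' + k *\<^sub>R R')) (inner \<kappa> Z)"
      unfolding transport_def kZ
      by (intro exI[of _ U'] exI[of _ V'] exI[of _ "E' + k *\<^sub>R R'"] exI[of _ 0])
         (use V'(2) E'(2) R'(2) in \<open>simp add: Z_def R_def volterra_add volterra_scaleR inner_add_right\<close>)
    then have "Z \<in> fst ` loop_op \<kappa> D c"
      by (metis fst_conv imageI loop_opI)
    moreover have "dist Z X < e"
    proof -
      have "norm (k *\<^sub>R R) < e/4"
      proof -
        have "norm (k *\<^sub>R R) \<le> (2 * \<bar>k0\<bar>) * norm R" using k(2) by (simp add: mult_right_mono)
        also have "\<dots> \<le> (2 * \<bar>k0\<bar> + 1) * norm R" by (intro mult_right_mono) auto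
        also have "\<dots> < (2 * \<bar>k0\<bar> + 1) * (e / (4 * (2 * \<bar>k0\<bar> + 1)))"
          using R(2) by (intro mult_strict_left_mono) auto
        also have "\<dots> = e/4"
        proof -
          have "m * (e / (4 * m)) = e / 4" if "m \<noteq> 0" for m :: real using that by simp
          moreover have "2 * \<bar>k0\<bar> + 1 \<noteq> 0" using abs_ge_zero[of k0] by linarith
          ultimately show ?thesis by blast
        qed
        finally show ?thesis .
      qed
      moreover have "norm (volterra E' + k *\<^sub>R R - E) \<le> norm (volterra E' - E) + norm (k *\<^sub>R R)"
        using norm_triangle_ineq[of "volterra E' - E" "k *\<^sub>R R"] by (simp add: algebra_simps)
      moreover have "norm (Z - X) \<le> norm (volterra U' - U) + (norm (volterra V' - V) + norm (volterra E' + k *\<^sub>R R - E))"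
        unfolding Z_def X diff_Pair
        by (rule order.trans[OF norm_Pair_le add_left_mono[OF norm_Pair_le]])
      ultimately have "norm (Z - X) < e"
        using U'(1) V'(1) E'(1) by (simp add: norm_minus_commute)
      then show ?thesis by (simp add: dist_norm)
    qed
    ultimately show ?thesis by blast
  qed
  then show ?thesis by (auto simp: closure_approachable)
qed

lemma subspace_loop_op: "subspace (loop_op \<kappa> D c)"
proof (rule subspaceI)
  show "0 \<in> loop_op \<kappa> D c"
  proof -
    have "transport c D 0 0 0"
      unfolding transport_def
      by (intro exI[of _ 0]) (use volterra_scaleR[of 0 0] in \<open>simp add: zero_prod_def\<close>)
    then have "transport c D 0 0 (inner \<kappa> 0)" by simp
    then have "(0, 0 + reaction c 0) \<in> loop_op \<kappa> D c" unfolding loop_op_def by blast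
    moreover have "reaction c 0 = 0" using reaction_linear(2)[of c 0 0] by simp
    ultimately show ?thesis by (simp add: zero_prod_def[where 'a=state and 'b=state])
  qed
  show "p + q \<in> loop_op \<kappa> D c" if pq: "p \<in> loop_op \<kappa> D c" "q \<in> loop_op \<kappa> D c" for p q
  proof -
    obtain X Y where p: "p = (X, Y + reaction c X)" "transport c D X Y (inner \<kappa> X)"
      using pq(1) unfolding loop_op_def by blast
    obtain X' Y' where q: "q = (X', Y' + reaction c X')" "transport c D X' Y' (inner \<kappa> X')"
      using pq(2) unfolding loop_op_def by blast
    have "transport c D (X + X') (Y + Y') (inner \<kappa> (X + X'))"
      using transport_add[OF p(2) q(2)] by (simp add: inner_add_right)
    moreover have "p + q = (X + X', (Y + Y') + reaction c (X + X'))"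
      by (simp add: p q reaction_linear)
    ultimately show ?thesis unfolding loop_op_def by blast
  qed
  show "s *\<^sub>R p \<in> loop_op \<kappa> D c" if pq: "p \<in> loop_op \<kappa> D c" for s p
  proof -
    obtain X Y where p: "p = (X, Y + reaction c X)" "transport c D X Y (inner \<kappa> X)"
      using pq(1) unfolding loop_op_def by blast
    have "transport c D (s *\<^sub>R X) (s *\<^sub>R Y) (inner \<kappa> (s *\<^sub>R X))"
      using transport_scaleR[OF p(2)] by simp
    moreover have "s *\<^sub>R p = (s *\<^sub>R X, s *\<^sub>R Y + reaction c (s *\<^sub>R X))"
      by (simp add: p reaction_linear scaleR_add_right)
    ultimately show ?thesis unfolding loop_op_def by blast
  qed
qed

lemma m_dissipative_loop_op:
  assumes c: "admissible c"
  shows "m_dissipative (loop_op \<kappa> D c) N (b * g) w h0"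
proof
  show "N (X + Y) \<le> N X + N Y" for X Y
    by (simp add: N_def weighted_add norm_triangle_ineq)
  show "N (r *\<^sub>R X) = \<bar>r\<bar> * N X" for r X
    by (simp add: N_def weighted_scaleR)
qed (use assms subspace_loop_op norm_le_N N_le_norm w_nonneg h0_pos loop_op_dissipative loop_op_range
      loop_op_dense in blast)+

end

section \<open>Identification with the operator of the closed-loop equations\<close>

lemma sq_integrable_kernel_section:
  assumes q: "bounded_kernel T2 q" and f: "continuous_on {0..1} f1" "continuous_on {0..1} f2"
    "f1 ` {0..1} \<subseteq> {0..1}" "f2 ` {0..1} \<subseteq> {0..1}"
  shows "sq_integrable (\<lambda>\<xi>. q (f1 \<xi>) (f2 \<xi>))"
proof -
  obtain B where B: "\<And>z. z \<in> T2 \<Longrightarrow> \<bar>case_prod q z\<bar> \<le> B"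
    using q by (force simp: bounded_kernel_def bounded_iff)
  have "(\<lambda>\<xi>. (f1 \<xi>, f2 \<xi>)) \<in> borel_measurable I01"
    by (intro continuous_imp_measurable_on_sets_lebesgue continuous_intros f) auto
  then have "(\<lambda>\<xi>. (f1 \<xi>, f2 \<xi>)) \<in> measurable I01 (restrict_space borel T2)"
    by (intro measurable_restrict_space2) (use f in \<open>auto simp: T2_def\<close>)
  then have "(\<lambda>\<xi>. case_prod q (f1 \<xi>, f2 \<xi>)) \<in> borel_measurable I01"
    by (rule measurable_compose) (use q in \<open>simp add: bounded_kernel_def\<close>)
  then have m: "(\<lambda>\<xi>. q (f1 \<xi>) (f2 \<xi>)) \<in> borel_measurable I01" by simp
  show ?thesis
  proof (rule bounded_sq_integrable(1)[OF m])
    fix \<xi> :: real assume "\<xi> \<in> {0..1}"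
    then have "(f1 \<xi>, f2 \<xi>) \<in> T2" using f(3,4) unfolding T2_def by blast
    then show "\<bar>q (f1 \<xi>) (f2 \<xi>)\<bar> \<le> B" using B by fastforce
  qed
qed

lemma sq_integrable_minus: "sq_integrable f \<Longrightarrow> sq_integrable (\<lambda>x. - f x)"
  using sq_integrable_scale[of f "-1"] by simp

lemma integral_mult_eq_inner:
  assumes "sq_integrable f" "sq_integrable g"
  shows "integral {0..1} (\<lambda>x. f x * g x) = inner (abs_L2 f) (abs_L2 g)"
  unfolding inner_abs_L2[OF assms]
  by (rule lebesgue_integral_eq_integral[OF sq_integrable_mult[OF assms], symmetric]) simp

text \<open>The Riesz vector is explicit: the sections q1(1,.), q2(1,.) and p(1 - .), which are
  bounded and measurable because the kernels are.\<close>

lemma control_eq_inner: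
  assumes "predictor_kernels D c Kvu Kvv q1 q2 p"
  obtains \<kappa> where "\<And>u v \<eta>. sq_integrable u \<Longrightarrow> sq_integrable v \<Longrightarrow> sq_integrable \<eta> \<Longrightarrow>
    control p q1 q2 u v \<eta> = inner \<kappa> (abs_L2 u, abs_L2 v, abs_L2 \<eta>)"
proof -
  have q: "bounded_kernel T2 q1" "bounded_kernel T2 q2" and p: "\<And>x. x \<in> {0..1} \<Longrightarrow> p x = D * mu c * q2 x 1"
    using assms by (auto simp: predictor_kernels_def)
  have 1: "sq_integrable (\<lambda>\<xi>. q1 1 \<xi>)" "sq_integrable (\<lambda>\<xi>. q2 1 \<xi>)"
    by (rule sq_integrable_kernel_section[of _ "\<lambda>_. 1" "\<lambda>\<xi>. \<xi>"]; use q in \<open>auto intro!: continuous_intros\<close>)+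
  have "sq_integrable (\<lambda>\<xi>. q2 (1 - \<xi>) 1)"
    by (rule sq_integrable_kernel_section[of _ "\<lambda>\<xi>. 1 - \<xi>" "\<lambda>_. 1"]; use q in \<open>auto intro!: continuous_intros\<close>)
  then have "sq_integrable (\<lambda>\<xi>. (D * mu c) * q2 (1 - \<xi>) 1)" by (rule sq_integrable_scale)
  then have 2: "sq_integrable (\<lambda>\<xi>. p (1 - \<xi>))"
    by (rule abs_L2_cong(1)) (simp add: p)
  show thesis
    by (rule that[of "(abs_L2 (\<lambda>\<xi>. q1 1 \<xi>), abs_L2 (\<lambda>\<xi>. q2 1 \<xi>), abs_L2 (\<lambda>\<xi>. p (1 - \<xi>)))"])
       (simp add: control_def integral_mult_eq_inner 1 2 inner_prod_def)
qed

lemma closed_loop_op_eq: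
  assumes \<kappa>: "\<And>u v \<eta>. sq_integrable u \<Longrightarrow> sq_integrable v \<Longrightarrow> sq_integrable \<eta> \<Longrightarrow>
    control p q1 q2 u v \<eta> = inner \<kappa> (abs_L2 u, abs_L2 v, abs_L2 \<eta>)"
  shows "closed_loop_op D p q1 q2 c = loop_op \<kappa> D c"
proof (intro set_eqI iffI)
  fix z assume "z \<in> closed_loop_op D p q1 q2 c"
  then obtain u v \<eta> u' v' \<eta>' where z: "z = ((abs_L2 u, abs_L2 v, abs_L2 \<eta>),
       (abs_L2 (\<lambda>x. - lam c * u' x + sigp c * v x),
        abs_L2 (\<lambda>x. mu c * v' x + sigm c * u x),
        abs_L2 (\<lambda>x. \<eta>' x / D)))" and H: "H1 u u'" "H1 v v'" "H1 \<eta> \<eta>'"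
    and bc: "u 0 = phi c * v 0" "v 1 = \<eta> 0" "\<eta> 1 = control p q1 q2 u v \<eta>"
    unfolding closed_loop_op_def by blast
  note sq = H[THEN H1_sq_integrable(1)] H[THEN H1_sq_integrable(2)]
  define X where "X = (abs_L2 u, abs_L2 v, abs_L2 \<eta>)"
  have tr: "abs_L2 f = f 0 *\<^sub>R one_L2 + volterra (abs_L2 f') \<and> f 1 = f 0 + inner one_L2 (abs_L2 f')"
    if "H1 f f'" for f f'
    by (subst H1_iff_volterra[symmetric]) (use that in blast)
  have "transport c D X (- lam c *\<^sub>R abs_L2 u', mu c *\<^sub>R abs_L2 v', (1 / D) *\<^sub>R abs_L2 \<eta>') (inner \<kappa> X)"
    unfolding transport_def X_def \<kappa>[OF sq(1-3), symmetric] bc(3)[symmetric]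
    by (intro exI[of _ "abs_L2 u'"] exI[of _ "abs_L2 v'"] exI[of _ "abs_L2 \<eta>'"] exI[of _ "v 0"])
       (use tr[OF H(1)] tr[OF H(2)] tr[OF H(3)] bc(1,2) in simp)
  moreover have "z = (X, (- lam c *\<^sub>R abs_L2 u', mu c *\<^sub>R abs_L2 v', (1 / D) *\<^sub>R abs_L2 \<eta>') + reaction c X)"
    using sq unfolding z X_def reaction_def
    by (simp add: abs_L2_scaleR abs_L2_add sq_integrable_scale sq_integrable_minus divide_inverse mult.commute
        del: scaleR_minus_left)
  ultimately show "z \<in> loop_op \<kappa> D c" unfolding loop_op_def by blast
next
  fix z assume "z \<in> loop_op \<kappa> D c"
  then obtain X Y where z: "z = (X, Y + reaction c X)" and tr: "transport c D X Y (inner \<kappa> X)"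
    unfolding loop_op_def by blast
  obtain U' V' E' a where X: "X = ((phi c * a) *\<^sub>R one_L2 + volterra U', a *\<^sub>R one_L2 + volterra V',
          (a + inner one_L2 V') *\<^sub>R one_L2 + volterra E')"
     and Y: "Y = (- lam c *\<^sub>R U', mu c *\<^sub>R V', (1 / D) *\<^sub>R E')"
     and k: "inner \<kappa> X = a + inner one_L2 V' + inner one_L2 E'"
    using tr unfolding transport_def by blast
  obtain u u' where u: "H1 u u'" "fst X = abs_L2 u" "U' = abs_L2 u'" "u 0 = phi c * a"
    using H1_iff_volterra[of "fst X" U' "phi c * a" "phi c * a + inner one_L2 U'"] X by auto
  obtain v v' where v: "H1 v v'" "fst (snd X) = abs_L2 v" "V' = abs_L2 v'" "v 0 = a" "v 1 = a + inner one_L2 V'"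
    using H1_iff_volterra[of "fst (snd X)" V' a "a + inner one_L2 V'"] X by auto
  obtain \<eta> \<eta>' where \<eta>: "H1 \<eta> \<eta>'" "snd (snd X) = abs_L2 \<eta>" "E' = abs_L2 \<eta>'" "\<eta> 0 = a + inner one_L2 V'"
      "\<eta> 1 = a + inner one_L2 V' + inner one_L2 E'"
    using H1_iff_volterra[of "snd (snd X)" E' "a + inner one_L2 V'" "a + inner one_L2 V' + inner one_L2 E'"] X by auto
  have XX: "X = (abs_L2 u, abs_L2 v, abs_L2 \<eta>)" using u v \<eta> by (metis prod.collapse)
  note sq = u(1)[THEN H1_sq_integrable(1)] v(1)[THEN H1_sq_integrable(1)] \<eta>(1)[THEN H1_sq_integrable(1)]
    u(1)[THEN H1_sq_integrable(2)] v(1)[THEN H1_sq_integrable(2)] \<eta>(1)[THEN H1_sq_integrable(2)]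
  have bc: "u 0 = phi c * v 0" "v 1 = \<eta> 0" "\<eta> 1 = control p q1 q2 u v \<eta>"
    using u v \<eta> k \<kappa>[OF sq(1-3)] unfolding XX[symmetric] by simp_all
  have "z = ((abs_L2 u, abs_L2 v, abs_L2 \<eta>),
       (abs_L2 (\<lambda>x. - lam c * u' x + sigp c * v x),
        abs_L2 (\<lambda>x. mu c * v' x + sigm c * u x),
        abs_L2 (\<lambda>x. \<eta>' x / D)))"
    using sq unfolding z Y XX reaction_def u(3) v(3) \<eta>(3)
    by (simp add: abs_L2_scaleR abs_L2_add sq_integrable_scale sq_integrable_minus divide_inverse mult.commute
        del: scaleR_minus_left)
  then show "z \<in> closed_loop_op D p q1 q2 c"
    unfolding closed_loop_op_def using u(1) v(1) \<eta>(1) bc by blast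
qed

subsection \<open>Switching along a path\<close>

text \<open>At the infimum c of the counterexamples, \<open>base\<close> or \<open>left\<close>
  gives P c; then \<open>right\<close> pushes all counterexamples beyond some b > c.\<close>

lemma real_induct:
  fixes P :: "real \<Rightarrow> bool"
  assumes base: "P 0"
    and right: "\<And>t. 0 \<le> t \<Longrightarrow> (\<And>s. 0 \<le> s \<Longrightarrow> s \<le> t \<Longrightarrow> P s) \<Longrightarrow> \<exists>b>t. \<forall>s\<in>{t..<b}. P s"
    and left: "\<And>t. 0 < t \<Longrightarrow> (\<And>s. 0 \<le> s \<Longrightarrow> s < t \<Longrightarrow> P s) \<Longrightarrow> P t"
    and t: "0 \<le> t"
  shows "P t"
proof (rule ccontr)
  assume not: "\<not> P t"
  define B where "B = {s. 0 \<le> s \<and> \<not> P s}"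
  have B: "B \<noteq> {}" "bdd_below B" using not t by (auto simp: B_def intro!: bdd_belowI[of _ 0])
  define c where "c = Inf B"
  have c0: "0 \<le> c" unfolding c_def using B by (intro cInf_greatest) (auto simp: B_def)
  have below: "P s" if "0 \<le> s" "s < c" for s
    using cInf_lower[OF _ B(2), of s] that by (auto simp: B_def c_def)
  have "P c"
  proof (cases "c = 0")
    case False
    then have "0 < c" using c0 by simp
    then show ?thesis by (rule left) (rule below)
  qed (use base in simp)
  then have "P s" if "0 \<le> s" "s \<le> c" for s using below[of s] that by (cases "s = c") auto
  then obtain b where b: "c < b" "\<And>s. s \<in> {c..<b} \<Longrightarrow> P s" using right[OF c0] by blast
  have "b \<le> c" unfolding c_def
  proof (rule cInf_greatest[OF B(1)])
    fix s assume s: "s \<in> B"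
    then have "c \<le> s" unfolding c_def by (rule cInf_lower[OF _ B(2)])
    then show "b \<le> s" using b(2)[of s] s by (auto simp: B_def not_less[symmetric])
  qed
  with b(1) show False by simp
qed

text \<open>The first clause is right-continuity in a discrete space. The second excludes
  accumulation of jumps; the constant j before t may differ from m t.\<close>

definition step_path :: "(real \<Rightarrow> nat) \<Rightarrow> bool" where
  "step_path m \<longleftrightarrow>
     (\<forall>t\<ge>0. \<exists>b>t. \<forall>s\<in>{t..<b}. m s = m t) \<and>
     (\<forall>t>0. \<exists>a j. 0 \<le> a \<and> a < t \<and> (\<forall>s\<in>{a..<t}. m s = j))"

lemma step_path_rightE:
  assumes "step_path m" "0 \<le> t"
  obtains b where "t < b" "\<And>s. t \<le> s \<Longrightarrow> s < b \<Longrightarrow> m s = m t"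
  using assms unfolding step_path_def by (meson atLeastLessThan_iff)

lemma step_path_leftE:
  assumes "step_path m" "0 < t"
  obtains a where "0 \<le> a" "a < t" "\<And>s. a \<le> s \<Longrightarrow> s < t \<Longrightarrow> m s = m a"
proof -
  obtain a j where a: "0 \<le> a" "a < t" "\<forall>s\<in>{a..<t}. m s = j"
    using assms unfolding step_path_def by blast
  then have "m a = j" by simp
  with a show thesis by (intro that[of a]) auto
qed

lemma constant_not_jump:
  assumes "\<And>s. a \<le> s \<Longrightarrow> s < b \<Longrightarrow> m s = j" "a < t" "t < b"
  shows "\<not> jump_time m t"
proof -
  have "continuous_on {a<..<b} m"
    by (rule continuous_on_eq[OF continuous_on_const[of _ j]]) (use assms(1) in simp)
  then have "isCont m t" using assms(2,3) by (simp add: continuous_on_eq_continuous_at)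
  then show ?thesis by (simp add: jump_time_def)
qed

text \<open>\<open>path_solution\<close> speaks only about intervals starting at 0 or at a jump, so
  every time has to be traced back to such a start.\<close>

lemma last_jump:
  assumes m: "step_path m" and "0 \<le> t"
  shows "\<exists>a. 0 \<le> a \<and> a \<le> t \<and> (a = 0 \<or> jump_time m a) \<and> (\<forall>s. a < s \<and> s \<le> t \<longrightarrow> \<not> jump_time m s)"
  using \<open>0 \<le> t\<close>
proof (induction t rule: real_induct[rotated 3, consumes 1, case_names base right left])
  case base
  then show ?case by (intro exI[of _ 0]) auto
next
  case (right t)
  obtain a where a: "0 \<le> a" "a \<le> t" "a = 0 \<or> jump_time m a" "\<forall>s. a < s \<and> s \<le> t \<longrightarrow> \<not> jump_time m s"
    using right(2)[of t] right(1) by auto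
  obtain b where b: "t < b" "\<And>s. t \<le> s \<Longrightarrow> s < b \<Longrightarrow> m s = m t"
    using step_path_rightE[OF m right(1)] by blast
  have nj: "\<not> jump_time m s" if "a < s" "s < b" for s
  proof (cases "s \<le> t")
    case False
    then show ?thesis using that(2) by (intro constant_not_jump[OF b(2)]) auto
  qed (use a(4) that in auto)
  show ?case
  proof (rule exI[of _ b], intro conjI ballI b(1))
    fix s assume s: "s \<in> {t..<b}"
    show "\<exists>a. 0 \<le> a \<and> a \<le> s \<and> (a = 0 \<or> jump_time m a) \<and> (\<forall>u. a < u \<and> u \<le> s \<longrightarrow> \<not> jump_time m u)"
      by (rule exI[of _ a]) (use a(1-3) nj s in auto)
  qed
next
  case (left t)
  show ?case
  proof (cases "jump_time m t")
    case True
    then show ?thesis using left(1) by (intro exI[of _ t]) auto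
  next
    case False
    obtain c where c: "0 \<le> c" "c < t" "\<And>s. c \<le> s \<Longrightarrow> s < t \<Longrightarrow> m s = m c"
      using step_path_leftE[OF m left(1)] by blast
    obtain a where a: "0 \<le> a" "a \<le> c" "a = 0 \<or> jump_time m a" "\<forall>s. a < s \<and> s \<le> c \<longrightarrow> \<not> jump_time m s"
      using left(2)[of c] c by auto
    have "\<not> jump_time m s" if as: "a < s" and st: "s \<le> t" for s
    proof -
      consider "s \<le> c" | "c < s \<and> s < t" | "s = t" using st by linarith
      then show ?thesis
      proof cases
        case 2
        then show ?thesis by (intro constant_not_jump[OF c(3)]) auto
      qed (use a as False in auto)
    qed
    then show ?thesis using a c(1,2) by (intro exI[of _ a]) auto
  qed
qed

lemma no_jump_constant:
  assumes m: "step_path m" and a: "0 \<le> a" and nj: "\<forall>s\<in>{a<..<b}. \<not> jump_time m s" and s: "a \<le> s" "s < b"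
  shows "m s = m a"
proof -
  have "0 \<le> s" using a s by simp
  then have "a \<le> s \<and> s < b \<longrightarrow> m s = m a"
  proof (induction s rule: real_induct[rotated 3, consumes 1, case_names base right left])
    case base
    then show ?case using a by (auto intro: arg_cong[where f=m])
  next
    case (right t)
    show ?case
    proof (cases "a \<le> t \<and> t < b")
      case True
      then have "m t = m a" using right(2)[of t] right(1) by auto
      with step_path_rightE[OF m right(1)] show ?thesis by (metis atLeastLessThan_iff)
    next
      case False
      then show ?thesis
      proof (cases "t < a")
        case True
        then show ?thesis by (intro exI[of _ a]) auto
      next
        case False
        then show ?thesis using \<open>\<not> (a \<le> t \<and> t < b)\<close> by (intro exI[of _ "t + 1"]) auto
      qed
    qed
  next
    case (left t)
    show ?case
    proof (intro impI)
      assume t: "a \<le> t \<and> t < b"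
      show "m t = m a"
      proof (cases "t = a")
        case False
        with t nj have "isCont m t" using left(1) by (auto simp: jump_time_def)
        then have "(m \<longlongrightarrow> m t) (at_left t)" unfolding isCont_def by (rule tendsto_within_subset) auto
        then have "eventually (\<lambda>s. m s = m t) (at_left t)" by (simp add: tendsto_discrete)
        moreover have "eventually (\<lambda>s. s \<in> {a<..<t}) (at_left t)"
          using t False by (intro eventually_at_leftI[of a]) auto
        ultimately have "eventually (\<lambda>s. m s = m t \<and> s \<in> {a<..<t}) (at_left t)" by (rule eventually_conj)
        then obtain s where "m s = m t" "s \<in> {a<..<t}"
          using eventually_happens'[OF trivial_limit_at_left_real] by blast
        then show ?thesis using left(2)[of s] a t by simp
      qed simp
    qed
  qed
  then show ?thesis using s by simp
qed

section \<open>Products of semigroups along a path\<close>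

text \<open>One norm \<open>N\<close> with one rate w for all modes keeps arbitrary products stable;
  with a norm per mode each switch could cost another factor.\<close>

locale switched_semigroups =
  fixes T :: "nat \<Rightarrow> real \<Rightarrow> 'a \<Rightarrow> 'a::real_normed_vector" and R :: "nat set"
    and N :: "'a \<Rightarrow> real" and C w :: real
  assumes semigroup: "j \<in> R \<Longrightarrow> C0_semigroup (T j)" and finite_R: "finite R"
    and norm_le_N: "norm x \<le> N x" and N_le_norm: "N x \<le> C * norm x"
    and N_T: "j \<in> R \<Longrightarrow> 0 \<le> t \<Longrightarrow> N (T j t x) \<le> exp (w * t) * N x"
    and w_nonneg: "0 \<le> w"
begin

lemma T_zero: "j \<in> R \<Longrightarrow> T j 0 x = x"
  and T_add: "j \<in> R \<Longrightarrow> 0 \<le> s \<Longrightarrow> 0 \<le> t \<Longrightarrow> T j (s + t) x = T j s (T j t x)"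
  and bl_T: "j \<in> R \<Longrightarrow> 0 \<le> t \<Longrightarrow> bounded_linear (T j t)"
  and T_lim: "j \<in> R \<Longrightarrow> ((\<lambda>t. T j t x) \<longlongrightarrow> x) (at_right 0)"
  using semigroup[of j] by (auto simp: C0_semigroup_def)

lemma norm_T_diff:
  assumes "j \<in> R" "0 \<le> s" "s \<le> t"
  shows "norm (T j s x - T j s y) \<le> exp (w * t) * \<bar>C\<bar> * norm (x - y)"
proof -
  have "T j s x - T j s y = T j s (x - y)"
    using bl_T[OF assms(1,2)] by (simp add: bounded_linear.linear linear_diff)
  then have "norm (T j s x - T j s y) \<le> N (T j s (x - y))" using norm_le_N by simp
  also have "\<dots> \<le> exp (w * s) * N (x - y)" by (rule N_T[OF assms(1,2)])
  also have "\<dots> \<le> exp (w * s) * (\<bar>C\<bar> * norm (x - y))"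
    by (intro mult_left_mono order.trans[OF N_le_norm] mult_right_mono) auto
  also have "\<dots> \<le> exp (w * t) * (\<bar>C\<bar> * norm (x - y))"
    using assms w_nonneg by (intro mult_right_mono) (auto intro: mult_left_mono)
  finally show ?thesis by (simp add: mult.assoc)
qed

text \<open>The approximations freeze the mode on each dyadic interval at its value at the left end point, so
  that they depend on finitely many values of the path only.\<close>

primrec grid_state :: "'a \<Rightarrow> (real \<Rightarrow> nat) \<Rightarrow> nat \<Rightarrow> nat \<Rightarrow> 'a" where
  "grid_state x0 m n 0 = x0"
| "grid_state x0 m n (Suc i) = T (m (real i / 2^n)) (1 / 2^n) (grid_state x0 m n i)"

definition approx :: "'a \<Rightarrow> (real \<Rightarrow> nat) \<Rightarrow> nat \<Rightarrow> real \<Rightarrow> 'a" where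
  "approx x0 m n t = (let k = nat \<lfloor>t * 2^n\<rfloor> in T (m (real k / 2^n)) (t - real k / 2^n) (grid_state x0 m n k))"

definition evolution :: "'a \<Rightarrow> (real \<Rightarrow> nat) \<Rightarrow> real \<Rightarrow> 'a" where
  "evolution x0 m t = lim (\<lambda>n. approx x0 m n t)"

lemma grid_floor:
  assumes "0 \<le> (t::real)"
  shows "real (nat \<lfloor>t * 2^n\<rfloor>) / 2^n \<le> t" "t < real (Suc (nat \<lfloor>t * 2^n\<rfloor>)) / 2^n"
proof -
  have "0 \<le> t * 2^n" using assms by simp
  then have "real (nat \<lfloor>t * 2^n\<rfloor>) \<le> t * 2^n" "t * 2^n < real (Suc (nat \<lfloor>t * 2^n\<rfloor>))"
    by linarith+
  then show "real (nat \<lfloor>t * 2^n\<rfloor>) / 2^n \<le> t" "t < real (Suc (nat \<lfloor>t * 2^n\<rfloor>)) / 2^n"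
    by (simp_all add: field_simps)
qed

context
  fixes m :: "real \<Rightarrow> nat" and x0 :: 'a
  assumes m_R: "\<And>t. 0 \<le> t \<Longrightarrow> m t \<in> R"
begin

lemma N_grid_state: "N (grid_state x0 m n k) \<le> exp (w * (real k / 2^n)) * N x0"
proof (induction k)
  case (Suc k)
  have "N (grid_state x0 m n (Suc k)) \<le> exp (w * (1 / 2^n)) * N (grid_state x0 m n k)"
    using N_T[OF m_R[of "real k / 2^n"], of "1 / 2^n" "grid_state x0 m n k"] by simp
  also have "\<dots> \<le> exp (w * (1 / 2^n)) * (exp (w * (real k / 2^n)) * N x0)"
    using Suc by (intro mult_left_mono) auto
  also have "\<dots> = exp (w * (real (Suc k) / 2^n)) * N x0"
    by (simp add: exp_add[symmetric] add_divide_distrib algebra_simps)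
  finally show ?case .
qed simp

lemma N_approx:
  assumes t: "0 \<le> t"
  shows "N (approx x0 m n t) \<le> exp (w * t) * N x0"
proof -
  define k where "k = nat \<lfloor>t * 2^n\<rfloor>"
  have k: "real k / 2^n \<le> t" using grid_floor[OF t] by (simp add: k_def)
  have "N (approx x0 m n t) \<le> exp (w * (t - real k / 2^n)) * N (grid_state x0 m n k)"
    unfolding approx_def Let_def k_def[symmetric] using k by (intro N_T m_R) auto
  also have "\<dots> \<le> exp (w * (t - real k / 2^n)) * (exp (w * (real k / 2^n)) * N x0)"
    by (intro mult_left_mono N_grid_state) simp
  also have "\<dots> = exp (w * t) * N x0"
    by (simp add: exp_add[symmetric] algebra_simps)
  finally show ?thesis .
qed

lemma approx_zero: "approx x0 m n 0 = x0"
  by (simp add: approx_def T_zero m_R)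

text \<open>Only the dyadic cell containing a may carry a foreign mode; d is the part of it after a,
  and beyond it the product collapses by the semigroup law. The case t = b is included and later
  provides left limits.\<close>

lemma approx_constant_mode:
  assumes a: "0 \<le> a" "a < t" "t \<le> b" and mj: "\<And>s. a \<le> s \<Longrightarrow> s < b \<Longrightarrow> m s = j"
    and n: "1 / 2^n < t - a"
  defines "k \<equiv> nat \<lfloor>a * 2^n\<rfloor>"
  defines "d \<equiv> real (Suc k) / 2^n - a"
  shows "0 < d" "d \<le> 1 / 2^n"
    "approx x0 m n t = T j (t - a - d) (T (m (real k / 2^n)) d (approx x0 m n a))"
proof -
  have j: "j \<in> R" using mj[of a] m_R[of a] a by simp
  have ka: "real k / 2^n \<le> a" "a < real (Suc k) / 2^n" using grid_floor[OF a(1)] by (simp_all add: k_def)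
  then show d: "0 < d" "d \<le> 1 / 2^n" by (simp_all add: d_def add_divide_distrib)
  have ad: "a + d = real (Suc k) / 2^n" by (simp add: d_def)
  \<comment> \<open>The cell is split at a: its first part a - k / 2^n produces the approximation at
    a, its second part is d.\<close>
  have V: "grid_state x0 m n (Suc k) = T (m (real k / 2^n)) d (approx x0 m n a)"
  proof -
    have "1 / 2^n = d + (a - real k / 2^n)" by (simp add: d_def add_divide_distrib)
    then have "T (m (real k / 2^n)) (1 / 2^n) y = T (m (real k / 2^n)) d (T (m (real k / 2^n)) (a - real k / 2^n) y)" for y
      using T_add[OF m_R[of "real k / 2^n"], of d "a - real k / 2^n" y] d ka by simp
    then show ?thesis by (simp add: approx_def Let_def k_def)
  qed
  have grid: "grid_state x0 m n (Suc k + i) = T j (real i / 2^n) (grid_state x0 m n (Suc k))"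
    if "real (Suc k + i) / 2^n \<le> t" for i
    using that
  proof (induction i)
    case 0
    then show ?case by (simp add: T_zero j)
  next
    case (Suc i)
    have le: "real (Suc k + i) / 2^n < real (Suc k + Suc i) / 2^n" by (simp add: divide_strict_right_mono)
    have "real (Suc k) / 2^n \<le> real (Suc k + i) / 2^n" by (simp add: divide_right_mono)
    then have "m (real (Suc k + i) / 2^n) = j" using le Suc.prems a ka(2) by (intro mj) linarith+
    moreover have "grid_state x0 m n (Suc k + i) = T j (real i / 2^n) (grid_state x0 m n (Suc k))"
      using le Suc.prems by (intro Suc.IH) linarith
    ultimately have "grid_state x0 m n (Suc k + Suc i) = T j (1 / 2^n) (T j (real i / 2^n) (grid_state x0 m n (Suc k)))"
      by simp
    also have "\<dots> = T j (1 / 2^n + real i / 2^n) (grid_state x0 m n (Suc k))"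
      by (rule T_add[OF j, symmetric]) auto
    also have "1 / 2^n + real i / 2^n = real (Suc i) / 2^n" by (simp add: add_divide_distrib)
    finally show ?case .
  qed
  define l where "l = nat \<lfloor>t * 2^n\<rfloor>"
  have lt: "real l / 2^n \<le> t" "t < real (Suc l) / 2^n" using grid_floor[of t] a by (simp_all add: l_def)
  have "real (Suc k) / 2^n < real (Suc l) / 2^n" using d n lt ad by linarith
  then have "Suc k \<le> l" by (simp add: divide_less_cancel)
  then obtain i where i: "l = Suc k + i" using le_Suc_ex by blast
  have "approx x0 m n t = T (m (real l / 2^n)) (t - real l / 2^n) (T j (real i / 2^n) (grid_state x0 m n (Suc k)))"
    using grid[of i] lt unfolding approx_def Let_def l_def[symmetric] by (simp add: i)
  also have "\<dots> = T j (t - real l / 2^n) (T j (real i / 2^n) (grid_state x0 m n (Suc k)))"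
  \<comment> \<open>If t is a grid point, the mode read there may already be the next one (t = b),
    but it acts for time zero.\<close>
  proof (cases "t = real l / 2^n")
    case True
    then show ?thesis by (simp add: T_zero j m_R)
  next
    case False
    have "real (Suc k) / 2^n \<le> real l / 2^n" using \<open>Suc k \<le> l\<close> by (simp add: divide_right_mono)
    then have "m (real l / 2^n) = j" using False lt a ka(2) by (intro mj) linarith+
    then show ?thesis by simp
  qed
  also have "\<dots> = T j (t - real l / 2^n + real i / 2^n) (grid_state x0 m n (Suc k))"
    using lt by (intro T_add[OF j, symmetric]) auto
  also have "t - real l / 2^n + real i / 2^n = t - a - d"
    by (simp add: i d_def add_divide_distrib)
  finally show "approx x0 m n t = T j (t - a - d) (T (m (real k / 2^n)) d (approx x0 m n a))"
    unfolding V .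
qed

lemma approx_tendsto:
  assumes a: "0 \<le> a" "a \<le> t" "t \<le> b" "a < b" and mj: "\<And>s. a \<le> s \<Longrightarrow> s < b \<Longrightarrow> m s = j"
    and lim: "(\<lambda>n. approx x0 m n a) \<longlonglongrightarrow> y"
  shows "(\<lambda>n. approx x0 m n t) \<longlonglongrightarrow> T j (t - a) y"
proof (cases "a = t")
  case True
  have "j \<in> R" using mj[of a] m_R[of a] a by simp
  then show ?thesis using lim True by (simp add: T_zero)
next
  case False
  with a have at: "a < t" by simp
  have j: "j \<in> R" using mj[of a] m_R[of a] a by simp
  define k where "k n = nat \<lfloor>a * 2^n\<rfloor>" for n
  define d where "d n = real (Suc (k n)) / 2^n - a" for n
  have half: "(\<lambda>n. 1 / 2^n :: real) \<longlonglongrightarrow> 0"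
    using LIMSEQ_power_zero[of "1/2::real"] by (simp add: power_divide)
  have ev: "eventually (\<lambda>n. 1 / 2^n < t - a) sequentially"
    using at by (intro order_tendstoD(2)[OF half]) simp
  note step = approx_constant_mode[OF a(1) at a(3) mj, folded k_def, folded d_def]
  have dpos: "eventually (\<lambda>n. 0 < d n \<and> d n \<le> 1 / 2^n) sequentially"
    using ev by eventually_elim (use step(1,2) in blast)
  have "d \<longlonglongrightarrow> 0"
    by (rule tendsto_sandwich[OF _ _ tendsto_const half]) (use dpos in \<open>auto elim: eventually_mono\<close>)
  then have dlim: "filterlim d (at_right 0) sequentially"
    unfolding filterlim_at using dpos by (auto elim: eventually_mono)
  \<comment> \<open>The mode in the cell containing a may vary with n, so strong continuity at y is
    needed uniformly in the mode; the sum over the finite set R provides it.\<close>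
  define \<omega> where "\<omega> s = (\<Sum>i\<in>R. norm (T i s y - y))" for s
  have "(\<omega> \<longlongrightarrow> (\<Sum>i\<in>R. 0)) (at_right 0)"
    unfolding \<omega>_def by (intro tendsto_sum tendsto_norm_zero LIM_zero T_lim)
  then have "(\<omega> \<longlongrightarrow> 0) (at_right 0)" by simp
  then have \<omega>lim: "(\<lambda>n. \<omega> (d n)) \<longlonglongrightarrow> 0" by (rule filterlim_compose[OF _ dlim])
  have \<omega>: "norm (T i s y - y) \<le> \<omega> s" if "i \<in> R" for i s
    unfolding \<omega>_def using that finite_R by (intro member_le_sum) auto
  define K where "K = exp (w * t) * \<bar>C\<bar>"
  have K0: "0 \<le> K" by (simp add: K_def)
  have "(\<lambda>n. K * (K * norm (approx x0 m n a - y) + 2 * \<omega> (d n))) \<longlonglongrightarrow> K * (K * 0 + 2 * 0)"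
    by (intro tendsto_intros \<omega>lim tendsto_norm_zero LIM_zero lim)
  then have null: "(\<lambda>n. K * (K * norm (approx x0 m n a - y) + 2 * \<omega> (d n))) \<longlonglongrightarrow> 0" by simp
  have "eventually (\<lambda>n. norm (approx x0 m n t - T j (t - a) y) \<le> K * (K * norm (approx x0 m n a - y) + 2 * \<omega> (d n))) sequentially"
    using ev
  proof eventually_elim
    case (elim n)
    define i where "i = m (real (k n) / 2^n)"
    have i: "i \<in> R" unfolding i_def by (rule m_R) simp
    have dn: "0 < d n" "d n < t - a" and eq: "approx x0 m n t = T j (t - a - d n) (T i (d n) (approx x0 m n a))"
      using step[OF _ _ elim] elim by (auto simp: i_def)
    have "T j (t - a) y = T j (t - a - d n) (T j (d n) y)"
      using T_add[OF j, of "t - a - d n" "d n" y] dn by simp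
    then have "norm (approx x0 m n t - T j (t - a) y) \<le> K * norm (T i (d n) (approx x0 m n a) - T j (d n) y)"
      unfolding eq K_def using dn a by (simp add: norm_T_diff[OF j])
    also have "\<dots> \<le> K * (K * norm (approx x0 m n a - y) + 2 * \<omega> (d n))"
    proof (rule mult_left_mono[OF _ K0])
      have "norm (p + q - r) \<le> norm p + norm q + norm r" for p q r :: 'a
        using norm_triangle_ineq4[of "p + q" r] norm_triangle_ineq[of p q] by linarith
      from this[of "T i (d n) (approx x0 m n a) - T i (d n) y" "T i (d n) y - y" "T j (d n) y - y"]
      have "norm (T i (d n) (approx x0 m n a) - T j (d n) y) \<le>
          norm (T i (d n) (approx x0 m n a) - T i (d n) y) + norm (T i (d n) y - y) + norm (T j (d n) y - y)"
        by simp
      also have "norm (T i (d n) (approx x0 m n a) - T i (d n) y) \<le> K * norm (approx x0 m n a - y)"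
        unfolding K_def using dn a by (intro norm_T_diff[OF i]) auto
      finally show "norm (T i (d n) (approx x0 m n a) - T j (d n) y) \<le> K * norm (approx x0 m n a - y) + 2 * \<omega> (d n)"
        using \<omega>[OF i, of "d n"] \<omega>[OF j, of "d n"] by linarith
    qed
    finally show ?case .
  qed
  then have "(\<lambda>n. approx x0 m n t - T j (t - a) y) \<longlonglongrightarrow> 0"
    by (rule Lim_null_comparison[OF _ null])
  then show ?thesis by (rule LIM_zero_cancel)
qed

section \<open>The limit evolution: existence and uniqueness along a path\<close>

context
  assumes step: "step_path m"
begin

text \<open>By \<open>approx_tendsto\<close> convergence spreads from the left end of a piece of
  constant mode over the piece and to its right end; these are the two steps of real
  induction.\<close>

lemma evolution_LIMSEQ:
  assumes "0 \<le> t"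
  shows "(\<lambda>n. approx x0 m n t) \<longlonglongrightarrow> evolution x0 m t"
proof -
  have "convergent (\<lambda>n. approx x0 m n t)"
    using assms
  proof (induction t rule: real_induct[rotated 3, consumes 1, case_names base right left])
    case base
    then show ?case by (simp add: approx_zero convergent_const)
  next
    case (right t)
    obtain b where b: "t < b" "\<And>s. t \<le> s \<Longrightarrow> s < b \<Longrightarrow> m s = m t"
      using step_path_rightE[OF step right(1)] by blast
    obtain y where y: "(\<lambda>n. approx x0 m n t) \<longlonglongrightarrow> y" using right(2)[of t] right(1) by (auto simp: convergent_def)
    show ?case
      by (intro exI[of _ b] conjI ballI b(1) convergentI, rule approx_tendsto[OF right(1) _ _ b y]) auto
  next
    case (left t)
    obtain a where a: "0 \<le> a" "a < t" "\<And>s. a \<le> s \<Longrightarrow> s < t \<Longrightarrow> m s = m a"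
      using step_path_leftE[OF step left(1)] by blast
    obtain y where y: "(\<lambda>n. approx x0 m n a) \<longlonglongrightarrow> y" using left(2)[of a] a by (auto simp: convergent_def)
    show ?case
      by (rule convergentI, rule approx_tendsto[OF a(1) _ _ a(2,3) y]) (use a(2) in auto)
  qed
  then show ?thesis unfolding evolution_def by (simp add: convergent_LIMSEQ_iff)
qed

lemma evolution_zero: "evolution x0 m 0 = x0"
  using evolution_LIMSEQ[of 0] by (simp add: approx_zero LIMSEQ_const_iff)

lemma evolution_constant_mode:
  assumes "0 \<le> a" "a \<le> t" "t \<le> b" "a < b" "\<And>s. a \<le> s \<Longrightarrow> s < b \<Longrightarrow> m s = m a"
  shows "evolution x0 m t = T (m a) (t - a) (evolution x0 m a)"
  by (rule LIMSEQ_unique[OF evolution_LIMSEQ approx_tendsto[OF assms evolution_LIMSEQ]])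
     (use assms(1-4) in auto)

lemma isCont_evolution:
  assumes t: "0 < t"
  shows "isCont (evolution x0 m) t"
proof -
  obtain a where a: "0 \<le> a" "a < t" "\<And>s. a \<le> s \<Longrightarrow> s < t \<Longrightarrow> m s = m a"
    using step_path_leftE[OF step t] by blast
  obtain b where b: "t < b" "\<And>s. t \<le> s \<Longrightarrow> s < b \<Longrightarrow> m s = m t"
    using step_path_rightE[OF step less_imp_le[OF t]] by blast
  let ?X = "evolution x0 m"
  define y where "y = ?X a"
  have j: "m a \<in> R" "m t \<in> R" using m_R a(1) t by auto
  have L: "?X s = T (m a) (s - a) y" if "a \<le> s" "s \<le> t" for s
    unfolding y_def by (rule evolution_constant_mode[OF a(1) that a(2,3)])
  have Rt: "?X s = T (m t) (s - t) (?X t)" if "t \<le> s" "s < b" for s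
    by (rule evolution_constant_mode[OF less_imp_le[OF t] that(1) less_imp_le[OF that(2)] b])
  have "(?X \<longlongrightarrow> ?X t) (at_left t)"
  proof (rule LIM_zero_cancel, rule Lim_null_comparison)
    have "filterlim (\<lambda>s. t - s) (at_right 0) (at_left t)"
      unfolding filterlim_at
    proof
      show "\<forall>\<^sub>F s in at_left t. t - s \<in> {0<..} \<and> t - s \<noteq> 0"
        by (rule eventually_at_leftI[of "t - 1"]) auto
      have "((\<lambda>s. t - s) \<longlongrightarrow> t - t) (at_left t)" by (intro tendsto_intros)
      then show "((\<lambda>s. t - s) \<longlongrightarrow> 0) (at_left t)" by simp
    qed
    then have "((\<lambda>s. T (m a) (t - s) y) \<longlongrightarrow> y) (at_left t)"
      by (rule filterlim_compose[OF T_lim[OF j(1)]])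
    then have "((\<lambda>s. norm (y - T (m a) (t - s) y)) \<longlongrightarrow> norm (y - y)) (at_left t)"
      by (intro tendsto_intros)
    then show "((\<lambda>s. exp (w * t) * \<bar>C\<bar> * norm (y - T (m a) (t - s) y)) \<longlongrightarrow> 0) (at_left t)"
      by (intro tendsto_mult_right_zero) simp
    show "\<forall>\<^sub>F s in at_left t. norm (?X s - ?X t) \<le> exp (w * t) * \<bar>C\<bar> * norm (y - T (m a) (t - s) y)"
    proof (rule eventually_at_leftI[OF _ a(2)])
      fix s assume s: "s \<in> {a<..<t}"
      \<comment> \<open>The values at s and t share the factor T (s - a), so left continuity reduces
        to strong continuity at time 0.\<close>
      have "T (m a) (t - a) y = T (m a) (s - a) (T (m a) (t - s) y)"
        using T_add[OF j(1), of "s - a" "t - s" y] s by simp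
      then show "norm (?X s - ?X t) \<le> exp (w * t) * \<bar>C\<bar> * norm (y - T (m a) (t - s) y)"
        using L[of s] L[of t] s a(1,2) by (simp add: norm_T_diff[OF j(1)])
    qed
  qed
  moreover have "(?X \<longlongrightarrow> ?X t) (at_right t)"
  proof -
    have "filterlim (\<lambda>s. s - t) (at_right 0) (at_right t)"
      unfolding filterlim_at
    proof
      show "\<forall>\<^sub>F s in at_right t. s - t \<in> {0<..} \<and> s - t \<noteq> 0"
        by (rule eventually_at_rightI[of t "t + 1"]) auto
      have "((\<lambda>s. s - t) \<longlongrightarrow> t - t) (at_right t)" by (intro tendsto_intros)
      then show "((\<lambda>s. s - t) \<longlongrightarrow> 0) (at_right t)" by simp
    qed
    then have "((\<lambda>s. T (m t) (s - t) (?X t)) \<longlongrightarrow> ?X t) (at_right t)"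
      by (rule filterlim_compose[OF T_lim[OF j(2)]])
    moreover have "\<forall>\<^sub>F s in at_right t. T (m t) (s - t) (?X t) = ?X s"
      by (rule eventually_at_rightI[OF _ b(1)], rule Rt[symmetric]) auto
    ultimately show ?thesis by (rule Lim_transform_eventually)
  qed
  ultimately show ?thesis
    unfolding isCont_def by (rule filterlim_split_at)
qed

lemma path_solution_evolution:
  assumes gen: "\<And>j. j \<in> R \<Longrightarrow> generator (T j) = A j"
  shows "path_solution A m x0 (evolution x0 m)"
  unfolding path_solution_def
proof (intro conjI allI impI)
  show "evolution x0 m 0 = x0" by (rule evolution_zero)
  show "isCont (evolution x0 m) t" if "jump_time m t" for t
    using that isCont_evolution by (simp add: jump_time_def)
  fix a b assume ab: "(a = 0 \<or> jump_time m a) \<and> a < b \<and> (\<forall>s\<in>{a<..<b}. \<not> jump_time m s)"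
  then have a: "0 \<le> a" by (auto simp: jump_time_def)
  show "\<exists>S. C0_semigroup S \<and> generator S = A (m a) \<and>
      (\<forall>t\<in>{a..<b}. evolution x0 m t = S (t - a) (evolution x0 m a))"
  proof (intro exI[of _ "T (m a)"] conjI ballI)
    show "C0_semigroup (T (m a))" "generator (T (m a)) = A (m a)" using m_R[OF a] semigroup gen by auto
    have nj: "\<forall>s\<in>{a<..<b}. \<not> jump_time m s" and lt: "a < b" using ab by blast+
    fix t assume "t \<in> {a..<b}"
    then have t: "a \<le> t" "t \<le> b" by auto
    show "evolution x0 m t = T (m a) (t - a) (evolution x0 m a)"
      by (rule evolution_constant_mode[OF a t lt no_jump_constant[OF step a nj]])
  qed
qed

text \<open>\<open>uniq\<close> identifies whatever semigroup y uses. At a jump the value is forced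
  by continuity from the left; any other time lies inside an interval that begins at 0 or at the
  last jump and reaches beyond it.\<close>

lemma path_solution_unique:
  assumes uniq: "\<And>j S t x. j \<in> R \<Longrightarrow> C0_semigroup S \<Longrightarrow> generator S = A j \<Longrightarrow> 0 \<le> t \<Longrightarrow> S t x = T j t x"
    and y: "path_solution A m x0 y" and "0 \<le> t"
  shows "y t = evolution x0 m t"
proof -
  let ?X = "evolution x0 m"
  have y0: "y 0 = x0" and ycont: "\<And>t. jump_time m t \<Longrightarrow> isCont y t"
    and ysemi: "\<And>a b. a = 0 \<or> jump_time m a \<Longrightarrow> a < b \<Longrightarrow> \<forall>s\<in>{a<..<b}. \<not> jump_time m s \<Longrightarrow>
        \<exists>S. C0_semigroup S \<and> generator S = A (m a) \<and> (\<forall>t\<in>{a..<b}. y t = S (t - a) (y a))"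
    using y unfolding path_solution_def by blast+
  have eq: "y s = ?X s"
    if a: "0 \<le> a" "a = 0 \<or> jump_time m a" "a < b" "\<forall>s\<in>{a<..<b}. \<not> jump_time m s"
      and ya: "y a = ?X a" and s: "a \<le> s" "s < b" for a b s
  proof -
    obtain S where S: "C0_semigroup S" "generator S = A (m a)" "\<forall>t\<in>{a..<b}. y t = S (t - a) (y a)"
      using ysemi[OF a(2-4)] by blast
    have "y s = S (s - a) (y a)" by (rule bspec[OF S(3)]) (use s in simp)
    also have "\<dots> = T (m a) (s - a) (?X a)"
      unfolding ya by (rule uniq[OF m_R[OF a(1)] S(1,2)]) (use s in simp)
    also have "\<dots> = ?X s"
      by (rule evolution_constant_mode[OF a(1) s(1) less_imp_le[OF s(2)] a(3) no_jump_constant[OF step a(1,4)], symmetric])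
    finally show ?thesis .
  qed
  show ?thesis
    using \<open>0 \<le> t\<close>
  proof (induction t rule: real_induct[rotated 3, consumes 1, case_names base right left])
    case base
    then show ?case by (simp add: y0 evolution_zero)
  next
    case (right t)
    obtain b where b: "t < b" "\<And>s. t \<le> s \<Longrightarrow> s < b \<Longrightarrow> m s = m t"
      using step_path_rightE[OF step right(1)] by blast
    obtain a where a: "0 \<le> a" "a \<le> t" "a = 0 \<or> jump_time m a" "\<forall>s. a < s \<and> s \<le> t \<longrightarrow> \<not> jump_time m s"
      using last_jump[OF step right(1)] by blast
    have "\<forall>s\<in>{a<..<b}. \<not> jump_time m s"
    proof
      fix s assume s: "s \<in> {a<..<b}"
      show "\<not> jump_time m s"
      proof (cases "s \<le> t")
        case False
        then show ?thesis using s by (intro constant_not_jump[OF b(2)]) auto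
      qed (use a(4) s in auto)
    qed
    then have "y s = ?X s" if "s \<in> {t..<b}" for s
      using that a(2) b(1) by (intro eq[OF a(1,3) _ _ right(2)[OF a(1,2)]]) auto
    then show ?case using b(1) by blast
  next
    case (left t)
    show ?case
    proof (cases "jump_time m t")
      case True
      have "(y \<longlongrightarrow> y t) (at_left t)" "(?X \<longlongrightarrow> ?X t) (at_left t)"
        using ycont[OF True] isCont_evolution[OF left(1)] unfolding isCont_def
        by (auto intro: tendsto_within_subset)
      moreover have "\<forall>\<^sub>F s in at_left t. y s = ?X s"
        by (rule eventually_at_leftI[OF _ left(1)]) (use left(2) in auto)
      ultimately have "(?X \<longlongrightarrow> y t) (at_left t)" using Lim_transform_eventually by blast
      then show ?thesis
        using tendsto_unique[OF trivial_limit_at_left_real _ \<open>(?X \<longlongrightarrow> ?X t) (at_left t)\<close>] by blast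
    next
      case False
      obtain b where b: "t < b" "\<And>s. t \<le> s \<Longrightarrow> s < b \<Longrightarrow> m s = m t"
        using step_path_rightE[OF step less_imp_le[OF left(1)]] by blast
      obtain a where a: "0 \<le> a" "a \<le> t" "a = 0 \<or> jump_time m a" "\<forall>s. a < s \<and> s \<le> t \<longrightarrow> \<not> jump_time m s"
        using last_jump[OF step less_imp_le[OF left(1)]] by blast
      have "a < t" using a False left(1) by (cases "a = t") auto
      have "\<forall>s\<in>{a<..<b}. \<not> jump_time m s"
      proof
        fix s assume s: "s \<in> {a<..<b}"
        show "\<not> jump_time m s"
        proof (cases "s \<le> t")
          case False
          then show ?thesis using s by (intro constant_not_jump[OF b(2)]) auto
        qed (use a(4) s in auto)
      qed
      then show ?thesis
        using a(2) b(1) by (intro eq[OF a(1,3) _ _ left(2)[OF a(1) \<open>a < t\<close>]]) auto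
    qed
  qed
qed

end

end

section \<open>Measurability of the approximations\<close>

text \<open>Finitely many countably-valued modes determine the state, so the discrete sigma-algebra
  works as target and any later map, such as the norm, composes freely.\<close>

lemma measurable_grid_state:
  assumes "\<And>t. 0 \<le> t \<Longrightarrow> \<theta> t \<in> measurable M (count_space UNIV)"
  shows "(\<lambda>\<omega>. grid_state x0 (\<lambda>t. \<theta> t \<omega>) n k) \<in> measurable M (count_space UNIV)"
proof (induction k)
  case (Suc k)
  have "(\<lambda>\<omega>. T i (1 / 2^n) (grid_state x0 (\<lambda>t. \<theta> t \<omega>) n k)) \<in> measurable M (count_space UNIV)" for i
    by (rule measurable_compose[OF Suc]) simp
  then have "(\<lambda>\<omega>. T (\<theta> (real k / 2^n) \<omega>) (1 / 2^n) (grid_state x0 (\<lambda>t. \<theta> t \<omega>) n k)) \<in> measurable M (count_space UNIV)"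
    by (rule measurable_compose_countable) (rule assms, simp)
  then show ?case by simp
qed simp

lemma measurable_approx:
  assumes "\<And>t. 0 \<le> t \<Longrightarrow> \<theta> t \<in> measurable M (count_space UNIV)"
  shows "(\<lambda>\<omega>. approx x0 (\<lambda>t. \<theta> t \<omega>) n t) \<in> measurable M (count_space UNIV)"
proof -
  define k where "k = nat \<lfloor>t * 2^n\<rfloor>"
  have "(\<lambda>\<omega>. T i (t - real k / 2^n) (grid_state x0 (\<lambda>t. \<theta> t \<omega>) n k)) \<in> measurable M (count_space UNIV)" for i
    by (rule measurable_compose[OF measurable_grid_state[OF assms]]) simp_all
  then have "(\<lambda>\<omega>. T (\<theta> (real k / 2^n) \<omega>) (t - real k / 2^n) (grid_state x0 (\<lambda>t. \<theta> t \<omega>) n k)) \<in> measurable M (count_space UNIV)"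
    by (rule measurable_compose_countable) (rule assms, simp)
  then show ?thesis by (simp add: approx_def Let_def k_def)
qed

end

subsection \<open>Non-explosion of the mode process\<close>

text \<open>Mean value theorem for the forward equation: the inflow into i is nonnegative, and P i i
  \<le> 1 bounds the outflow by \<tau>s.\<close>

lemma stay_probability:
  assumes P: "transition_probabilities r \<tau> P"
    and nonneg: "\<And>i j t. i \<in> {1..r} \<Longrightarrow> j \<in> {1..r} \<Longrightarrow> t \<ge> 0 \<Longrightarrow> \<tau> i j t \<ge> 0"
    and bound: "\<And>i t. i \<in> {1..r} \<Longrightarrow> t \<ge> 0 \<Longrightarrow> (\<Sum>l\<in>{1..r} - {i}. \<tau> i l t) \<le> \<tau>s"
    and i: "i \<in> {1..r}" and st: "0 \<le> s" "s \<le> t"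
  shows "1 - \<tau>s * (t - s) \<le> P i i s t"
proof (cases "s = t")
  case True
  then show ?thesis using P i st by (simp add: transition_probabilities_def)
next
  case False
  with st have lt: "s < t" by simp
  have P0: "0 \<le> P i j s u" and P1: "(\<Sum>j\<in>{1..r}. P i j s u) = 1" if "s \<le> u" "j \<in> {1..r}" for u j
    using P i st that unfolding transition_probabilities_def by blast+
  define f' where "f' u = (\<Sum>k\<in>{1..r} - {i}. P i k s u * \<tau> k i u) - P i i s u * (\<Sum>l\<in>{1..r} - {i}. \<tau> i l u)" for u
  have der: "((\<lambda>u. P i i s u) has_real_derivative f' u) (at u within {s..t})" if "s \<le> u" for u
  proof (rule DERIV_subset)
    show "((\<lambda>u. P i i s u) has_real_derivative f' u) (at u within {s..})"
      unfolding f'_def using P i st that unfolding transition_probabilities_def by blast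
  qed auto
  have "\<exists>u\<in>{s<..<t}. P i i s t - P i i s s = (*) (f' u) (t - s)"
    by (rule mvt_simple[OF lt]) (use der in \<open>auto simp: has_field_derivative_def\<close>)
  then obtain u where u: "s < u" "u < t" "P i i s t - P i i s s = f' u * (t - s)" by auto
  have "- \<tau>s \<le> f' u"
  proof -
    have su: "s \<le> u" "0 \<le> u" using u st by auto
    have "P i i s u \<le> (\<Sum>j\<in>{1..r}. P i j s u)"
      using P0[OF su(1)] i by (intro member_le_sum) auto
    then have le1: "P i i s u \<le> 1" using P1[OF su(1) i] by simp
    have "0 \<le> (\<Sum>k\<in>{1..r} - {i}. P i k s u * \<tau> k i u)"
      using P0[OF su(1)] nonneg i su by (intro sum_nonneg mult_nonneg_nonneg) auto
    moreover have "P i i s u * (\<Sum>l\<in>{1..r} - {i}. \<tau> i l u) \<le> 1 * (\<Sum>l\<in>{1..r} - {i}. \<tau> i l u)"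
      using le1 nonneg i su by (intro mult_right_mono sum_nonneg) auto
    ultimately show ?thesis using bound[OF i su(2)] unfolding f'_def by linarith
  qed
  then have "- \<tau>s * (t - s) \<le> f' u * (t - s)" using lt by (intro mult_right_mono) auto
  moreover have "P i i s s = 1" using P i st by (simp add: transition_probabilities_def)
  ultimately show ?thesis using u(3) by (simp add: algebra_simps)
qed

text \<open>Conditioning on the past at s, the probability of equal modes at s and t is the sum of P
  j j s t weighted by the law of the mode at s, hence at least 1 - e.\<close>

lemma change_probability:
  assumes M: "prob_space M" and \<theta>: "markov_process M r P \<theta>" and st: "0 \<le> s" "s \<le> t"
    and stay: "\<And>i. i \<in> {1..r} \<Longrightarrow> 1 - e \<le> P i i s t"
  shows "measure M {\<omega>\<in>space M. \<theta> s \<omega> \<noteq> \<theta> t \<omega>} \<le> e"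
proof -
  interpret prob_space M by fact
  have m [measurable]: "\<theta> u \<in> measurable M (count_space UNIV)" if "0 \<le> u" for u
    using \<theta> that by (simp add: markov_process_def)
  have t0: "0 \<le> t" using st by simp
  have range: "\<theta> u \<omega> \<in> {1..r}" if "0 \<le> u" "\<omega> \<in> space M" for u \<omega>
    using \<theta> that by (simp add: markov_process_def)
  define S where "S u j = {\<omega>\<in>space M. \<theta> u \<omega> = j}" for u j
  have S_eq: "S u j = \<theta> u -` {j} \<inter> space M" for u j by (auto simp: S_def)
  have S [measurable]: "S u j \<in> sets M" if "0 \<le> u" for u j
    unfolding S_eq by (rule measurable_sets[OF m[OF that]]) simp
  let ?F = "past M \<theta> s"
  have gen: "(\<Union>u\<in>{0..s}. {\<theta> u -` B \<inter> space M | B. True}) \<subseteq> sets M"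
    using measurable_sets[OF m] by fastforce
  have pow: "(\<Union>u\<in>{0..s}. {\<theta> u -` B \<inter> space M | B. True}) \<subseteq> Pow (space M)" by auto
  have "subalgebra M ?F"
    unfolding subalgebra_def past_def sets_measure_of[OF pow] space_measure_of[OF pow]
    using sets.sigma_sets_subset[OF gen] by simp
  then interpret sub: finite_measure_subalgebra M ?F
    by unfold_locales
  have SF: "S s j \<in> sets ?F" for j
    unfolding past_def S_eq
    by (rule in_measure_of[OF pow], rule UN_I[of s]) (use st in auto)
  have joint: "(LINT \<omega>|M. indicator (S s j) \<omega> * indicator (S t j) \<omega>) = P j j s t * measure M (S s j)"
    if j: "j \<in> {1..r}" for j
  proof -
    have int: "integrable M (\<lambda>\<omega>. indicator (S s j) \<omega> * (indicator (S t j) \<omega> :: real))"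
      using S st by (intro integrable_real_mult_indicator integrable_real_indicator) (auto simp: emeasure_eq_measure)
    have "(LINT \<omega>|M. indicator (S s j) \<omega> * indicator (S t j) \<omega>) =
        (LINT \<omega>|M. indicator (S s j) \<omega> * real_cond_exp M ?F (indicator (S t j)) \<omega>)"
      by (rule sub.real_cond_exp_intg(2)[symmetric, OF int]) (use SF S st in auto)
    also have "\<dots> = (LINT \<omega>|M. indicator (S s j) \<omega> * P j j s t)"
    proof (rule integral_cong_AE)
      have "AE \<omega> in M. real_cond_exp M ?F (indicator (S t j)) \<omega> = P (\<theta> s \<omega>) j s t"
        using \<theta> st j unfolding markov_process_def S_def by blast
      then show "AE \<omega> in M. indicator (S s j) \<omega> * real_cond_exp M ?F (indicator (S t j)) \<omega> = indicator (S s j) \<omega> * P j j s t"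
        by eventually_elim (auto simp: indicator_def S_def)
    qed (use S st in \<open>auto intro!: borel_measurable_times borel_measurable_indicator borel_measurable_cond_exp2\<close>)
    also have "\<dots> = P j j s t * measure M (S s j)" using S st by simp
    finally show ?thesis .
  qed
  have one: "(\<Sum>j\<in>{1..r}. measure M (S s j)) = 1"
  proof -
    have "(\<Sum>j\<in>{1..r}. measure M (S s j)) = measure M (\<Union>j\<in>{1..r}. S s j)"
      using S st by (intro finite_measure_finite_Union[symmetric]) (auto simp: disjoint_family_on_def S_def)
    also have "(\<Union>j\<in>{1..r}. S s j) = space M" using range st by (auto simp: S_def)
    finally show ?thesis by (simp add: prob_space)
  qed
  let ?E = "{\<omega>\<in>space M. \<theta> s \<omega> = \<theta> t \<omega>}"
  have E: "?E = (\<Union>j\<in>{1..r}. S s j \<inter> S t j)" using range st t0 by (auto simp: S_def)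
  have "1 - e = (\<Sum>j\<in>{1..r}. (1 - e) * measure M (S s j))"
    unfolding sum_distrib_left[symmetric] one by simp
  also have "\<dots> \<le> (\<Sum>j\<in>{1..r}. P j j s t * measure M (S s j))"
    by (intro sum_mono mult_right_mono stay) auto
  also have "\<dots> = (\<Sum>j\<in>{1..r}. measure M (S s j \<inter> S t j))"
  proof (rule sum.cong[OF refl])
    fix j assume "j \<in> {1..r}"
    then have "P j j s t * measure M (S s j) = (LINT \<omega>|M. indicator (S s j \<inter> S t j) \<omega>)"
      unfolding indicator_inter_arith by (rule joint[symmetric])
    then show "P j j s t * measure M (S s j) = measure M (S s j \<inter> S t j)"
      using S st t0 by simp
  qed
  also have "\<dots> = measure M ?E"
    unfolding E using S st t0
    by (intro finite_measure_finite_Union[symmetric]) (auto simp: disjoint_family_on_def S_def)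
  finally have "1 - e \<le> measure M ?E" .
  moreover have "?E \<in> sets M" unfolding E using S st t0 by auto
  moreover have "{\<omega>\<in>space M. \<theta> s \<omega> \<noteq> \<theta> t \<omega>} = space M - ?E" by auto
  ultimately show ?thesis by (simp add: prob_compl)
qed

section \<open>Counting mode changes on dyadic grids\<close>

text \<open>Only cells lying entirely in [a, b] are counted, which makes the count superadditive
  when the interval is split.\<close>

definition dyadic_changes :: "(real \<Rightarrow> nat) \<Rightarrow> nat \<Rightarrow> real \<Rightarrow> real \<Rightarrow> nat set" where
  "dyadic_changes m n a b =
     {i. a \<le> real i / 2^n \<and> real (Suc i) / 2^n \<le> b \<and> m (real i / 2^n) \<noteq> m (real (Suc i) / 2^n)}"

lemma finite_dyadic_changes: "finite (dyadic_changes m n a b)"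
proof (rule finite_subset)
  show "dyadic_changes m n a b \<subseteq> {..nat \<lceil>b * 2^n\<rceil>}"
  proof
    fix i assume "i \<in> dyadic_changes m n a b"
    then have "real (Suc i) \<le> b * 2^n" by (simp add: dyadic_changes_def divide_le_eq)
    then show "i \<in> {..nat \<lceil>b * 2^n\<rceil>}" by simp linarith
  qed
qed simp

lemma dyadic_changes_split:
  assumes "a \<le> c" "c \<le> b"
  shows "card (dyadic_changes m n a c) + card (dyadic_changes m n c b) \<le> card (dyadic_changes m n a b)"
proof -
  have lt: "real i / 2^n < real (Suc i) / 2^n" for i by (simp add: divide_strict_right_mono)
  have "card (dyadic_changes m n a c) + card (dyadic_changes m n c b) =
      card (dyadic_changes m n a c \<union> dyadic_changes m n c b)"
  proof (rule card_Un_disjoint[symmetric, OF finite_dyadic_changes finite_dyadic_changes])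
    show "dyadic_changes m n a c \<inter> dyadic_changes m n c b = {}"
    proof (rule equals0I)
      fix i assume "i \<in> dyadic_changes m n a c \<inter> dyadic_changes m n c b"
      then have "real (Suc i) / 2^n \<le> c" "c \<le> real i / 2^n" by (auto simp: dyadic_changes_def)
      with lt[of i] show False by linarith
    qed
  qed
  also have "\<dots> \<le> card (dyadic_changes m n a b)"
  proof (rule card_mono[OF finite_dyadic_changes], rule Un_least; rule subsetI)
    fix i assume "i \<in> dyadic_changes m n a c"
    then show "i \<in> dyadic_changes m n a b" using assms unfolding dyadic_changes_def by force
  next
    fix i assume "i \<in> dyadic_changes m n c b"
    then show "i \<in> dyadic_changes m n a b" using assms unfolding dyadic_changes_def by force
  qed
  finally show ?thesis .
qed

lemma exists_change:
  fixes f :: "nat \<Rightarrow> 'a"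
  assumes "i \<le> k" "f i \<noteq> f k"
  shows "\<exists>l\<ge>i. l < k \<and> f l \<noteq> f (Suc l)"
  using assms
proof (induction k rule: dec_induct)
  case (step k)
  then show ?case by (cases "f i = f k") (auto intro: less_SucI)
qed simp

lemma dyadic_point:
  assumes "0 \<le> s" "1 / 2^n < b - (s::real)"
  obtains i where "s \<le> real i / 2^n" "real i / 2^n < b"
proof (rule that[of "nat \<lceil>s * 2^n\<rceil>"])
  have "0 \<le> s * 2^n" using assms by simp
  then have 1: "s * 2^n \<le> real (nat \<lceil>s * 2^n\<rceil>)" "real (nat \<lceil>s * 2^n\<rceil>) < s * 2^n + 1" by linarith+
  show "s \<le> real (nat \<lceil>s * 2^n\<rceil>) / 2^n" using 1(1) by (simp add: le_divide_eq)
  have "real (nat \<lceil>s * 2^n\<rceil>) / 2^n < (s * 2^n + 1) / 2^n" using 1(2) by (simp add: divide_strict_right_mono)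
  also have "\<dots> = s + 1 / 2^n" by (simp add: add_divide_distrib)
  finally show "real (nat \<lceil>s * 2^n\<rceil>) / 2^n < b" using assms(2) by linarith
qed

text \<open>Near t the mode keeps leaving its value. Right-constancy makes the values at a and at s
  visible to fine grids, so one change is counted up to c2, and the argument restarts there.\<close>

lemma dyadic_changes_unbounded:
  assumes right: "\<And>s. 0 \<le> s \<Longrightarrow> \<exists>b>s. \<forall>u\<in>{s..<b}. m u = m s"
    and bad: "\<And>a. 0 \<le> a \<Longrightarrow> a < t \<Longrightarrow> \<exists>s\<in>{a..<t}. m s \<noteq> m a"
    and a: "0 \<le> a" "a < t"
  shows "eventually (\<lambda>n. k \<le> card (dyadic_changes m n a t)) sequentially"
  using a
proof (induction k arbitrary: a)
  case (Suc k)
  obtain s where s: "a \<le> s" "s < t" "m s \<noteq> m a" using bad[OF Suc.prems] by auto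
  then have as: "a < s" by (cases "a = s") auto
  obtain b1 where b1: "a < b1" "\<forall>u\<in>{a..<b1}. m u = m a" using right[OF Suc.prems(1)] by blast
  have s0: "0 \<le> s" using s Suc.prems by simp
  obtain b2 where b2: "s < b2" "\<forall>u\<in>{s..<b2}. m u = m s" using right[OF s0] by blast
  define c1 where "c1 = min b1 s"
  \<comment> \<open>The midpoint leaves room before t for the induction; b2 keeps the mode equal to
    m s up to c2.\<close>
  define c2 where "c2 = min b2 ((s + t) / 2)"
  have c: "a < c1" "c1 \<le> s" "s < c2" "c2 < t" using b1(1) b2(1) as s(2) by (simp_all add: c1_def c2_def min_less_iff_disj)
  have half: "(\<lambda>n. 1 / 2^n :: real) \<longlonglongrightarrow> 0"
    using LIMSEQ_power_zero[of "1/2::real"] by (simp add: power_divide)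
  have ev: "eventually (\<lambda>n. 1 / 2^n < c1 - a) sequentially" "eventually (\<lambda>n. 1 / 2^n < c2 - s) sequentially"
    using c by (intro order_tendstoD(2)[OF half]; simp)+
  have "eventually (\<lambda>n. k \<le> card (dyadic_changes m n c2 t)) sequentially"
    using c s0 by (intro Suc.IH) auto
  with ev show ?case
  proof eventually_elim
    case (elim n)
    obtain i1 where i1: "a \<le> real i1 / 2^n" "real i1 / 2^n < c1"
      by (rule dyadic_point[OF Suc.prems(1) elim(1)])
    obtain i2 where i2: "s \<le> real i2 / 2^n" "real i2 / 2^n < c2"
      by (rule dyadic_point[OF s0 elim(2)])
    have "real i1 / 2^n < real i2 / 2^n" using i1 i2 c by linarith
    then have "i1 \<le> i2" by (simp add: divide_less_cancel)
    moreover have "real i1 / 2^n \<in> {a..<b1}" "real i2 / 2^n \<in> {s..<b2}"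
      using i1 i2 by (simp_all add: c1_def c2_def)
    then have "m (real i1 / 2^n) = m a" "m (real i2 / 2^n) = m s" using b1(2) b2(2) by blast+
    ultimately obtain l where l: "i1 \<le> l" "l < i2" "m (real l / 2^n) \<noteq> m (real (Suc l) / 2^n)"
      using exists_change[of i1 i2 "\<lambda>i. m (real i / 2^n)"] s(3) by auto
    have "real i1 / 2^n \<le> real l / 2^n" "real (Suc l) / 2^n \<le> real i2 / 2^n"
      using l by (intro divide_right_mono; simp)+
    then have "l \<in> dyadic_changes m n a c2"
      using l(3) i1 i2 unfolding dyadic_changes_def by simp
    then have "1 \<le> card (dyadic_changes m n a c2)"
      using finite_dyadic_changes by (metis One_nat_def Suc_leI card_gt_0_iff empty_iff)
    then show ?case
      using dyadic_changes_split[of a c2 t m n] elim(3) c by simp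
  qed
qed simp

text \<open>Fatou's lemma turns the bound K c on the expected counts over [0, K] into an almost
  surely finite liminf. A time t \<le> K without left-constancy would make it infinite; one null set
  serves all integers K, hence all t.\<close>

lemma AE_left_constant:
  assumes M: "prob_space M" and \<theta>: "markov_process M r P \<theta>"
    and right: "\<And>\<omega> s. \<omega> \<in> space M \<Longrightarrow> 0 \<le> s \<Longrightarrow> \<exists>b>s. \<forall>u\<in>{s..<b}. \<theta> u \<omega> = \<theta> s \<omega>"
    and change: "\<And>s t. 0 \<le> s \<Longrightarrow> s \<le> t \<Longrightarrow> measure M {\<omega>\<in>space M. \<theta> s \<omega> \<noteq> \<theta> t \<omega>} \<le> c * (t - s)"
    and c: "0 \<le> c"
  shows "AE \<omega> in M. \<forall>t>0. \<exists>a j. 0 \<le> a \<and> a < t \<and> (\<forall>s\<in>{a..<t}. \<theta> s \<omega> = j)"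
proof -
  interpret prob_space M by fact
  have m: "\<theta> u \<in> measurable M (count_space UNIV)" if "0 \<le> u" for u
    using \<theta> that by (simp add: markov_process_def)
  have Cm: "{\<omega>\<in>space M. \<theta> s \<omega> \<noteq> \<theta> t \<omega>} \<in> sets M" if "0 \<le> s" "0 \<le> t" for s t
  proof -
    have "(\<lambda>\<omega>. i \<noteq> \<theta> t \<omega>) \<in> measurable M (count_space UNIV)" for i
      by (rule measurable_compose[OF m[OF that(2)]]) simp
    then have "(\<lambda>\<omega>. \<theta> s \<omega> \<noteq> \<theta> t \<omega>) \<in> measurable M (count_space UNIV)"
      by (rule measurable_compose_countable[OF _ m[OF that(1)]])
    then show ?thesis by (rule predE)
  qed
  have fin: "AE \<omega> in M. liminf (\<lambda>n. of_nat (card (dyadic_changes (\<lambda>t. \<theta> t \<omega>) n 0 (real K)))) \<noteq> (\<infinity> :: ennreal)" for K :: nat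
  proof -
    define B where "B n i = {\<omega>\<in>space M. \<theta> (real i / 2^n) \<omega> \<noteq> \<theta> (real (Suc i) / 2^n) \<omega>}" for n i :: nat
    have B: "B n i \<in> sets M" for n i unfolding B_def by (rule Cm) auto
    have card_eq: "of_nat (card (dyadic_changes (\<lambda>t. \<theta> t \<omega>) n 0 (real K))) = (\<Sum>i<K * 2^n. indicator (B n i) \<omega> :: ennreal)"
      if "\<omega> \<in> space M" for \<omega> n
    proof -
      have "dyadic_changes (\<lambda>t. \<theta> t \<omega>) n 0 (real K) = {i\<in>{..<K * 2^n}. \<omega> \<in> B n i}"
      proof -
        have "real (Suc i) / 2^n \<le> real K \<longleftrightarrow> i < K * 2^n" for i
        proof -
          have "real (Suc i) / 2^n \<le> real K \<longleftrightarrow> real (Suc i) \<le> real (K * 2^n)" by (simp add: divide_le_eq)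
          also have "\<dots> \<longleftrightarrow> i < K * 2^n" by (simp only: of_nat_le_iff Suc_le_eq)
          finally show ?thesis .
        qed
        then show ?thesis using that by (auto simp: dyadic_changes_def B_def simp del: of_nat_Suc)
      qed
      then show ?thesis by (simp add: indicator_def sum.If_cases Int_def flip: of_nat_sum)
    qed
    have meas: "(\<lambda>\<omega>. \<Sum>i<K * 2^n. indicator (B n i) \<omega> :: ennreal) \<in> borel_measurable M" for n
      using B by simp
    have "(\<integral>\<^sup>+\<omega>. (\<Sum>i<K * 2^n. indicator (B n i) \<omega>) \<partial>M) \<le> ennreal (real K * c)" for n
    proof -
      have "(\<integral>\<^sup>+\<omega>. (\<Sum>i<K * 2^n. indicator (B n i) \<omega>) \<partial>M) = (\<Sum>i<K * 2^n. emeasure M (B n i))"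
        using B by (simp add: nn_integral_sum)
      also have "\<dots> \<le> (\<Sum>i<K * 2^n. ennreal (c / 2^n))"
      proof (rule sum_mono)
        fix i
        have "measure M (B n i) \<le> c * (real (Suc i) / 2^n - real i / 2^n)"
          unfolding B_def by (rule change) (auto simp: divide_right_mono)
        also have "real (Suc i) / 2^n - real i / 2^n = 1 / (2::real)^n" by (simp add: add_divide_distrib)
        finally show "emeasure M (B n i) \<le> ennreal (c / 2^n)" by (simp add: emeasure_eq_measure ennreal_leI)
      qed
      also have "\<dots> = ennreal (real K * c)"
        using c by (simp add: ennreal_of_nat_eq_real_of_nat ennreal_mult[symmetric])
      finally show ?thesis .
    qed
    then have "liminf (\<lambda>n. \<integral>\<^sup>+\<omega>. (\<Sum>i<K * 2^n. indicator (B n i) \<omega>) \<partial>M) \<le> liminf (\<lambda>n. ennreal (real K * c))"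
      by (intro Liminf_mono always_eventually allI)
    then have "(\<integral>\<^sup>+\<omega>. liminf (\<lambda>n. \<Sum>i<K * 2^n. indicator (B n i) \<omega>) \<partial>M) \<le> ennreal (real K * c)"
      using nn_integral_liminf[of "\<lambda>n \<omega>. \<Sum>i<K * 2^n. indicator (B n i) \<omega>" M, OF meas]
      by (simp add: Liminf_const)
    then have "(\<integral>\<^sup>+\<omega>. liminf (\<lambda>n. \<Sum>i<K * 2^n. indicator (B n i) \<omega>) \<partial>M) \<noteq> \<infinity>"
      by (auto simp: top_unique)
    then have "AE \<omega> in M. liminf (\<lambda>n. \<Sum>i<K * 2^n. indicator (B n i) \<omega> :: ennreal) \<noteq> \<infinity>"
      using meas by (intro nn_integral_noteq_infinite borel_measurable_liminf) auto
    then show ?thesis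
      by (rule AE_mp) (intro AE_I2 impI, simp only: card_eq not_False_eq_True)
  qed
  then have "AE \<omega> in M. \<forall>K::nat. liminf (\<lambda>n. of_nat (card (dyadic_changes (\<lambda>t. \<theta> t \<omega>) n 0 (real K)))) \<noteq> (\<infinity> :: ennreal)"
    by (simp add: AE_all_countable)
  then show ?thesis
  proof (rule AE_mp, intro AE_I2 impI allI)
    fix \<omega> t assume \<omega>: "\<omega> \<in> space M" and t: "0 < (t::real)"
      and fin: "\<forall>K::nat. liminf (\<lambda>n. of_nat (card (dyadic_changes (\<lambda>t. \<theta> t \<omega>) n 0 (real K)))) \<noteq> (\<infinity> :: ennreal)"
    show "\<exists>a j. 0 \<le> a \<and> a < t \<and> (\<forall>s\<in>{a..<t}. \<theta> s \<omega> = j)"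
    proof (rule ccontr)
      assume "\<not> ?thesis"
      then have bad: "\<exists>s\<in>{a..<t}. \<theta> s \<omega> \<noteq> \<theta> a \<omega>" if "0 \<le> a" "a < t" for a
        using that by blast
      obtain K :: nat where K: "t \<le> real K" using real_arch_simple by blast
      have "eventually (\<lambda>n. k \<le> card (dyadic_changes (\<lambda>t. \<theta> t \<omega>) n 0 t)) sequentially" for k
        by (rule dyadic_changes_unbounded[OF right[OF \<omega>] bad order_refl t])
      then have "eventually (\<lambda>n. k \<le> card (dyadic_changes (\<lambda>t. \<theta> t \<omega>) n 0 (real K))) sequentially" for k
      proof (rule eventually_mono)
        fix n assume k: "k \<le> card (dyadic_changes (\<lambda>t. \<theta> t \<omega>) n 0 t)"
        have "dyadic_changes (\<lambda>t. \<theta> t \<omega>) n 0 t \<subseteq> dyadic_changes (\<lambda>t. \<theta> t \<omega>) n 0 (real K)"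
          using K unfolding dyadic_changes_def by force
        then have "card (dyadic_changes (\<lambda>t. \<theta> t \<omega>) n 0 t) \<le> card (dyadic_changes (\<lambda>t. \<theta> t \<omega>) n 0 (real K))"
          by (rule card_mono[OF finite_dyadic_changes])
        with k show "k \<le> card (dyadic_changes (\<lambda>t. \<theta> t \<omega>) n 0 (real K))" by simp
      qed
      then have ge: "of_nat k \<le> liminf (\<lambda>n. of_nat (card (dyadic_changes (\<lambda>t. \<theta> t \<omega>) n 0 (real K))) :: ennreal)" for k
        by (intro Liminf_bounded) (auto elim!: eventually_mono)
      obtain k where "liminf (\<lambda>n. of_nat (card (dyadic_changes (\<lambda>t. \<theta> t \<omega>) n 0 (real K))) :: ennreal) < of_nat k"
        using ennreal_Ex_less_of_nat fin by (metis infinity_ennreal_def less_top)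
      with ge[of k] show False by simp
    qed
  qed
qed

subsection \<open>The closed-loop Markov-jumping system\<close>

lemma AE_step_path:
  assumes M: "prob_space M" and \<theta>: "markov_process M r P \<theta>" and r: "1 \<le> r"
    and P: "transition_probabilities r \<tau> P"
    and nonneg: "\<And>i j t. i \<in> {1..r} \<Longrightarrow> j \<in> {1..r} \<Longrightarrow> t \<ge> 0 \<Longrightarrow> \<tau> i j t \<ge> 0"
    and bound: "\<And>i t. i \<in> {1..r} \<Longrightarrow> t \<ge> 0 \<Longrightarrow> (\<Sum>l\<in>{1..r} - {i}. \<tau> i l t) \<le> \<tau>s"
  shows "AE \<omega> in M. step_path (\<lambda>t. \<theta> t \<omega>)"
proof -
  have right: "\<exists>b>s. \<forall>u\<in>{s..<b}. \<theta> u \<omega> = \<theta> s \<omega>" if "\<omega> \<in> space M" "0 \<le> s" for \<omega> s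
  proof -
    have "continuous (at_right s) (\<lambda>t. \<theta> t \<omega>)" using \<theta> that by (simp add: markov_process_def)
    then have "eventually (\<lambda>u. \<theta> u \<omega> = \<theta> s \<omega>) (at_right s)"
      by (simp add: continuous_within tendsto_discrete)
    then obtain b where b: "s < b" "\<And>u. s < u \<Longrightarrow> u < b \<Longrightarrow> \<theta> u \<omega> = \<theta> s \<omega>"
      unfolding eventually_at_right_field by blast
    have "\<theta> u \<omega> = \<theta> s \<omega>" if "u \<in> {s..<b}" for u
      using b(2)[of u] that by (cases "u = s") auto
    with b(1) show ?thesis by blast
  qed
  \<comment> \<open>The sign of \<tau>s is read off from the rates out of mode 1, which exists
    because r \<ge> 1.\<close>
  have "0 \<le> (\<Sum>l\<in>{1..r} - {1}. \<tau> 1 l 0)" using nonneg r by (intro sum_nonneg) auto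
  also have "\<dots> \<le> \<tau>s" using bound[of 1 0] r by simp
  finally have "0 \<le> \<tau>s" .
  then have "AE \<omega> in M. \<forall>t>0. \<exists>a j. 0 \<le> a \<and> a < t \<and> (\<forall>s\<in>{a..<t}. \<theta> s \<omega> = j)"
    using change_probability[OF M \<theta> _ _ stay_probability[OF P nonneg bound]]
    by (intro AE_left_constant[OF M \<theta> right]) auto
  then show ?thesis
    by (rule AE_mp) (use right in \<open>auto simp: step_path_def\<close>)
qed

text \<open>The conditional expectation given the initial data is the integral under M conditioned
  on \<theta> 0 = j, for modes of positive initial probability. Uniqueness is claimed for t \<ge> 0
  because \<open>path_solution\<close> constrains only those times.\<close>

theorem lemma1:
  fixes M :: "'w measure"
    and \<theta> :: "real \<Rightarrow> 'w \<Rightarrow> nat"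
    and r :: nat
    and P :: "nat \<Rightarrow> nat \<Rightarrow> real \<Rightarrow> real \<Rightarrow> real"
    and \<tau> :: "nat \<Rightarrow> nat \<Rightarrow> real \<Rightarrow> real"
    and \<tau>star D :: real
    and \<delta> :: "nat \<Rightarrow> coeffs"
    and \<delta>0 :: coeffs
    and lam_lo lam_hi mu_lo mu_hi sigp_lo sigp_hi sigm_lo sigm_hi phi_lo phi_hi :: real
    and Kvu Kvv q1 q2 :: "real \<Rightarrow> real \<Rightarrow> real"
    and p :: "real \<Rightarrow> real"
    and u0 v0 \<eta>0 :: L2
  assumes "prob_space M"
    and "r \<ge> 1"
    and "\<And>i j t. i \<in> {1..r} \<Longrightarrow> j \<in> {1..r} \<Longrightarrow> t \<ge> 0 \<Longrightarrow> \<tau> i j t \<ge> 0"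
    and "\<And>i t. i \<in> {1..r} \<Longrightarrow> t \<ge> 0 \<Longrightarrow> \<tau> i i t = 0"
    and "\<And>i t. i \<in> {1..r} \<Longrightarrow> t \<ge> 0 \<Longrightarrow> (\<Sum>l\<in>{1..r} - {i}. \<tau> i l t) \<le> \<tau>star"
    and "transition_probabilities r \<tau> P"
    and "markov_process M r P \<theta>"
    and "0 < lam_lo" and "0 < mu_lo"
    and "\<And>j. j \<in> {1..r} \<Longrightarrow> lam (\<delta> j) \<in> {lam_lo..lam_hi}"
    and "\<And>j. j \<in> {1..r} \<Longrightarrow> mu (\<delta> j) \<in> {mu_lo..mu_hi}"
    and "\<And>j. j \<in> {1..r} \<Longrightarrow> sigp (\<delta> j) \<in> {sigp_lo..sigp_hi}"
    and "\<And>j. j \<in> {1..r} \<Longrightarrow> sigm (\<delta> j) \<in> {sigm_lo..sigm_hi}"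
    and "\<And>j. j \<in> {1..r} \<Longrightarrow> phi (\<delta> j) \<in> {phi_lo..phi_hi}"
    and "D > 0"
    and "lam \<delta>0 > 0" and "mu \<delta>0 > 0" and "phi \<delta>0 \<noteq> 0"
    and "backstepping_kernels \<delta>0 Kvu Kvv"
    and "predictor_kernels D \<delta>0 Kvu Kvv q1 q2 p"
  shows "\<exists>X. solution M (\<lambda>j. closed_loop_op D p q1 q2 (\<delta> j)) \<theta> (u0, v0, \<eta>0) X \<and>
           (\<forall>Y. solution M (\<lambda>j. closed_loop_op D p q1 q2 (\<delta> j)) \<theta> (u0, v0, \<eta>0) Y \<longrightarrow> (AE \<omega> in M. \<forall>t\<ge>0. Y t \<omega> = X t \<omega>)) \<and>
           (\<forall>j\<in>{1..r}. measure M {\<omega>\<in>space M. \<theta> 0 \<omega> = j} > 0 \<longrightarrow>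
              (\<forall>t\<ge>0. integrable (uniform_measure M {\<omega>\<in>space M. \<theta> 0 \<omega> = j})
                        (\<lambda>\<omega>. (norm (X t \<omega>))\<^sup>2)))"
proof -
  interpret prob_space M by fact
  note P = assms(6) and \<theta> = assms(7)
  obtain \<kappa> where \<kappa>: "\<And>u v \<eta>. sq_integrable u \<Longrightarrow> sq_integrable v \<Longrightarrow> sq_integrable \<eta> \<Longrightarrow>
      control p q1 q2 u v \<eta> = inner \<kappa> (abs_L2 u, abs_L2 v, abs_L2 \<eta>)"
    using control_eq_inner[OF assms(20)] by blast
  define phih where "phih = max \<bar>phi_lo\<bar> \<bar>phi_hi\<bar>"
  define s where "s = \<bar>sigp_lo\<bar> + \<bar>sigp_hi\<bar> + \<bar>sigm_lo\<bar> + \<bar>sigm_hi\<bar>"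
  have hi: "0 \<le> lam_hi" "0 \<le> mu_hi"
    using assms(8,9) assms(10)[of 1] assms(11)[of 1] \<open>r \<ge> 1\<close> by auto
  interpret cb: coupled_bounds \<kappa> D lam_hi mu_lo mu_hi phih s
    by unfold_locales (use assms(9,15) hi in \<open>auto simp: s_def\<close>)
  define A where "A j = loop_op \<kappa> D (\<delta> j)" for j
  have A: "closed_loop_op D p q1 q2 (\<delta> j) = A j" for j
    unfolding A_def by (rule closed_loop_op_eq[OF \<kappa>])
  have diss: "m_dissipative (A j) cb.N (cb.b * cb.g) cb.w cb.h0" if j: "j \<in> {1..r}" for j
    unfolding A_def
  proof (rule cb.m_dissipative_loop_op)
    show "cb.admissible (\<delta> j)"
      unfolding cb.admissible_def
      using assms(8) assms(10-14)[OF j] by (auto simp: phih_def s_def)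
  qed
  define T where "T j = m_dissipative.T (A j) cb.h0" for j
  have gen: "generator (T j) = A j" if "j \<in> {1..r}" for j
    unfolding T_def by (rule m_dissipative.generator_T[OF diss[OF that]])
  have uniq: "S t x = T j t x" if "j \<in> {1..r}" "C0_semigroup S" "generator S = A j" "0 \<le> t" for S t x j
    unfolding T_def by (rule m_dissipative.semigroup_unique[OF diss[OF that(1)] that(2-4)])
  interpret sw: switched_semigroups T "{1..r}" cb.N "cb.b * cb.g" cb.w
  proof
    show "C0_semigroup (T j)" if "j \<in> {1..r}" for j
      unfolding T_def by (rule m_dissipative.C0_semigroup_T[OF diss[OF that]])
    show "cb.N (T j t x) \<le> exp (cb.w * t) * cb.N x" if "j \<in> {1..r}" "0 \<le> t" for j t x
      unfolding T_def by (rule m_dissipative.N_T[OF diss[OF that(1)] that(2)])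
  qed (use cb.norm_le_N cb.N_le_norm cb.w_nonneg in auto)
  define x0 where "x0 = (u0, v0, \<eta>0)"
  have mode: "\<theta> t \<omega> \<in> {1..r}" if "\<omega> \<in> space M" "0 \<le> t" for t \<omega>
    using \<theta> that by (simp add: markov_process_def)
  have meas: "\<theta> t \<in> measurable M (count_space UNIV)" if "0 \<le> t" for t
    using \<theta> that by (simp add: markov_process_def)
  have "AE \<omega> in M. step_path (\<lambda>t. \<theta> t \<omega>)"
    by (rule AE_step_path[OF assms(1) \<theta> assms(2) P assms(3,5)])
  \<comment> \<open>The exceptional paths need not form a measurable set, so they are enclosed in a
    null set belonging to M.\<close>
  then obtain Z where Z: "Z \<in> null_sets M" "\<And>\<omega>. \<omega> \<in> space M \<Longrightarrow> \<omega> \<notin> Z \<Longrightarrow> step_path (\<lambda>t. \<theta> t \<omega>)"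
    by (elim AE_E) (auto simp: null_sets_def)
  \<comment> \<open>The value 0 on Z makes the norm of X a limit of measurable functions at every
    sample point, and the deterministic bound holds there as well.\<close>
  define X where "X t \<omega> = (if \<omega> \<in> Z then 0 else sw.evolution x0 (\<lambda>t. \<theta> t \<omega>) t)" for t \<omega>
  have lim: "(\<lambda>n. sw.approx x0 (\<lambda>t. \<theta> t \<omega>) n t) \<longlonglongrightarrow> X t \<omega>" if "\<omega> \<in> space M" "\<omega> \<notin> Z" "0 \<le> t" for t \<omega>
    using sw.evolution_LIMSEQ[OF mode[OF that(1)] Z(2)[OF that(1,2)] that(3)] that(2) by (simp add: X_def)
  have notZ: "AE \<omega> in M. \<omega> \<notin> Z" by (rule AE_not_in[OF Z(1)])
  have sol: "solution M A \<theta> x0 X"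
    unfolding solution_def
  proof (rule AE_mp[OF notZ], intro AE_I2 impI)
    fix \<omega> assume \<omega>: "\<omega> \<in> space M" "\<omega> \<notin> Z"
    show "path_solution A (\<lambda>t. \<theta> t \<omega>) x0 (\<lambda>t. X t \<omega>)"
      using sw.path_solution_evolution[OF mode[OF \<omega>(1)] Z(2)[OF \<omega>] gen] \<omega>(2) by (simp add: X_def)
  qed
  have unique: "AE \<omega> in M. \<forall>t\<ge>0. Y t \<omega> = X t \<omega>" if "solution M A \<theta> x0 Y" for Y
    using that[unfolded solution_def] notZ
  proof (rule AE_mp[OF AE_conjI], intro AE_I2 impI allI)
    fix \<omega> t assume \<omega>: "\<omega> \<in> space M" and *: "path_solution A (\<lambda>t. \<theta> t \<omega>) x0 (\<lambda>t. Y t \<omega>) \<and> \<omega> \<notin> Z" and t: "0 \<le> (t::real)"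
    have "Y t \<omega> = sw.evolution x0 (\<lambda>t. \<theta> t \<omega>) t"
    proof (rule sw.path_solution_unique[where A=A and m="\<lambda>t. \<theta> t \<omega>" and y="\<lambda>t. Y t \<omega>"])
      show "\<theta> t \<omega> \<in> {1..r}" if "0 \<le> t" for t by (rule mode[OF \<omega> that])
      show "step_path (\<lambda>t. \<theta> t \<omega>)" using Z(2) \<omega> * by blast
    qed (use * t uniq in blast)+
    then show "Y t \<omega> = X t \<omega>" using * by (simp add: X_def)
  qed
  have int: "integrable (uniform_measure M {\<omega>\<in>space M. \<theta> 0 \<omega> = j}) (\<lambda>\<omega>. (norm (X t \<omega>))\<^sup>2)"
    if j: "measure M {\<omega>\<in>space M. \<theta> 0 \<omega> = j} > 0" and t: "0 \<le> t" for j t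
  proof -
    define Mj where "Mj = uniform_measure M {\<omega>\<in>space M. \<theta> 0 \<omega> = j}"
    have "prob_space Mj"
      unfolding Mj_def by (rule prob_space_uniform_measure) (use j in \<open>auto simp: emeasure_eq_measure\<close>)
    then interpret Mj: prob_space Mj .
    have X_meas: "(\<lambda>\<omega>. norm (X t \<omega>)) \<in> borel_measurable M"
    proof (rule borel_measurable_LIMSEQ_real)
      show "(\<lambda>\<omega>. if \<omega> \<in> Z then 0 else norm (sw.approx x0 (\<lambda>t. \<theta> t \<omega>) n t)) \<in> borel_measurable M" for n
      proof (rule measurable_If_set)
        show "(\<lambda>\<omega>. norm (sw.approx x0 (\<lambda>t. \<theta> t \<omega>) n t)) \<in> borel_measurable M"
          by (rule measurable_compose[OF sw.measurable_approx[OF meas]]) simp_all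
        show "Z \<inter> space M \<in> sets M" using Z(1) by auto
      qed simp
      show "(\<lambda>n. if \<omega> \<in> Z then 0 else norm (sw.approx x0 (\<lambda>t. \<theta> t \<omega>) n t)) \<longlonglongrightarrow> norm (X t \<omega>)"
        if "\<omega> \<in> space M" for \<omega>
      proof (cases "\<omega> \<in> Z")
        case True
        then show ?thesis by (simp add: X_def)
      next
        case False
        then show ?thesis using tendsto_norm[OF lim[OF that False t]] by simp
      qed
    qed
    have X_bound: "norm (X t \<omega>) \<le> exp (cb.w * t) * cb.N x0" if \<omega>: "\<omega> \<in> space M" for \<omega>
    proof (cases "\<omega> \<in> Z")
      case True
      then show ?thesis by (simp add: X_def cb.N_nonneg)
    next
      case False
      show ?thesis
      proof (rule LIMSEQ_le_const2[OF tendsto_norm[OF lim[OF \<omega> False t]]])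
        show "\<exists>N. \<forall>n\<ge>N. norm (sw.approx x0 (\<lambda>t. \<theta> t \<omega>) n t) \<le> exp (cb.w * t) * cb.N x0"
        proof (intro exI allI impI)
          show "norm (sw.approx x0 (\<lambda>t. \<theta> t \<omega>) n t) \<le> exp (cb.w * t) * cb.N x0" for n
            by (rule order.trans[OF cb.norm_le_N sw.N_approx]) (use mode[OF \<omega>] t in auto)
        qed
      qed
    qed
    have sets: "sets Mj = sets M" and space: "space Mj = space M"
      by (simp_all add: Mj_def)
    have "integrable Mj (\<lambda>\<omega>. (norm (X t \<omega>))\<^sup>2)"
    proof (rule Mj.integrable_const_bound[where B="(exp (cb.w * t) * cb.N x0)\<^sup>2"])
      show "AE \<omega> in Mj. norm ((norm (X t \<omega>))\<^sup>2) \<le> (exp (cb.w * t) * cb.N x0)\<^sup>2"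
        by (rule AE_I2) (use X_bound in \<open>auto simp: space intro!: power_mono\<close>)
      have "(\<lambda>\<omega>. (norm (X t \<omega>))\<^sup>2) \<in> borel_measurable M" using X_meas by (rule borel_measurable_power)
      then show "(\<lambda>\<omega>. (norm (X t \<omega>))\<^sup>2) \<in> borel_measurable Mj"
        by (simp add: measurable_cong_sets[OF sets refl])
    qed
    then show ?thesis by (simp only: Mj_def)
  qed
  show ?thesis
    unfolding A x0_def[symmetric]
    by (intro exI[of _ X] conjI allI impI ballI sol unique int)
qed

end
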